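(* Let $E=\mathbb{Q}(i)$ and for $n\in\mathbb{Z}$ let $\chi_n$ be the Hecke character of $E$ defined on nonzero ideals $(a)$ of $\mathbb{Z}[i]$ by $\chi_n((a))=\big(a/|a|\big)^{4n}$. Let $L(s,\chi_n)=\sum_{\mathfrak{a}}\chi_n(\mathfrak{a})N(\mathfrak{a})^{-s}$ (sum over all nonzero integral ideals $\mathfrak{a}$ of $\mathbb{Z}[i]$, $\mathrm{Re}(s)>1$) be the Hecke $L$-function. Consider the double Dirichlet series $$D_E(s,w)=L(s,\chi_0)+\sum_{n\in\mathbb{Z}\setminus\{0\}}L(s,\chi_n)\,|n|^{-w},$$ defined for $(s,w)\in\mathbb{C}^2$ with $\mathrm{Re}(s)$ and $\mathrm{Re}(w)$ sufficiently large. Then $D_E(s,w)$ extends to a meromorphic function on $\mathbb{C}^2$.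
   Context: $N(\mathfrak{a})$ denotes the absolute norm of the ideal $\mathfrak{a}$. The character $\chi_n$ is well defined since $(i^k)^{4n}=1$ for every unit $i^k$. *)

theory Defs
  imports "HOL-Complex_Analysis.Complex_Analysis" "HOL-Algebra.Algebra"
begin

definition gauss_ints :: "complex set" where
  "gauss_ints = {z. Re z \<in> \<int> \<and> Im z \<in> \<int>}"

definition gauss_ring :: "complex ring" where
  "gauss_ring = \<lparr>carrier = gauss_ints, monoid.mult = (*), one = 1, ring.zero = 0, add = (+)\<rparr>"

definition nonzero_gauss_ideals :: "complex set set" where
  "nonzero_gauss_ideals = {I. ideal I gauss_ring \<and> I \<noteq> {0}}"

definition ideal_norm :: "complex set \<Rightarrow> nat" where
  "ideal_norm I = card (carrier (gauss_ring Quot I))"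

text \<open>
  The value does not depend on the generator (see \<open>hecke_char_principal\<close> below),
  and every ideal of \<open>\<int>[i]\<close> is principal.
\<close>
definition hecke_char :: "int \<Rightarrow> complex set \<Rightarrow> complex" where
  "hecke_char n I =
     (THE c. \<exists>a\<in>gauss_ints - {0}. I = PIdl\<^bsub>gauss_ring\<^esub> a \<and> c = (a / of_real (cmod a)) powi (4 * n))"

definition hecke_L_term :: "int \<Rightarrow> complex \<Rightarrow> complex set \<Rightarrow> complex" where
  "hecke_L_term n s I = hecke_char n I * of_nat (ideal_norm I) powr (- s)"

definition hecke_L :: "int \<Rightarrow> complex \<Rightarrow> complex" where
  "hecke_L n s = (\<Sum>\<^sub>\<infinity>I\<in>nonzero_gauss_ideals. hecke_L_term n s I)"

definition double_term :: "complex \<Rightarrow> complex \<Rightarrow> int \<Rightarrow> complex" where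
  "double_term s w n = hecke_L n s * of_int \<bar>n\<bar> powr (- w)"

definition double_series :: "complex \<Rightarrow> complex \<Rightarrow> complex" where
  "double_series s w = hecke_L 0 s + (\<Sum>\<^sub>\<infinity>n\<in>UNIV - {0}. double_term s w n)"

text \<open>Complex differentiability on an open set: the derivative is \<open>\<complex>\<close>-linear.\<close>
definition holomorphic2_on :: "(complex \<times> complex \<Rightarrow> complex) \<Rightarrow> (complex \<times> complex) set \<Rightarrow> bool" where
  "holomorphic2_on f U \<longleftrightarrow> open U \<and>
     (\<forall>p\<in>U. \<exists>a b. (f has_derivative (\<lambda>(u, v). a * u + b * v)) (at p))"

text \<open>
  Locally a quotient of holomorphic functions with denominator not identically zero. As for
  the one-variable \<open>meromorphic_on\<close>, the function is total and its values on the zero set of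
  the local denominators are irrelevant.
\<close>
definition meromorphic2_on :: "(complex \<times> complex \<Rightarrow> complex) \<Rightarrow> (complex \<times> complex) set \<Rightarrow> bool" where
  "meromorphic2_on f U \<longleftrightarrow> open U \<and>
     (\<forall>p\<in>U. \<exists>V g h. p \<in> V \<and> V \<subseteq> U \<and> connected V \<and>
        holomorphic2_on g V \<and> holomorphic2_on h V \<and> (\<exists>q\<in>V. h q \<noteq> 0) \<and>
        (\<forall>q\<in>V. h q \<noteq> 0 \<longrightarrow> f q = g q / h q))"

lemma gauss_ring_simps [simp]:
  "carrier gauss_ring = gauss_ints" "x \<otimes>\<^bsub>gauss_ring\<^esub> y = x * y" "\<one>\<^bsub>gauss_ring\<^esub> = 1"
  "\<zero>\<^bsub>gauss_ring\<^esub> = 0" "x \<oplus>\<^bsub>gauss_ring\<^esub> y = x + y"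
  by (simp_all add: gauss_ring_def)

lemma cring_gauss_ring: "cring gauss_ring"
proof (rule cringI)
  show "abelian_group gauss_ring"
  proof (rule abelian_groupI)
    fix x assume "x \<in> carrier gauss_ring"
    then have "- x \<in> gauss_ints" by (auto simp: gauss_ints_def)
    then show "\<exists>y\<in>carrier gauss_ring. y \<oplus>\<^bsub>gauss_ring\<^esub> x = \<zero>\<^bsub>gauss_ring\<^esub>"
      by (intro bexI[of _ "- x"]) auto
  qed (auto simp: gauss_ints_def)
  show "Group.comm_monoid gauss_ring"
    by (rule comm_monoidI) (auto simp: gauss_ints_def mult_ac)
qed (auto simp: algebra_simps)

lemma gauss_unit_power4:
  assumes "u \<in> gauss_ints" "v \<in> gauss_ints" "u * v = 1"
  shows "u ^ 4 = 1"
proof -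
  obtain a b where ab: "Re u = of_int a" "Im u = of_int b"
    using assms(1) by (auto simp: gauss_ints_def elim!: Ints_cases)
  obtain c d where cd: "Re v = of_int c" "Im v = of_int d"
    using assms(2) by (auto simp: gauss_ints_def elim!: Ints_cases)
  have "(cmod u)\<^sup>2 * (cmod v)\<^sup>2 = (cmod (u * v))\<^sup>2"
    unfolding norm_mult power_mult_distrib ..
  then have "real_of_int ((a\<^sup>2 + b\<^sup>2) * (c\<^sup>2 + d\<^sup>2)) = of_int 1"
    unfolding assms(3) by (simp add: cmod_power2 ab cd)
  then have prod: "(a\<^sup>2 + b\<^sup>2) * (c\<^sup>2 + d\<^sup>2) = 1"
    by (simp only: of_int_eq_iff)
  have "a\<^sup>2 + b\<^sup>2 \<noteq> 0"
  proof
    assume "a\<^sup>2 + b\<^sup>2 = 0"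
    with prod show False by (simp only: mult_zero_left)
  qed
  then have "0 < a\<^sup>2 + b\<^sup>2"
    using zero_le_power2[of a] zero_le_power2[of b] by linarith
  with prod have 1: "a\<^sup>2 + b\<^sup>2 = 1"
    using pos_zmult_eq_1_iff by blast
  have u: "u = Complex (of_int a) (of_int b)"
    using ab by (simp add: complex_eq_iff)
  have "a\<^sup>2 \<le> 1\<^sup>2" "b\<^sup>2 \<le> 1\<^sup>2"
    using 1 zero_le_power2[of a] zero_le_power2[of b] unfolding power_one by linarith+
  then have "\<bar>a\<bar> \<le> 1" "\<bar>b\<bar> \<le> 1"
    using abs_le_square_iff[of a 1] abs_le_square_iff[of b 1] by simp_all
  then have "a \<in> {-1, 0, 1}" "b \<in> {-1, 0, 1}"
    by auto
  with 1 show ?thesis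
    unfolding u by (auto simp: complex_eq_iff eval_nat_numeral)
qed

lemma hecke_char_principal:
  assumes "a \<in> gauss_ints" "a \<noteq> 0"
  shows "hecke_char n (PIdl\<^bsub>gauss_ring\<^esub> a) = (a / of_real (cmod a)) powi (4 * n)"
  unfolding hecke_char_def
proof (rule the_equality)
  show "\<exists>a'\<in>gauss_ints - {0}. PIdl\<^bsub>gauss_ring\<^esub> a = PIdl\<^bsub>gauss_ring\<^esub> a' \<and>
      (a / of_real (cmod a)) powi (4 * n) = (a' / of_real (cmod a')) powi (4 * n)"
    using assms by blast
next
  fix c
  assume "\<exists>a'\<in>gauss_ints - {0}. PIdl\<^bsub>gauss_ring\<^esub> a = PIdl\<^bsub>gauss_ring\<^esub> a' \<and>
      c = (a' / of_real (cmod a')) powi (4 * n)"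
  then obtain b where b: "b \<in> gauss_ints" "b \<noteq> 0"
    "PIdl\<^bsub>gauss_ring\<^esub> a = PIdl\<^bsub>gauss_ring\<^esub> b" "c = (b / of_real (cmod b)) powi (4 * n)"
    by auto
  interpret cring gauss_ring by (rule cring_gauss_ring)
  have "a \<in> PIdl\<^bsub>gauss_ring\<^esub> b" "b \<in> PIdl\<^bsub>gauss_ring\<^esub> a"
    using cgenideal_self[of a] cgenideal_self[of b] assms b by simp_all
  then obtain u v where uv: "u \<in> gauss_ints" "v \<in> gauss_ints" "a = u * b" "b = v * a"
    unfolding cgenideal_def gauss_ring_simps by blast
  have "a = (u * v) * a"
    by (subst (1) uv(3), subst uv(4)) (rule mult.assoc[symmetric])
  then have "u * v = 1"
    using assms(2) mult_cancel_right1[of a "u * v"] by blast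
  with uv have u4: "u ^ 4 = 1"
    by (blast intro: gauss_unit_power4)
  then have "cmod u ^ 4 = 1"
    by (simp flip: norm_power)
  then have u1: "cmod u = 1"
    using power_eq_iff_eq_base[of 4 "cmod u" 1] by simp
  have "(a / of_real (cmod a)) ^ 4 = (b / of_real (cmod b)) ^ 4"
    unfolding uv(3) norm_mult u1 power_divide power_mult_distrib u4 by simp
  then have "(a / of_real (cmod a)) powi 4 = (b / of_real (cmod b)) powi 4"
    by (simp only: power_int_numeral)
  then show "c = (a / of_real (cmod a)) powi (4 * n)"
    unfolding b(4) power_int_mult by (rule arg_cong[OF sym])
qed

end

theory Submission imports Defs begin

text \<open>
  Opening the sums over the lattice, \<open>D\<^sub>E\<close> becomes, up to zeta factors,
  \<open>\<Sum>\<^sub>j j\<^sup>-\<^sup>w \<Lambda>\<^sub>j(s)\<close> with \<open>\<Lambda>\<^sub>j(s)\<close> the sum of \<open>|a|\<^sup>-\<^sup>2\<^sup>s (a / cnj a)\<^sup>j\<close> over the lattice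
  points of the upper half plane; odd \<open>j\<close> may be included, since rotation by \<open>\<i>\<close> shows that they
  contribute a zeta factor only.

  Repeated integration by parts along the rows \<open>Im a = n\<close> replaces each row sum by an integral
  homogeneous in \<open>n\<close>, up to an error of arbitrary order in \<open>1 / n\<close>. This continues \<open>\<Lambda>\<^sub>j(s)\<close> in \<open>s\<close>
  with polynomial growth in \<open>j\<close>, hence \<open>D\<^sub>E\<close> to all \<open>s\<close> as long as \<open>Re w\<close> is large.

  To move \<open>w\<close> to the left, replace \<open>j\<^sup>-\<^sup>w\<close> by the coefficients \<open>\<beta>\<^sub>j(w)\<close> of the binomial series of
  \<open>(1 - z) powr (w - 1)\<close>. As \<open>1 - a / cnj a\<close> is a multiple of \<open>Im a / cnj a\<close>, the sum
  \<open>\<Sum>\<^sub>j \<beta>\<^sub>j(w) \<Lambda>\<^sub>j(s)\<close> is again a lattice sum with explicit row integrals, so it continues to all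
  \<open>(s, w)\<close>. The asymptotic expansion of \<open>\<Gamma>(1 - w) \<beta>\<^sub>j(w)\<close> in the powers \<open>j\<^sup>-\<^sup>w\<^sup>-\<^sup>l\<close> expresses it through
  the series at \<open>w, w + 1, \<dots>\<close> and a remainder that continues by the first step, which allows
  induction on strips in \<open>w\<close>.
\<close>

subsection \<open>Holomorphic functions of two variables\<close>

text \<open>Sums over \<open>k\<close> involve infinitely many continued functions, so their
  denominators must not depend on \<open>k\<close> and their growth in \<open>k\<close> must be
  polynomial. Both are built into the exponents \<open>p = k - s\<close> and
  \<open>q = - k - s - v\<close>: the poles of a row integral depend on
  \<open>p + q = - 2 * s - v\<close> alone, and the size of \<open>kern p q\<close> on
  \<open>p + q\<close> and \<open>Im (p - q) = Im v\<close> alone. Powers of \<open>k\<close> enter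
  only through the polynomial factors of the integrations by parts. For \<open>v = 0\<close> their
  degree is fixed by the range of \<open>s\<close>, so one decay rate in \<open>k\<close> serves in
  every strip of \<open>w\<close>. The binomial coefficients fit because summing them trades the sum
  over \<open>k\<close> for the value \<open>v = w - 1\<close> of a parameter in which the lattice
  sums are continued anyway. The price is the factor \<open>rGamma (1 - w)\<close>, which vanishes
  at the positive integers and hence inside the region of convergence. Continuations are therefore
  kept as pairs with \<open>g = h * f\<close>, where \<open>h\<close> must be nonzero only for
  non-integral \<open>w\<close>.\<close>

lemma holomorphic2_onI:
  assumes "open U" and "\<And>s w. (s, w) \<in> U \<Longrightarrow> \<exists>a b. (f has_derivative (\<lambda>(u, v). a * u + b * v)) (at (s, w))"
  shows "holomorphic2_on f U"
  using assms unfolding holomorphic2_on_def by auto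

lemma holomorphic2_onD:
  assumes "holomorphic2_on f U" "p \<in> U"
  obtains a b where "(f has_derivative (\<lambda>(u, v). a * u + b * v)) (at p)"
  using assms unfolding holomorphic2_on_def by blast

lemma holomorphic2_on_open: "holomorphic2_on f U \<Longrightarrow> open U"
  by (simp add: holomorphic2_on_def)

lemma holomorphic2_on_subset:
  "holomorphic2_on f U \<Longrightarrow> open V \<Longrightarrow> V \<subseteq> U \<Longrightarrow> holomorphic2_on f V"
  unfolding holomorphic2_on_def by blast

lemma holomorphic2_on_imp_continuous_on: "holomorphic2_on f U \<Longrightarrow> continuous_on U f"
  by (meson continuous_at_imp_continuous_on has_derivative_continuous holomorphic2_on_def)

lemma holomorphic2_on_const: "open U \<Longrightarrow> holomorphic2_on (\<lambda>_. c) U"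
  by (rule holomorphic2_onI) (auto intro!: exI[of _ 0] has_derivative_eq_rhs[OF has_derivative_const])

lemma holomorphic2_on_fst: "open U \<Longrightarrow> holomorphic2_on fst U"
  by (rule holomorphic2_onI, assumption, rule exI[of _ 1], rule exI[of _ 0])
    (auto intro!: has_derivative_eq_rhs[OF has_derivative_fst[OF has_derivative_ident]])

lemma holomorphic2_on_snd: "open U \<Longrightarrow> holomorphic2_on snd U"
  by (rule holomorphic2_onI, assumption, rule exI[of _ 0], rule exI[of _ 1])
    (auto intro!: has_derivative_eq_rhs[OF has_derivative_snd[OF has_derivative_ident]])

lemma holomorphic2_on_add:
  assumes "holomorphic2_on f U" "holomorphic2_on g U"
  shows "holomorphic2_on (\<lambda>p. f p + g p) U"
proof (rule holomorphic2_onI[OF holomorphic2_on_open[OF assms(1)]])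
  fix s w assume "(s, w) \<in> U"
  then obtain a b c d where "(f has_derivative (\<lambda>(u, v). a * u + b * v)) (at (s, w))"
      "(g has_derivative (\<lambda>(u, v). c * u + d * v)) (at (s, w))"
    by (rule holomorphic2_onD[OF assms(1)], rule holomorphic2_onD[OF assms(2)])
  from has_derivative_add[OF this]
  show "\<exists>a b. ((\<lambda>p. f p + g p) has_derivative (\<lambda>(u, v). a * u + b * v)) (at (s, w))"
    by (intro exI[of _ "a + c"] exI[of _ "b + d"]) (erule has_derivative_eq_rhs, auto simp: algebra_simps)
qed

lemma holomorphic2_on_mult:
  assumes "holomorphic2_on f U" "holomorphic2_on g U"
  shows "holomorphic2_on (\<lambda>p. f p * g p) U"
proof (rule holomorphic2_onI[OF holomorphic2_on_open[OF assms(1)]])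
  fix s w assume "(s, w) \<in> U"
  then obtain a b c d where "(f has_derivative (\<lambda>(u, v). a * u + b * v)) (at (s, w))"
      "(g has_derivative (\<lambda>(u, v). c * u + d * v)) (at (s, w))"
    by (rule holomorphic2_onD[OF assms(1)], rule holomorphic2_onD[OF assms(2)])
  from has_derivative_mult[OF this]
  show "\<exists>a b. ((\<lambda>p. f p * g p) has_derivative (\<lambda>(u, v). a * u + b * v)) (at (s, w))"
    by (intro exI[of _ "f (s,w) * c + a * g (s,w)"] exI[of _ "f (s,w) * d + b * g (s,w)"])
      (erule has_derivative_eq_rhs, auto simp: algebra_simps)
qed

lemma holomorphic2_on_minus:
  assumes "holomorphic2_on f U"
  shows "holomorphic2_on (\<lambda>p. - f p) U"
  using holomorphic2_on_mult[OF holomorphic2_on_const[OF holomorphic2_on_open[OF assms], of "-1"] assms]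
  by simp

lemma holomorphic2_on_diff:
  assumes "holomorphic2_on f U" "holomorphic2_on g U"
  shows "holomorphic2_on (\<lambda>p. f p - g p) U"
  using holomorphic2_on_add[OF assms(1) holomorphic2_on_minus[OF assms(2)]] by simp

lemma holomorphic2_on_prod:
  assumes "open U" "\<And>i. i \<in> I \<Longrightarrow> holomorphic2_on (f i) U"
  shows "holomorphic2_on (\<lambda>p. \<Prod>i\<in>I. f i p) U"
  using assms(2)
  by (induction I rule: infinite_finite_induct)
    (auto intro!: holomorphic2_on_mult holomorphic2_on_const assms(1))

lemma holomorphic2_on_compose1:
  assumes g: "holomorphic2_on g U" and f: "f holomorphic_on S" and S: "open S" and gS: "\<And>p. p \<in> U \<Longrightarrow> g p \<in> S"
  shows "holomorphic2_on (\<lambda>p. f (g p)) U"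
proof (rule holomorphic2_onI[OF holomorphic2_on_open[OF g]])
  fix s w assume sw: "(s, w) \<in> U"
  then obtain a b where ab: "(g has_derivative (\<lambda>(u, v). a * u + b * v)) (at (s, w))"
    by (rule holomorphic2_onD[OF g])
  have "(f has_field_derivative deriv f (g (s, w))) (at (g (s, w)))"
    using f S gS[OF sw] holomorphic_derivI by blast
  then have "(f has_derivative (*) (deriv f (g (s, w)))) (at (g (s, w)))"
    by (simp add: has_field_derivative_def)
  from diff_chain_at[OF ab this]
  show "\<exists>a b. ((\<lambda>p. f (g p)) has_derivative (\<lambda>(u, v). a * u + b * v)) (at (s, w))"
    by (intro exI[of _ "deriv f (g (s, w)) * a"] exI[of _ "deriv f (g (s, w)) * b"])
      (auto elim!: has_derivative_eq_rhs simp: o_def algebra_simps fun_eq_iff)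
qed

lemma holomorphic2_on_compose2:
  assumes f: "holomorphic2_on f V" and g: "holomorphic2_on g U" and h: "holomorphic2_on h U"
    and V: "\<And>p. p \<in> U \<Longrightarrow> (g p, h p) \<in> V"
  shows "holomorphic2_on (\<lambda>p. f (g p, h p)) U"
proof (rule holomorphic2_onI[OF holomorphic2_on_open[OF g]])
  fix s w assume sw: "(s, w) \<in> U"
  then obtain a b c d where "(g has_derivative (\<lambda>(u, v). a * u + b * v)) (at (s, w))"
      "(h has_derivative (\<lambda>(u, v). c * u + d * v)) (at (s, w))"
    by (rule holomorphic2_onD[OF g], rule holomorphic2_onD[OF h])
  from has_derivative_Pair[OF this]
  have gh: "((\<lambda>p. (g p, h p)) has_derivative (\<lambda>(u, v). (a * u + b * v, c * u + d * v))) (at (s, w))"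
    by (rule has_derivative_eq_rhs) auto
  obtain A B where "(f has_derivative (\<lambda>(u, v). A * u + B * v)) (at (g (s, w), h (s, w)))"
    by (rule holomorphic2_onD[OF f V[OF sw]])
  from diff_chain_at[OF gh this]
  show "\<exists>a b. ((\<lambda>p. f (g p, h p)) has_derivative (\<lambda>(u, v). a * u + b * v)) (at (s, w))"
    by (intro exI[of _ "A * a + B * c"] exI[of _ "A * b + B * d"])
      (auto elim!: has_derivative_eq_rhs simp: o_def algebra_simps fun_eq_iff)
qed

lemma holomorphic2_on_fst_differentiable:
  assumes "holomorphic2_on f U" "(s, w) \<in> U"
  shows "(\<lambda>z. f (z, w)) field_differentiable at s"
proof -
  obtain a b where ab: "(f has_derivative (\<lambda>(u, v). a * u + b * v)) (at (s, w))"
    by (rule holomorphic2_onD[OF assms])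
  have "((\<lambda>z. (z, w)) has_derivative (\<lambda>u. (u, 0))) (at s)"
    by (auto intro!: derivative_eq_intros)
  from diff_chain_at[OF this ab] have "((\<lambda>z. f (z, w)) has_derivative (*) a) (at s)"
    by (simp add: o_def)
  then show ?thesis
    unfolding field_differentiable_def has_field_derivative_def by blast
qed

lemma holomorphic2_on_snd_differentiable:
  assumes "holomorphic2_on f U" "(s, w) \<in> U"
  shows "(\<lambda>z. f (s, z)) field_differentiable at w"
proof -
  obtain a b where ab: "(f has_derivative (\<lambda>(u, v). a * u + b * v)) (at (s, w))"
    by (rule holomorphic2_onD[OF assms])
  have "((\<lambda>z. (s, z)) has_derivative (\<lambda>u. (0, u))) (at w)"
    by (auto intro!: derivative_eq_intros)
  from diff_chain_at[OF this ab] have "((\<lambda>z. f (s, z)) has_derivative (*) b) (at w)"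
    by (simp add: o_def)
  then show ?thesis
    unfolding field_differentiable_def has_field_derivative_def by blast
qed

text \<open>By Cauchy's estimate, the second partial derivative is jointly continuous.\<close>
lemma holomorphic2_on_separately:
  assumes U: "open U" and cont: "continuous_on U f"
    and d1: "\<And>s w. (s, w) \<in> U \<Longrightarrow> (\<lambda>z. f (z, w)) field_differentiable at s"
    and d2: "\<And>s w. (s, w) \<in> U \<Longrightarrow> (\<lambda>z. f (s, z)) field_differentiable at w"
  shows "holomorphic2_on f U"
proof (rule holomorphic2_onI[OF U])
  fix s0 w0 assume "(s0, w0) \<in> U"
  then obtain A B where AB: "open A" "open B" "s0 \<in> A" "w0 \<in> B" "A \<times> B \<subseteq> U"
    using U by (auto elim!: open_prod_elim)
  then obtain r1 r2 where r12: "r1 > 0" "r2 > 0" "cball s0 r1 \<subseteq> A" "cball w0 r2 \<subseteq> B"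
    by (meson open_contains_cball)
  define r where "r = min r1 r2"
  have r: "r > 0" using r12 by (simp add: r_def)
  have sub: "cball s0 r \<times> cball w0 r \<subseteq> U"
    using r12 AB(5) by (force simp: r_def)
  define D where "D = (\<lambda>x y. deriv (\<lambda>z. f (x, z)) y)"
  have hol2: "(\<lambda>z. f (x, z)) holomorphic_on cball w0 r" if "x \<in> cball s0 r" for x
    unfolding holomorphic_on_def using d2 sub that
    by (meson SigmaI field_differentiable_at_within subsetD)
  have uc: "uniformly_continuous_on (cball s0 r \<times> cball w0 r) f"
    by (intro compact_uniformly_continuous continuous_on_subset[OF cont sub] compact_Times compact_cball)
  have D_hol: "D x holomorphic_on ball w0 r" if "x \<in> cball s0 r" for x
    unfolding D_def using hol2[OF that] by (intro holomorphic_deriv) (auto elim: holomorphic_on_subset)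
  have fyd: "((\<lambda>z. f (x, z)) has_field_derivative D x y) (at y)"
    if "x \<in> ball s0 r" "y \<in> ball w0 r" for x y
    unfolding D_def using that sub
    by (intro field_differentiable_derivI d2) (auto simp: less_imp_le subset_iff)
  have Dcont: "continuous (at (s0, w0)) (\<lambda>(x, y). D x y)"
  proof -
    have "((\<lambda>p. D (fst p) (snd p)) \<longlongrightarrow> D s0 w0) (at (s0, w0))"
    proof (rule tendstoI)
      fix e :: real assume e: "e > 0"
      have "continuous_on (ball w0 r) (D s0)"
        using D_hol[of s0] r by (intro holomorphic_on_imp_continuous_on) auto
      then have "isCont (D s0) w0"
        using r by (auto simp: continuous_on_eq_continuous_at)
      then have "(D s0 \<longlongrightarrow> D s0 w0) (nhds w0)"
        unfolding isCont_def tendsto_at_iff_tendsto_nhds .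
      then have "\<forall>\<^sub>F y in nhds w0. dist (D s0 y) (D s0 w0) < e / 2"
        by (rule tendstoD) (use e in simp)
      then obtain d1 where d1: "d1 > 0" "\<And>y. dist y w0 < d1 \<Longrightarrow> dist (D s0 y) (D s0 w0) < e / 2"
        unfolding eventually_nhds_metric by blast
      \<comment> \<open>Cauchy's estimate on a circle of radius \<open>r / 2\<close> turns a
        variation \<open>e * r / 8\<close> of \<open>f\<close> into \<open>e / 4\<close> for the
        derivative, so the two steps from \<open>D x y\<close> over \<open>D s0 y\<close> to
        \<open>D s0 w0\<close> add up to less than \<open>e\<close>.\<close>
      have er: "e * r / 8 > 0" using e r by simp
      obtain d2 where d2: "d2 > 0" "\<And>p q. p \<in> cball s0 r \<times> cball w0 r \<Longrightarrow> q \<in> cball s0 r \<times> cball w0 r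
         \<Longrightarrow> dist q p < d2 \<Longrightarrow> dist (f q) (f p) < e * r / 8"
        using uc er unfolding uniformly_continuous_on_def by metis
      define d where "d = min (min d1 d2) (r / 2)"
      have d: "d > 0" "d \<le> d1" "d \<le> d2" "d \<le> r / 2" using d1(1) d2(1) r by (auto simp: d_def)
      have "dist (D x y) (D s0 w0) < e" if xy: "dist (x, y) (s0, w0) < d" for x y
      proof -
        have x: "dist x s0 < d" using xy dist_fst_le[of "(x,y)" "(s0,w0)"] by simp
        have y: "dist y w0 < d" using xy dist_snd_le[of "(x,y)" "(s0,w0)"] by simp
        have xr: "x \<in> ball s0 r" using x d r by (simp add: dist_commute)
        have yr: "y \<in> ball w0 r" using y d r by (simp add: dist_commute)
        have sb: "cball y (r / 2) \<subseteq> cball w0 r"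
          using y d by (intro cball_subset_cball_iff[THEN iffD2]) (auto simp: dist_commute)
        define F where "F = (\<lambda>z. f (x, z) - f (s0, z))"
        have F: "F holomorphic_on cball y (r / 2)"
          unfolding F_def using xr r sb
          by (intro holomorphic_intros holomorphic_on_subset[OF hol2]) auto
        have "norm ((deriv ^^ 1) F y) \<le> fact 1 * (e * r / 8) / (r / 2) ^ 1"
        proof (rule Cauchy_inequality)
          show "F holomorphic_on ball y (r / 2)" using F by (rule holomorphic_on_subset) auto
          show "continuous_on (cball y (r / 2)) F" using F by (rule holomorphic_on_imp_continuous_on)
          show "0 < r / 2" using r by simp
          fix z assume "norm (y - z) = r / 2"
          then have "z \<in> cball w0 r" using sb by (auto simp: dist_norm)
          moreover have "dist (x, z) (s0, z) < d2" using x d by (simp add: dist_Pair_Pair)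
          ultimately have "dist (f (x, z)) (f (s0, z)) < e * r / 8"
            using xr r by (intro d2(2)) (auto simp: less_imp_le)
          then show "norm (F z) \<le> e * r / 8" by (simp add: F_def dist_norm)
        qed
        then have "norm (deriv F y) \<le> e / 4" using r by (simp add: field_simps)
        moreover have "deriv F y = D x y - D s0 y"
          unfolding F_def using xr yr r by (intro DERIV_imp_deriv derivative_intros fyd) auto
        ultimately have "dist (D x y) (D s0 y) \<le> e / 4" by (simp add: dist_norm)
        moreover have "dist (D s0 y) (D s0 w0) < e / 2" using d1 y d by auto
        ultimately show ?thesis using dist_triangle[of "D x y" "D s0 w0" "D s0 y"] e by linarith
      qed
      then show "\<forall>\<^sub>F p in at (s0, w0). dist (D (fst p) (snd p)) (D s0 w0) < e"
        unfolding eventually_at using d(1) by (intro exI[of _ d]) auto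
    qed
    then show ?thesis by (simp add: continuous_at case_prod_unfold isCont_def)
  qed
  define Q where "Q = ball s0 r"
  define Q2 where "Q2 = ball w0 r"
  \<comment> \<open>One partial derivative has to be continuous, the other only has to exist at the
    point.\<close>
  have "((\<lambda>(x, y). f (x, y)) has_derivative
      (\<lambda>(tx, ty). deriv (\<lambda>z. f (z, w0)) s0 * tx + blinfun_mult_right (D s0 w0) ty)) (at (s0, w0) within Q \<times> Q2)"
  proof (rule has_derivative_partialsI)
    have "((\<lambda>z. f (z, w0)) has_field_derivative deriv (\<lambda>z. f (z, w0)) s0) (at s0)"
      using sub r by (intro field_differentiable_derivI d1) auto
    then show "((\<lambda>x. f (x, w0)) has_derivative (*) (deriv (\<lambda>z. f (z, w0)) s0)) (at s0 within Q)"
      by (simp add: has_field_derivative_def has_derivative_at_withinI)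
    show "((\<lambda>y. f (x, y)) has_derivative blinfun_apply (blinfun_mult_right (D x y))) (at y within Q2)"
      if "x \<in> Q" "y \<in> Q2" for x y
    proof -
      have "blinfun_apply (blinfun_mult_right (D x y)) = (*) (D x y)"
        by (auto simp: fun_eq_iff)
      then show ?thesis
        using fyd[of x y] that by (simp add: has_field_derivative_def has_derivative_at_withinI Q_def Q2_def)
    qed
    have "isCont (\<lambda>(x, y). blinfun_mult_right (D x y)) (s0, w0)"
      using bounded_linear.isCont[OF bounded_linear_blinfun_mult_right Dcont]
      by (simp add: case_prod_unfold)
    then show "continuous (at (s0, w0) within Q \<times> Q2) (\<lambda>(x, y). blinfun_mult_right (D x y))"
      by (rule continuous_at_imp_continuous_within)
  qed (use r in \<open>auto simp: Q_def Q2_def\<close>)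
  moreover have "at (s0, w0) within Q \<times> Q2 = at (s0, w0)"
    using r by (intro at_within_open) (auto simp: Q_def Q2_def intro: open_Times)
  ultimately have "(f has_derivative (\<lambda>(tx, ty). deriv (\<lambda>z. f (z, w0)) s0 * tx + D s0 w0 * ty)) (at (s0, w0))"
    by (simp add: case_prod_unfold)
  then show "\<exists>a b. (f has_derivative (\<lambda>(u, v). a * u + b * v)) (at (s0, w0))"
    by blast
qed

text \<open>A majorant on each bounded part of \<open>U\<close> is enough, since the M-test is
  applied on closed discs. The majorants met below grow with the size of the variables, so the bound
  is asked for separately for each \<open>R\<close>.\<close>

lemma holomorphic_on_infsum:
  fixes f :: "'i \<Rightarrow> complex \<Rightarrow> complex"
  assumes U: "open U" and f: "\<And>i. i \<in> I \<Longrightarrow> f i holomorphic_on U"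
    and bd: "\<And>R. \<exists>M. M summable_on I \<and> (\<forall>i\<in>I. \<forall>z\<in>U. norm z \<le> R \<longrightarrow> norm (f i z) \<le> M i)"
  shows "(\<lambda>z. \<Sum>\<^sub>\<infinity>i\<in>I. f i z) holomorphic_on U"
proof -
  have "(\<lambda>z. \<Sum>\<^sub>\<infinity>i\<in>I. f i z) field_differentiable at z" if z: "z \<in> U" for z
  proof -
    obtain r where r: "r > 0" "cball z r \<subseteq> U" using U z by (meson open_contains_cball)
    obtain M where M: "M summable_on I" "\<And>i x. i \<in> I \<Longrightarrow> x \<in> U \<Longrightarrow> norm x \<le> norm z + r \<Longrightarrow> norm (f i x) \<le> M i"
      using bd[of "norm z + r"] by blast
    have ul: "uniform_limit (cball z r) (\<lambda>Q y. \<Sum>x\<in>Q. f x y) (\<lambda>y. \<Sum>\<^sub>\<infinity>x\<in>I. f x y) (finite_subsets_at_top I)"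
    proof (rule Weierstrass_m_test_general[OF _ M(1)])
      fix i x assume ix: "i \<in> I" "x \<in> cball z r"
      have "norm x \<le> norm z + r"
        using ix(2) norm_triangle_sub[of x z] by (simp add: dist_norm norm_minus_commute)
      then show "norm (f i x) \<le> M i" using M(2) ix r by blast
    qed
    have ev: "\<forall>\<^sub>F Q in finite_subsets_at_top I. continuous_on (cball z r) (\<lambda>y. \<Sum>x\<in>Q. f x y)
            \<and> (\<lambda>y. \<Sum>x\<in>Q. f x y) holomorphic_on ball z r"
    proof (rule eventually_finite_subsets_at_top_weakI)
      fix Q assume Q: "finite Q" "Q \<subseteq> I"
      have "(\<lambda>y. \<Sum>x\<in>Q. f x y) holomorphic_on U"
        using Q f by (intro holomorphic_on_sum) auto
      then show "continuous_on (cball z r) (\<lambda>y. \<Sum>x\<in>Q. f x y) \<and> (\<lambda>y. \<Sum>x\<in>Q. f x y) holomorphic_on ball z r"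
        using r ball_subset_cball
        by (meson holomorphic_on_imp_continuous_on holomorphic_on_subset subset_trans)
    qed
    obtain "(\<lambda>y. \<Sum>\<^sub>\<infinity>x\<in>I. f x y) holomorphic_on ball z r"
      using holomorphic_uniform_limit[OF ev ul] by auto
    then show ?thesis
      using r(1) by (simp add: holomorphic_on_imp_differentiable_at)
  qed
  then show ?thesis
    by (simp add: holomorphic_on_def field_differentiable_at_within)
qed

lemma open_slice1: "open U \<Longrightarrow> open {z. (z, w) \<in> (U :: (complex \<times> complex) set)}"
  using open_vimage[of U "\<lambda>z. (z, w)"] by (simp add: vimage_def continuous_on_Pair continuous_on_const continuous_on_id)

lemma open_slice2: "open U \<Longrightarrow> open {z. (s, z) \<in> (U :: (complex \<times> complex) set)}"
  using open_vimage[of U "\<lambda>z. (s, z)"] by (simp add: vimage_def continuous_on_Pair continuous_on_const continuous_on_id)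

lemma norm_Pair_le_add: "norm (s, w) \<le> norm s + norm w"
  by (metis norm_Pair norm_ge_zero sqrt_sum_squares_le_sum)

text \<open>The M-test gives joint continuity, and the one-variable lemma on slices gives both
  partial derivatives; by Osgood's lemma this suffices.\<close>

lemma holomorphic2_on_infsum:
  fixes f :: "'i \<Rightarrow> complex \<times> complex \<Rightarrow> complex"
  assumes U: "open U" and f: "\<And>i. i \<in> I \<Longrightarrow> holomorphic2_on (f i) U"
    and bd: "\<And>R. \<exists>M. M summable_on I \<and> (\<forall>i\<in>I. \<forall>p\<in>U. norm p \<le> R \<longrightarrow> norm (f i p) \<le> M i)"
  shows "holomorphic2_on (\<lambda>p. \<Sum>\<^sub>\<infinity>i\<in>I. f i p) U"
proof (rule holomorphic2_on_separately[OF U])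
  show "continuous_on U (\<lambda>p. \<Sum>\<^sub>\<infinity>i\<in>I. f i p)"
    unfolding continuous_on_eq_continuous_at[OF U]
  proof
    fix p assume p: "p \<in> U"
    obtain M where M: "M summable_on I" "\<And>i x. i \<in> I \<Longrightarrow> x \<in> U \<Longrightarrow> norm x \<le> norm p + 1 \<Longrightarrow> norm (f i x) \<le> M i"
      using bd[of "norm p + 1"] by blast
    have *: "norm x \<le> norm p + 1" if "x \<in> ball p 1" for x
      using that norm_triangle_sub[of x p] by (simp add: dist_norm norm_minus_commute)
    have "uniform_limit (U \<inter> ball p 1) (\<lambda>Q y. \<Sum>x\<in>Q. f x y) (\<lambda>y. \<Sum>\<^sub>\<infinity>x\<in>I. f x y) (finite_subsets_at_top I)"
      by (rule Weierstrass_m_test_general[OF _ M(1)]) (use * M(2) in blast)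
    moreover have "\<forall>\<^sub>F Q in finite_subsets_at_top I. continuous_on (U \<inter> ball p 1) (\<lambda>y. \<Sum>x\<in>Q. f x y)"
      by (rule eventually_finite_subsets_at_top_weakI)
        (auto intro!: continuous_on_sum intro: continuous_on_subset[OF holomorphic2_on_imp_continuous_on[OF f]])
    ultimately have "continuous_on (U \<inter> ball p 1) (\<lambda>y. \<Sum>\<^sub>\<infinity>x\<in>I. f x y)"
      by (intro uniform_limit_theorem) auto
    moreover have "open (U \<inter> ball p 1)" using U by auto
    ultimately show "isCont (\<lambda>y. \<Sum>\<^sub>\<infinity>x\<in>I. f x y) p"
      using p by (auto simp: continuous_on_eq_continuous_at)
  qed
next
  fix s w assume sw: "(s, w) \<in> U"
  have "(\<lambda>z. \<Sum>\<^sub>\<infinity>i\<in>I. f i (z, w)) holomorphic_on {z. (z, w) \<in> U}"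
  proof (rule holomorphic_on_infsum[OF open_slice1[OF U]])
    show "(\<lambda>z. f i (z, w)) holomorphic_on {z. (z, w) \<in> U}" if "i \<in> I" for i
      unfolding holomorphic_on_def
      using holomorphic2_on_fst_differentiable[OF f[OF that]] field_differentiable_at_within by blast
    fix R
    obtain M where M: "M summable_on I" "\<And>i p. i \<in> I \<Longrightarrow> p \<in> U \<Longrightarrow> norm p \<le> R + norm w \<Longrightarrow> norm (f i p) \<le> M i"
      using bd[of "R + norm w"] by blast
    have "norm (f i (z, w)) \<le> M i" if "i \<in> I" "(z, w) \<in> U" "norm z \<le> R" for i z
      by (rule M(2)[OF that(1,2)], rule order_trans[OF norm_Pair_le_add], rule add_right_mono, rule that(3))
    with M(1) show "\<exists>M. M summable_on I \<and> (\<forall>i\<in>I. \<forall>z\<in>{z. (z, w) \<in> U}. norm z \<le> R \<longrightarrow> norm (f i (z, w)) \<le> M i)"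
      by blast
  qed
  then show "(\<lambda>z. \<Sum>\<^sub>\<infinity>i\<in>I. f i (z, w)) field_differentiable at s"
    using open_slice1[OF U, of w] sw by (simp add: holomorphic_on_imp_differentiable_at)
  have "(\<lambda>z. \<Sum>\<^sub>\<infinity>i\<in>I. f i (s, z)) holomorphic_on {z. (s, z) \<in> U}"
  proof (rule holomorphic_on_infsum[OF open_slice2[OF U]])
    show "(\<lambda>z. f i (s, z)) holomorphic_on {z. (s, z) \<in> U}" if "i \<in> I" for i
      unfolding holomorphic_on_def
      using holomorphic2_on_snd_differentiable[OF f[OF that]] field_differentiable_at_within by blast
    fix R
    obtain M where M: "M summable_on I" "\<And>i p. i \<in> I \<Longrightarrow> p \<in> U \<Longrightarrow> norm p \<le> norm s + R \<Longrightarrow> norm (f i p) \<le> M i"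
      using bd[of "norm s + R"] by blast
    have "norm (f i (s, z)) \<le> M i" if "i \<in> I" "(s, z) \<in> U" "norm z \<le> R" for i z
      by (rule M(2)[OF that(1,2)], rule order_trans[OF norm_Pair_le_add], rule add_left_mono, rule that(3))
    with M(1) show "\<exists>M. M summable_on I \<and> (\<forall>i\<in>I. \<forall>z\<in>{z. (s, z) \<in> U}. norm z \<le> R \<longrightarrow> norm (f i (s, z)) \<le> M i)"
      by blast
  qed
  then show "(\<lambda>z. \<Sum>\<^sub>\<infinity>i\<in>I. f i (s, z)) field_differentiable at w"
    using open_slice2[OF U, of s] sw by (simp add: holomorphic_on_imp_differentiable_at)
qed

text \<open>Reduction to one variable: the complex line through \<open>p0\<close> and
  \<open>p\<close> meets the convex set \<open>U\<close> in a convex, hence connected, open set of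
  parameters. It contains \<open>1\<close>, which belongs to \<open>p\<close>, and a neighbourhood
  of \<open>0\<close> that is mapped into \<open>V\<close>.\<close>

lemma holomorphic2_on_identity:
  assumes f: "holomorphic2_on f U" and g: "holomorphic2_on g U" and U: "convex U"
    and V: "open V" "V \<subseteq> U" "p0 \<in> V" and eq: "\<And>p. p \<in> V \<Longrightarrow> f p = g p" and p: "p \<in> U"
  shows "f p = g p"
proof -
  obtain s0 w0 s w where p0': "p0 = (s0, w0)" and p': "p = (s, w)" by fastforce
  define l where "l = (\<lambda>t::complex. (s0 + t * (s - s0), w0 + t * (w - w0)))"
  have lcont: "continuous_on UNIV l" unfolding l_def by (intro continuous_intros)
  have U_open: "open U" using f by (rule holomorphic2_on_open)
  define S where "S = l -` U"
  define T where "T = l -` V"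
  have S: "open S" and T: "open T"
    unfolding S_def T_def using U_open V(1) lcont by (auto intro!: open_vimage)
  have "convex S"
  proof (rule convexI)
    fix x y and a b :: real assume xy: "x \<in> S" "y \<in> S" and ab: "0 \<le> a" "0 \<le> b" "a + b = 1"
    have "l (a *\<^sub>R x + b *\<^sub>R y) = ((a+b) *\<^sub>R s0 + (a *\<^sub>R x + b *\<^sub>R y) * (s - s0), (a+b) *\<^sub>R w0 + (a *\<^sub>R x + b *\<^sub>R y) * (w - w0))"
      unfolding l_def ab(3) by simp
    also have "\<dots> = a *\<^sub>R l x + b *\<^sub>R l y"
      by (simp add: l_def algebra_simps)
    finally show "a *\<^sub>R x + b *\<^sub>R y \<in> S"
      using convexD[OF U _ _ ab, of "l x" "l y"] xy by (simp add: S_def)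
  qed
  then have S_conn: "connected S" by (rule convex_connected)
  have ld: "(l has_derivative (\<lambda>u. (u * (s - s0), u * (w - w0)))) (at t)" for t
    unfolding l_def by (auto intro!: derivative_eq_intros)
  have hol: "(\<lambda>t. h (l t)) holomorphic_on S" if h: "holomorphic2_on h U" for h
  proof -
    have "(\<lambda>t. h (l t)) field_differentiable at t" if t: "t \<in> S" for t
    proof -
      obtain a b where "(h has_derivative (\<lambda>(u, v). a * u + b * v)) (at (l t))"
        by (rule holomorphic2_onD[OF h]) (use t in \<open>auto simp: S_def\<close>)
      note D = diff_chain_at[OF ld this]
      have eq: "(\<lambda>(u, v). a * u + b * v) \<circ> (\<lambda>u. (u * (s - s0), u * (w - w0))) = (*) (a * (s - s0) + b * (w - w0))"
        by (auto simp: fun_eq_iff algebra_simps)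
      have "((\<lambda>t. h (l t)) has_derivative (*) (a * (s - s0) + b * (w - w0))) (at t)"
        using D unfolding eq by (simp add: o_def)
      then show ?thesis unfolding field_differentiable_def has_field_derivative_def by blast
    qed
    then show ?thesis by (simp add: holomorphic_on_def field_differentiable_at_within)
  qed
  have l0: "l 0 = p0" and l1: "l 1 = p" by (simp_all add: l_def p0' p')
  have "0 \<in> T" "1 \<in> S" "T \<subseteq> S" using V p l0 l1 by (auto simp: S_def T_def)
  have "f (l 1) = g (l 1)"
  proof (rule analytic_continuation_open[of T S "\<lambda>t. f (l t)" "\<lambda>t. g (l t)"])
    show "T \<noteq> {}" using \<open>0 \<in> T\<close> by auto
    show "f (l t) = g (l t)" if "t \<in> T" for t using eq that by (simp add: T_def)
  qed (use S T S_conn \<open>T \<subseteq> S\<close> \<open>1 \<in> S\<close> hol f g in auto)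
  then show ?thesis by (simp add: l1)
qed

subsection \<open>Lattice rows\<close>

text \<open>The point \<open>m + n * \<i>\<close> is \<open>n\<close> times \<open>x + \<i>\<close>
  with \<open>x = m / n\<close>, so one function of a real variable serves for all rows. Both bases
  stay off the negative real axis: the principal powers are smooth in \<open>x\<close> and entire in
  \<open>p\<close> and \<open>q\<close>.\<close>

definition kern :: "complex \<Rightarrow> complex \<Rightarrow> real \<Rightarrow> complex" where
  "kern p q x = (of_real x + \<i>) powr p * (of_real x - \<i>) powr q"

lemma real_add_i_not_nonpos [simp]:
  "complex_of_real x + \<i> \<notin> \<real>\<^sub>\<le>\<^sub>0" "complex_of_real x - \<i> \<notin> \<real>\<^sub>\<le>\<^sub>0"
  by (auto simp: complex_nonpos_Reals_iff)

lemma real_add_i_nonzero [simp]: "complex_of_real x + \<i> \<noteq> 0" "complex_of_real x \<noteq> \<i>"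
proof -
  show "complex_of_real x + \<i> \<noteq> 0" using real_add_i_not_nonpos(1)[of x] by (metis nonpos_Reals_zero_I)
  show "complex_of_real x \<noteq> \<i>" by (metis Im_complex_of_real imaginary_unit.simps(2) zero_neq_one)
qed

lemma kern_exp: "kern p q x = exp (p * Ln (of_real x + \<i>) + q * Ln (of_real x - \<i>))"
  by (simp add: kern_def powr_def exp_add)

lemma kern_add: "kern (p + p') (q + q') x = kern p q x * kern p' q' x"
  by (simp add: kern_exp algebra_simps flip: exp_add)

lemma Ln_minus_i: "Ln (of_real x - \<i>) = cnj (Ln (of_real x + \<i>))"
  by (subst cnj_Ln) (auto simp: real_add_i_not_nonpos)

text \<open>The two logarithms are conjugate, so the modulus is
  \<open>exp (Re (p + q) * Re L - Im (p - q) * Im L)\<close> with \<open>L = Ln (x + \<i>)\<close>.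
  Adding an integer to \<open>p\<close> and subtracting it from \<open>q\<close> does not change the
  bound.\<close>

lemma norm_kern_le:
  "norm (kern p q x) \<le> exp (pi * \<bar>Im (p - q)\<bar>) * (1 + x\<^sup>2) powr (Re (p + q) / 2)"
proof -
  define L where "L = Ln (of_real x + \<i>)"
  have "Re (p * L + q * cnj L) = Re (p + q) * Re L - Im (p - q) * Im L"
    by (simp add: algebra_simps)
  moreover have "- Im (p - q) * Im L \<le> \<bar>Im (p - q)\<bar> * pi"
  proof -
    have "\<bar>Im L\<bar> \<le> pi"
      using mpi_less_Im_Ln[of "of_real x + \<i>"] Im_Ln_le_pi[of "of_real x + \<i>"] by (simp add: L_def)
    then have "\<bar>Im (p - q)\<bar> * \<bar>Im L\<bar> \<le> \<bar>Im (p - q)\<bar> * pi" by (intro mult_left_mono) auto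
    moreover have "- Im (p - q) * Im L \<le> \<bar>Im (p - q)\<bar> * \<bar>Im L\<bar>"
      by (metis abs_ge_minus_self abs_mult mult_minus_left)
    ultimately show ?thesis by linarith
  qed
  moreover have "Re L = ln (1 + x\<^sup>2) / 2"
    unfolding L_def by (subst Re_Ln) (simp_all add: cmod_def ln_sqrt add_pos_nonneg add.commute[of "1::real"])
  moreover have "a * (l / 2) - d * i \<le> pi * \<bar>d\<bar> + (a / 2) * l" if "- d * i \<le> \<bar>d\<bar> * pi" for a d i l :: real
    using that by (simp add: mult.commute)
  ultimately have "Re (p * L + q * cnj L) \<le> pi * \<bar>Im (p - q)\<bar> + (Re (p + q) / 2) * ln (1 + x\<^sup>2)"
    by metis
  then have "exp (Re (p * L + q * cnj L)) \<le> exp (pi * \<bar>Im (p - q)\<bar> + (Re (p + q) / 2) * ln (1 + x\<^sup>2))"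
    by simp
  also have "\<dots> = exp (pi * \<bar>Im (p - q)\<bar>) * (1 + x\<^sup>2) powr (Re (p + q) / 2)"
    by (simp add: exp_add powr_def add_pos_nonneg power2_eq_square)
      (smt (verit) sum_power2_gt_zero_iff zero_le_square)
  finally show ?thesis
    by (simp add: kern_exp norm_exp_eq_Re Ln_minus_i flip: L_def)
qed

text \<open>Uniformity in \<open>t\<close> lets one bound serve for lattice points
  (\<open>t = 0\<close>) and for integrals over cells. With \<open>y = m + t\<close>, the factor
  \<open>n\<^sup>2\<close> is the numerator of \<open>1 / (1 + (y / n)\<^sup>2)\<close>, and the
  \<open>3\<close> comes from
  \<open>(y - t)\<^sup>2 \<le> 2 * y\<^sup>2 + 2 * t\<^sup>2\<close>.\<close>

lemma norm_kern_lattice_le: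
  assumes "Re (p + q) \<le> -2" "n \<ge> 1" "0 \<le> t" "t \<le> 1"
  shows "norm (kern p q ((of_int m + t) / of_nat n))
     \<le> 3 * exp (pi * \<bar>Im (p - q)\<bar>) * (real n)\<^sup>2 * inverse (1 + (of_int m)\<^sup>2)"
proof -
  define y where "y = of_int m + t"
  define x where "x = y / real n"
  have n: "real n \<ge> 1" using assms by simp
  have "(1 + x\<^sup>2) powr (Re (p + q) / 2) \<le> (1 + x\<^sup>2) powr (-1)"
    using assms(1) by (intro powr_mono) auto
  also have "\<dots> = inverse (1 + x\<^sup>2)" by (subst powr_minus) (simp add: add_nonneg_nonneg)
  also have "\<dots> = (real n)\<^sup>2 * inverse ((real n)\<^sup>2 + y\<^sup>2)"
    using n by (simp add: x_def field_simps power2_eq_square)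
  also have "\<dots> \<le> (real n)\<^sup>2 * (3 * inverse (1 + (of_int m)\<^sup>2))"
  proof (intro mult_left_mono)
    have "(of_int m)\<^sup>2 = (y - t)\<^sup>2" by (simp add: y_def)
    also have "\<dots> \<le> 2 * y\<^sup>2 + 2 * t\<^sup>2"
      using zero_le_power2[of "y + t"] by (simp add: power2_eq_square algebra_simps)
    also have "t\<^sup>2 \<le> 1" using assms by (simp add: power_le_one)
    finally have "(of_int m)\<^sup>2 \<le> 2 * y\<^sup>2 + 2" by simp
    moreover have "1 + a \<le> 3 * (1 + c)" if "a \<le> 2 * c + 2" "0 \<le> c" for a c :: real
      using that by simp
    ultimately have "1 + (of_int m)\<^sup>2 \<le> 3 * (1 + y\<^sup>2)" using zero_le_power2 by blast
    also have "1 + y\<^sup>2 \<le> (real n)\<^sup>2 + y\<^sup>2" using n by simp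
    finally have *: "1 + (of_int m)\<^sup>2 \<le> 3 * ((real n)\<^sup>2 + y\<^sup>2)" by simp
    have "inverse (3 * ((real n)\<^sup>2 + y\<^sup>2)) \<le> inverse (1 + (real_of_int m)\<^sup>2)"
      by (rule le_imp_inverse_le[OF *]) (simp add: add_pos_nonneg)
    then show "inverse ((real n)\<^sup>2 + y\<^sup>2) \<le> 3 * inverse (1 + (of_int m)\<^sup>2)"
      unfolding inverse_mult_distrib by simp
  qed auto
  finally have "(1 + x\<^sup>2) powr (Re (p + q) / 2) \<le> (real n)\<^sup>2 * (3 * inverse (1 + (of_int m)\<^sup>2))" .
  then have "exp (pi * \<bar>Im (p - q)\<bar>) * (1 + x\<^sup>2) powr (Re (p + q) / 2)
      \<le> exp (pi * \<bar>Im (p - q)\<bar>) * ((real n)\<^sup>2 * (3 * inverse (1 + (of_int m)\<^sup>2)))"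
    by (intro mult_left_mono) auto
  from order_trans[OF norm_kern_le[of p q x] this] show ?thesis
    unfolding x_def y_def by (simp only: mult_ac)
qed

lemma summable_on_inverse_int_square: "(\<lambda>m::int. inverse (1 + (of_int m)\<^sup>2 :: real)) summable_on UNIV"
proof -
  have h1: "summable (\<lambda>n. inverse (real (Suc n) ^ 2))"
    using inverse_power_summable[of 2, where ?'a = real] by (subst summable_Suc_iff) simp
  have h2: "inverse (1 + (real n)\<^sup>2) \<le> 4 * inverse (real (Suc n) ^ 2)" for n
  proof -
    have "(real (Suc n))\<^sup>2 \<le> 4 * (1 + (real n)\<^sup>2)"
      using zero_le_power2[of "real n - 1"] by (simp add: power2_eq_square algebra_simps)
    then have "inverse (4 * (1 + (real n)\<^sup>2)) \<le> inverse ((real (Suc n))\<^sup>2)"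
      by (rule le_imp_inverse_le) simp
    then show ?thesis unfolding inverse_mult_distrib by simp
  qed
  have "summable (\<lambda>n. inverse (1 + (real n)\<^sup>2))"
  proof (rule summable_comparison_test'[OF summable_mult[OF h1, of 4], of 0])
    show "norm (inverse (1 + (real n)\<^sup>2)) \<le> 4 * inverse (real (Suc n) ^ 2)" for n
      using h2[of n] abs_of_nonneg[OF add_nonneg_nonneg[OF zero_le_one zero_le_power2[of "real n"]]]
      by (simp only: abs_inverse real_norm_def)
  qed
  then have 1: "(\<lambda>n. inverse (1 + (real n)\<^sup>2)) summable_on UNIV"
    by (intro summable_nonneg_imp_summable_on) auto
  have "(\<lambda>m::int. inverse (1 + (of_int m)\<^sup>2 :: real)) summable_on range int"
    by (subst summable_on_reindex) (use 1 in \<open>auto simp: o_def\<close>)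
  moreover have "(\<lambda>m::int. inverse (1 + (of_int m)\<^sup>2 :: real)) summable_on range (\<lambda>n. - int n)"
    by (subst summable_on_reindex) (use 1 in \<open>auto simp: o_def inj_on_def\<close>)
  ultimately have "(\<lambda>m::int. inverse (1 + (of_int m)\<^sup>2 :: real)) summable_on (range int \<union> range (\<lambda>n. - int n))"
    by (rule summable_on_union)
  moreover have "range int \<union> range (\<lambda>n. - int n) = UNIV"
    by (auto simp: image_iff) (metis int_cases2)
  ultimately show ?thesis by simp
qed

lemma kern_has_vector_derivative:
  "(kern p q has_vector_derivative (p * kern (p - 1) q x + q * kern p (q - 1) x)) (at x within S)"
proof -
  have "((\<lambda>z. (z + \<i>) powr p * (z - \<i>) powr q) has_field_derivative
     (p * kern (p - 1) q x + q * kern p (q - 1) x)) (at (of_real x))"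
    unfolding kern_def
    by (rule derivative_eq_intros refl | simp)+
  from has_vector_derivative_real_field[OF this] show ?thesis
    by (simp add: kern_def[abs_def])
qed

lemma kern_scaled_has_vector_derivative:
  assumes "n \<ge> 1"
  shows "((\<lambda>t. kern p q ((of_int m + t) / of_nat n)) has_vector_derivative
    ((p * kern (p - 1) q ((of_int m + t) / of_nat n) + q * kern p (q - 1) ((of_int m + t) / of_nat n)) / of_nat n)) (at t within S)"
proof -
  have "((\<lambda>t. (of_int m + t) / real n) has_real_derivative (1 / real n)) (at t within S)"
    using assms by (auto intro!: derivative_eq_intros)
  then have "((\<lambda>t. (of_int m + t) / real n) has_vector_derivative (1 / real n)) (at t within S)"
    by (simp add: has_real_derivative_iff_has_vector_derivative)
  from vector_diff_chain_within[OF this kern_has_vector_derivative]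
  show ?thesis
    by (simp add: o_def scaleR_conv_of_real divide_simps)
qed

lemma continuous_on_kern [continuous_intros]:
  assumes "continuous_on S f" "continuous_on S g" "continuous_on S h"
  shows "continuous_on S (\<lambda>x. kern (f x) (g x) (h x))"
  unfolding kern_exp using assms by (auto intro!: continuous_intros)

lemma continuous_on_Ln_i [continuous_intros]:
  assumes "continuous_on S h"
  shows "continuous_on S (\<lambda>x. Ln (of_real (h x) + \<i>))" "continuous_on S (\<lambda>x. Ln (of_real (h x) - \<i>))"
  using assms by (auto intro!: continuous_intros)

section \<open>Row integrals against a periodic weight\<close>

definition cell_int :: "(real \<Rightarrow> real) \<Rightarrow> nat \<Rightarrow> complex \<Rightarrow> complex \<Rightarrow> int \<Rightarrow> complex" where
  "cell_int b n p q m = integral {0..1} (\<lambda>t. of_real (b t) * kern p q ((of_int m + t) / of_nat n))"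

text \<open>The integral over the whole line of \<open>kern p q\<close> against \<open>b\<close>
  repeated with period \<open>1 / n\<close>, in the scale where a cell has length \<open>1\<close>.
  Written as a sum over cells, it involves integrals over \<open>{0..1}\<close> only.\<close>

definition row_int :: "(real \<Rightarrow> real) \<Rightarrow> nat \<Rightarrow> complex \<Rightarrow> complex \<Rightarrow> complex" where
  "row_int b n p q = (\<Sum>\<^sub>\<infinity>m. cell_int b n p q m)"

lemma norm_cell_int_le:
  assumes b: "continuous_on {0..1} b" "\<And>t. t \<in> {0..1} \<Longrightarrow> \<bar>b t\<bar> \<le> C" and pq: "Re (p + q) \<le> -2" and n: "n \<ge> 1"
  shows "norm (cell_int b n p q m)
    \<le> C * (3 * exp (pi * \<bar>Im (p - q)\<bar>) * (real n)\<^sup>2 * inverse (1 + (of_int m)\<^sup>2))" (is "_ \<le> C * ?B")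
proof -
  have "0 \<le> C" using b(2)[of 0] by force
  have "norm (cell_int b n p q m) \<le> (C * ?B) * (1 - 0)"
    unfolding cell_int_def
  proof (rule integral_bound)
    show "continuous_on {0..1} (\<lambda>t. complex_of_real (b t) * kern p q ((of_int m + t) / of_nat n))"
      using b(1) n by (auto intro!: continuous_intros)
    fix t :: real assume t: "t \<in> {0..1}"
    then have "norm (kern p q ((of_int m + t) / of_nat n)) \<le> ?B"
      using norm_kern_lattice_le[OF pq n, of t m] by simp
    then show "norm (complex_of_real (b t) * kern p q ((of_int m + t) / of_nat n)) \<le> C * ?B"
      unfolding norm_mult using b(2)[OF t] \<open>0 \<le> C\<close> by (intro mult_mono) auto
  qed auto
  then show ?thesis by simp
qed

lemma summable_on_kern_row:
  assumes "Re (p + q) \<le> -2" "n \<ge> 1"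
  shows "(\<lambda>m::int. norm (kern p q (of_int m / of_nat n))) summable_on UNIV"
  by (rule Infinite_Sum.abs_summable_on_comparison_test'[OF summable_on_cmult_right[OF summable_on_inverse_int_square]])
    (use norm_kern_lattice_le[OF assms, of 0] in simp)

lemma continuous_on_bounded_unit:
  fixes b :: "real \<Rightarrow> real"
  assumes "continuous_on {0..1} b"
  obtains C where "C \<ge> 0" "\<And>t. t \<in> {0..1} \<Longrightarrow> \<bar>b t\<bar> \<le> C"
proof -
  have "bounded (b ` {0..1})"
    using assms by (intro compact_imp_bounded compact_continuous_image) auto
  then obtain C where "\<forall>x\<in>b ` {0..1}. norm x \<le> C" by (auto simp: bounded_iff)
  then show ?thesis by (intro that[of "max C 0"]) force+
qed

lemma summable_on_cell_int:
  assumes b: "continuous_on {0..1} b" and pq: "Re (p + q) \<le> -2" and n: "n \<ge> 1"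
  shows "(\<lambda>m::int. norm (cell_int b n p q m)) summable_on UNIV"
proof -
  obtain C where "C \<ge> 0" "\<And>t. t \<in> {0..1} \<Longrightarrow> \<bar>b t\<bar> \<le> C" using continuous_on_bounded_unit[OF b] by blast
  then show ?thesis
    using norm_cell_int_le[OF b _ pq n]
    by (intro Infinite_Sum.abs_summable_on_comparison_test'[OF summable_on_cmult_right[OF summable_on_cmult_right[OF summable_on_inverse_int_square]]])
      blast
qed

lemma row_int_bound:
  assumes b: "continuous_on {0..1} b"
  obtains C where "C \<ge> 0" "\<And>n p q. n \<ge> 1 \<Longrightarrow> Re (p + q) \<le> -2 \<Longrightarrow>
    norm (row_int b n p q) \<le> C * exp (pi * \<bar>Im (p - q)\<bar>) * (real n)\<^sup>2"
proof -
  obtain C where C: "C \<ge> 0" "\<And>t. t \<in> {0..1} \<Longrightarrow> \<bar>b t\<bar> \<le> C" using continuous_on_bounded_unit[OF b] by blast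
  define K where "K = (\<Sum>\<^sub>\<infinity>m::int. inverse (1 + (of_int m)\<^sup>2 :: real))"
  have K: "K \<ge> 0" unfolding K_def by (rule infsum_nonneg) auto
  show ?thesis
  proof (rule that[of "C * 3 * K"])
    fix n :: nat and p q :: complex assume n: "n \<ge> 1" and pq: "Re (p + q) \<le> -2"
    let ?f = "cell_int b n p q"
    let ?c = "C * (3 * exp (pi * \<bar>Im (p - q)\<bar>) * (real n)\<^sup>2)"
    have sm: "(\<lambda>m. norm (?f m)) summable_on UNIV" by (rule summable_on_cell_int[OF b pq n])
    have "norm (row_int b n p q) \<le> (\<Sum>\<^sub>\<infinity>m. norm (?f m))"
      unfolding row_int_def by (rule norm_infsum_bound[OF sm])
    also have "\<dots> \<le> (\<Sum>\<^sub>\<infinity>m::int. ?c * inverse (1 + (of_int m)\<^sup>2))"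
      by (rule infsum_mono[OF sm summable_on_cmult_right[OF summable_on_inverse_int_square]])
        (use norm_cell_int_le[OF b C(2) pq n] in \<open>simp add: mult_ac\<close>)
    also have "\<dots> = ?c * K" unfolding K_def by (rule infsum_cmult_right')
    finally show "norm (row_int b n p q) \<le> C * 3 * K * exp (pi * \<bar>Im (p - q)\<bar>) * (real n)\<^sup>2"
      by (simp add: mult_ac)
  qed (use C K in auto)
qed

lemma cell_int_holomorphic2:
  assumes b: "continuous_on {0..1} b" and n: "n \<ge> (1 :: nat)"
  shows "holomorphic2_on (\<lambda>(p, q). cell_int b n p q m) UNIV"
proof (rule holomorphic2_on_separately)
  have c: "continuous_on (UNIV \<times> cbox 0 1)
       (\<lambda>((p, q), t). of_real (b t) * kern p q ((of_int m + t) / of_nat n))"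
    using n unfolding case_prod_unfold
    by (intro continuous_intros continuous_on_compose2[OF b]) auto
  show "continuous_on UNIV (\<lambda>(p, q). cell_int b n p q m)"
    unfolding cell_int_def
    using integral_continuous_on_param[of UNIV 0 1 "\<lambda>x t. of_real (b t) * kern (fst x) (snd x) ((of_int m + t) / of_nat n)"] c
    by (simp add: case_prod_unfold)
  have ker_int: "(\<lambda>t. complex_of_real (b t) * kern p q ((of_int m + t) / of_nat n)) integrable_on cbox 0 1" for p q
    using b n by (intro integrable_continuous continuous_intros) auto
  fix s w :: complex
  let ?L1 = "\<lambda>t. Ln (of_real ((of_int m + t) / real n) + \<i>)"
  let ?L2 = "\<lambda>t. Ln (of_real ((of_int m + t) / real n) - \<i>)"
  have d1: "((\<lambda>z. of_real (b t) * kern z w ((of_int m + t) / of_nat n)) has_field_derivative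
      of_real (b t) * (kern z w ((of_int m + t) / of_nat n) * ?L1 t)) (at z within UNIV)" for z t
    unfolding kern_exp by (auto intro!: derivative_eq_intros)
  have d2: "((\<lambda>z. of_real (b t) * kern s z ((of_int m + t) / of_nat n)) has_field_derivative
      of_real (b t) * (kern s z ((of_int m + t) / of_nat n) * ?L2 t)) (at z within UNIV)" for z t
    unfolding kern_exp by (auto intro!: derivative_eq_intros)
  have "(\<lambda>z. integral (cbox 0 1) (\<lambda>t. of_real (b t) * kern z w ((of_int m + t) / of_nat n))) holomorphic_on UNIV"
    by (rule leibniz_rule_holomorphic[OF d1 ker_int])
      (unfold case_prod_unfold, (intro continuous_intros continuous_on_compose2[OF b])?, use n in auto)
  then show "(\<lambda>z. case (z, w) of (p, q) \<Rightarrow> cell_int b n p q m) field_differentiable at s"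
    by (simp add: cell_int_def holomorphic_on_def)
  have "(\<lambda>z. integral (cbox 0 1) (\<lambda>t. of_real (b t) * kern s z ((of_int m + t) / of_nat n))) holomorphic_on UNIV"
    by (rule leibniz_rule_holomorphic[OF d2 ker_int])
      (unfold case_prod_unfold, (intro continuous_intros continuous_on_compose2[OF b])?, use n in auto)
  then show "(\<lambda>z. case (s, z) of (p, q) \<Rightarrow> cell_int b n p q m) field_differentiable at w"
    by (simp add: cell_int_def holomorphic_on_def)
qed auto

lemma open_Re_add_less: "open {(p, q). Re (p + q) < c}"
  unfolding case_prod_unfold by (intro open_Collect_less continuous_intros)

lemma row_int_holomorphic2:
  assumes b: "continuous_on {0..1} b" and n: "n \<ge> 1"
  shows "holomorphic2_on (\<lambda>(p, q). row_int b n p q) {(p, q). Re (p + q) < -2}"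
proof -
  obtain C where C: "C \<ge> 0" "\<And>t. t \<in> {0..1} \<Longrightarrow> \<bar>b t\<bar> \<le> C" using continuous_on_bounded_unit[OF b] by blast
  have "holomorphic2_on (\<lambda>x. \<Sum>\<^sub>\<infinity>m\<in>UNIV. (\<lambda>(p, q). cell_int b n p q m) x)
      {(p, q). Re (p + q) < -2}"
  proof (rule holomorphic2_on_infsum[OF open_Re_add_less])
    show "holomorphic2_on (\<lambda>(p, q). cell_int b n p q m)
        {(p, q). Re (p + q) < -2}" for m
      by (rule holomorphic2_on_subset[OF cell_int_holomorphic2[OF b n] open_Re_add_less]) auto
    fix R :: real
    let ?M = "\<lambda>m::int. (C * (3 * exp (pi * (2 * R)) * (real n)\<^sup>2)) * inverse (1 + (of_int m)\<^sup>2)"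
    show "\<exists>M. M summable_on UNIV \<and> (\<forall>m\<in>UNIV. \<forall>x\<in>{(p, q). Re (p + q) < -2}. norm x \<le> R \<longrightarrow>
        norm ((\<lambda>(p, q). cell_int b n p q m) x) \<le> M m)"
    proof (intro exI[of _ ?M] conjI ballI impI)
      show "?M summable_on UNIV" by (intro summable_on_cmult_right summable_on_inverse_int_square)
      fix m :: int and x :: "complex \<times> complex" assume x: "x \<in> {(p, q). Re (p + q) < -2}" "norm x \<le> R"
      obtain p q where pq: "x = (p, q)" by fastforce
      have "\<bar>Im (p - q)\<bar> \<le> norm p + norm q"
        using abs_Im_le_cmod[of "p - q"] norm_triangle_ineq4[of p q] by linarith
      also have "\<dots> \<le> 2 * R"
        using x(2) norm_fst_le[of p q] norm_snd_le[of q p] unfolding pq by linarith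
      finally have "exp (pi * \<bar>Im (p - q)\<bar>) \<le> exp (pi * (2 * R))" by simp
      then have "C * (3 * exp (pi * \<bar>Im (p - q)\<bar>) * (real n)\<^sup>2 * inverse (1 + (of_int m)\<^sup>2))
        \<le> C * (3 * exp (pi * (2 * R)) * (real n)\<^sup>2 * inverse (1 + (of_int m)\<^sup>2))"
        using C(1) by (intro mult_left_mono mult_right_mono) auto
      moreover have "norm (cell_int b n p q m)
        \<le> C * (3 * exp (pi * \<bar>Im (p - q)\<bar>) * (real n)\<^sup>2 * inverse (1 + (of_int m)\<^sup>2))"
        using x(1) pq by (intro norm_cell_int_le[OF b C(2) _ n]) auto
      ultimately show "norm ((\<lambda>(p, q). cell_int b n p q m) x) \<le> ?M m"
        unfolding pq by (simp add: mult_ac)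
    qed
  qed
  then show ?thesis by (simp add: row_int_def case_prod_unfold)
qed

text \<open>The boundary terms at \<open>m + 1\<close> and \<open>m\<close> combine, after a shift
  of \<open>m\<close>, to a multiple of the row sum, and differentiating \<open>kern\<close> in the
  scaled variable brings out \<open>1 / n\<close>. Three cases occur below: \<open>b = 1\<close>
  compares the row sum with an integral (Euler-Maclaurin), a mean-zero \<open>b\<close> leaves no
  row sum, and \<open>b = 0\<close> with \<open>B = 1\<close> integrates a derivative.\<close>

lemma row_int_by_parts:
  assumes b: "continuous_on {0..1} b" and B: "\<And>t. t \<in> {0..1} \<Longrightarrow> (B has_real_derivative b t) (at t within {0..1})"
    and pq: "Re (p + q) \<le> -2" and n: "n \<ge> 1"
  shows "row_int b n p q = of_real (B 1 - B 0) * (\<Sum>\<^sub>\<infinity>m::int. kern p q (of_int m / of_nat n))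
    - (p * row_int B n (p - 1) q + q * row_int B n p (q - 1)) / of_nat n"
proof -
  have Bc: "continuous_on {0..1} B"
    using B by (meson DERIV_continuous_on)
  let ?k = "\<lambda>p q m t. kern p q ((of_int m + t) / of_nat n)"
  define F where "F = (\<lambda>m::int. kern p q (of_int m / of_nat n))"
  have F: "F summable_on UNIV" unfolding F_def by (rule abs_summable_summable[OF summable_on_kern_row[OF pq n]])
  let ?I1 = "cell_int B n (p - 1) q" and ?I2 = "cell_int B n p (q - 1)"
  have I1: "?I1 summable_on UNIV" and I2: "?I2 summable_on UNIV"
    using pq
    by (rule_tac [!] abs_summable_summable[OF summable_on_cell_int[OF Bc _ n]]) auto
  have parts: "cell_int b n p q m =
      of_real (B 1) * F (m + 1) - of_real (B 0) * F m - (p * ?I1 m + q * ?I2 m) / of_nat n" for m :: int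
  proof -
    have dB: "((\<lambda>t. complex_of_real (B t)) has_vector_derivative of_real (b t)) (at t within {0..1})" if "t \<in> {0..1}" for t
      using B[OF that] by (simp add: has_vector_derivative_of_real has_real_derivative_iff_has_vector_derivative)
    have cont: "continuous_on {0..1} (\<lambda>t. complex_of_real (B t) * ?k p' q' m t)" for p' q'
      using Bc n by (auto intro!: continuous_intros)
    have h1: "((\<lambda>t. of_real (b t) * ?k p q m t + of_real (B t) * ((p * ?k (p - 1) q m t + q * ?k p (q - 1) m t) / of_nat n))
       has_integral (of_real (B 1) * ?k p q m 1 - of_real (B 0) * ?k p q m 0)) {0..1}"
    proof (rule fundamental_theorem_of_calculus)
      fix t :: real assume t: "t \<in> {0..1}"
      show "((\<lambda>t. of_real (B t) * ?k p q m t) has_vector_derivative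
        of_real (b t) * ?k p q m t + of_real (B t) * ((p * ?k (p - 1) q m t + q * ?k p (q - 1) m t) / of_nat n)) (at t within {0..1})"
        using has_vector_derivative_mult[OF dB[OF t] kern_scaled_has_vector_derivative[OF n]]
        by (simp add: add.commute)
    qed simp
    have h2: "((\<lambda>t. of_real (B t) * ((p * ?k (p - 1) q m t + q * ?k p (q - 1) m t) / of_nat n))
       has_integral ((p * ?I1 m + q * ?I2 m) / of_nat n)) {0..1}"
    proof -
      have "((\<lambda>t. (p * (of_real (B t) * ?k (p - 1) q m t) + q * (of_real (B t) * ?k p (q - 1) m t)) / of_nat n)
       has_integral ((p * ?I1 m + q * ?I2 m) / of_nat n)) {0..1}"
        unfolding cell_int_def
        by (intro has_integral_divide has_integral_add has_integral_mult_right integrable_integral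
            integrable_continuous_interval cont)
      then show ?thesis by (simp add: algebra_simps)
    qed
    have "((\<lambda>t. of_real (b t) * ?k p q m t) has_integral
       (of_real (B 1) * ?k p q m 1 - of_real (B 0) * ?k p q m 0 - (p * ?I1 m + q * ?I2 m) / of_nat n)) {0..1}"
      using has_integral_diff[OF h1 h2] by simp
    then show ?thesis by (simp add: cell_int_def integral_unique F_def)
  qed
  define S i1 i2 where "S = infsum F UNIV" and "i1 = infsum ?I1 UNIV" and "i2 = infsum ?I2 UNIV"
  have hF: "(F has_sum S) UNIV" and hI: "(?I1 has_sum i1) UNIV" "(?I2 has_sum i2) UNIV"
    using F I1 I2 by (simp_all add: S_def i1_def i2_def)
  have hF1: "((\<lambda>m. F (m + 1)) has_sum S) UNIV"
    using hF has_sum_reindex_bij_betw[OF bij_plus_right[of 1], of F S] by blast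
  have "((\<lambda>m. of_real (B 1) * F (m + 1) + (- of_real (B 0)) * F m + (p * ?I1 m + q * ?I2 m) * (- inverse (of_nat n)))
     has_sum (of_real (B 1) * S + (- of_real (B 0)) * S + (p * i1 + q * i2) * (- inverse (of_nat n)))) UNIV"
    by (intro has_sum_add has_sum_cmult_left has_sum_cmult_right hF hF1 hI)
  moreover have "cell_int b n p q = (\<lambda>m. of_real (B 1) * F (m + 1) + (- of_real (B 0)) * F m + (p * ?I1 m + q * ?I2 m) * (- inverse (of_nat n)))"
    by (simp add: fun_eq_iff parts divide_inverse)
  ultimately have "row_int b n p q = of_real (B 1) * S + (- of_real (B 0)) * S + (p * i1 + q * i2) * (- inverse (of_nat n))"
    unfolding row_int_def by (simp only: infsumI)
  then show ?thesis
    unfolding S_def i1_def i2_def F_def row_int_def by (simp add: divide_inverse algebra_simps)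
qed

text \<open>\<open>B 0 = B 1\<close> because \<open>b\<close> has mean zero, and the constant of
  integration is chosen so that \<open>B\<close> has mean zero as well; the step can then be
  repeated. Starting from \<open>t - 1 / 2\<close>, this runs through multiples of the Bernoulli
  polynomials.\<close>

lemma mean_zero_antiderivative:
  fixes b :: "real \<Rightarrow> real"
  assumes b: "continuous_on {0..1} b" "integral {0..1} b = 0"
  obtains B where "continuous_on {0..1} B" "integral {0..1} B = 0" "B 0 = B 1"
    "\<And>t. t \<in> {0..1} \<Longrightarrow> (B has_real_derivative b t) (at t within {0..1})"
proof -
  define B0 where "B0 = (\<lambda>t. integral {0..t} b)"
  have d: "(B0 has_real_derivative b t) (at t within {0..1})" if "t \<in> {0..1}" for t
    unfolding B0_def by (rule integral_has_real_derivative[OF b(1) that])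
  then have c: "continuous_on {0..1} B0" by (meson DERIV_continuous_on)
  define a where "a = integral {0..1} B0"
  show ?thesis
  proof (rule that[of "\<lambda>t. B0 t - a"])
    show "continuous_on {0..1} (\<lambda>t. B0 t - a)" using c by (intro continuous_intros)
    have "integral {0..1} (\<lambda>t. B0 t - a) = a - integral {0..1} (\<lambda>t::real. a)"
      unfolding a_def by (rule Henstock_Kurzweil_Integration.integral_diff)
        (use c in \<open>auto intro: integrable_continuous_interval\<close>)
    then show "integral {0..1} (\<lambda>t. B0 t - a) = 0" by simp
    show "B0 0 - a = B0 1 - a" using b(2) by (simp add: B0_def)
    show "((\<lambda>t. B0 t - a) has_real_derivative b t) (at t within {0..1})" if "t \<in> {0..1}" for t
      using d[OF that] by (auto intro!: derivative_eq_intros)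
  qed
qed

text \<open>Each integration by parts gains a factor \<open>1 / n\<close> and widens the half plane by \<open>1\<close>.\<close>
lemma row_int_continuation:
  assumes "continuous_on {0..1} b" "integral {0..1} b = 0"
  shows "\<exists>E C. C \<ge> 0 \<and> (\<forall>n\<ge>1. holomorphic2_on (E n) {(p, q). Re (p + q) < real J - 2} \<and>
      (\<forall>p q. Re (p + q) < -2 \<longrightarrow> E n (p, q) = row_int b n p q) \<and>
      (\<forall>p q. Re (p + q) < real J - 2 \<longrightarrow>
         norm (E n (p, q)) \<le> C * (1 + norm p + norm q) ^ J * exp (pi * \<bar>Im (p - q)\<bar>) * (real n)\<^sup>2 / real n ^ J))"
  using assms
proof (induction J arbitrary: b)
  case 0
  obtain C where C: "C \<ge> 0" "\<And>n p q. n \<ge> 1 \<Longrightarrow> Re (p + q) \<le> -2 \<Longrightarrow>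
    norm (row_int b n p q) \<le> C * exp (pi * \<bar>Im (p - q)\<bar>) * (real n)\<^sup>2"
    using row_int_bound[OF 0(1)] by blast
  show ?case
    by (intro exI[of _ "\<lambda>n (p, q). row_int b n p q"] exI[of _ C])
      (use C row_int_holomorphic2[OF 0(1)] in \<open>auto simp: case_prod_unfold\<close>)
next
  case (Suc J)
  obtain B where B: "continuous_on {0..1} B" "integral {0..1} B = 0" "B 0 = B 1"
    "\<And>t. t \<in> {0..1} \<Longrightarrow> (B has_real_derivative b t) (at t within {0..1})"
    using mean_zero_antiderivative[OF Suc.prems] by blast
  obtain E C where C: "C \<ge> 0" and E: "\<And>n. n \<ge> 1 \<Longrightarrow> holomorphic2_on (E n) {(p, q). Re (p + q) < real J - 2}"
      "\<And>n p q. n \<ge> 1 \<Longrightarrow> Re (p + q) < -2 \<Longrightarrow> E n (p, q) = row_int B n p q"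
      "\<And>n p q. n \<ge> 1 \<Longrightarrow> Re (p + q) < real J - 2 \<Longrightarrow>
         norm (E n (p, q)) \<le> C * (1 + norm p + norm q) ^ J * exp (pi * \<bar>Im (p - q)\<bar>) * (real n)\<^sup>2 / real n ^ J"
    using Suc.IH[OF B(1,2)] by blast
  define E' where "E' = (\<lambda>n x. (fst x * E n (fst x - 1, snd x) + snd x * E n (fst x, snd x - 1)) * (- inverse (of_nat n)))"
  show ?case
  proof (rule exI[of _ E'], rule exI[of _ "2 ^ J * C"], intro conjI allI impI)
    show "0 \<le> 2 ^ J * C" using C by simp
    fix n :: nat assume n: "n \<ge> 1"
    let ?U = "{(p, q). Re (p + q) < real (Suc J) - 2}"
    have U: "open ?U" by (rule open_Re_add_less)
    show "holomorphic2_on (E' n) ?U"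
      unfolding E'_def
      by (intro holomorphic2_on_mult holomorphic2_on_add holomorphic2_on_compose2[OF E(1)[OF n]] holomorphic2_on_diff
          holomorphic2_on_fst holomorphic2_on_snd holomorphic2_on_const U) auto
    show "E' n (p, q) = row_int b n p q" if pq: "Re (p + q) < -2" for p q
    proof -
      have "E n (p - 1, q) = row_int B n (p - 1) q" "E n (p, q - 1) = row_int B n p (q - 1)"
        using pq by (auto intro!: E(2)[OF n])
      then show ?thesis
        using row_int_by_parts[OF Suc.prems(1) B(4), of p q n] pq n
        by (simp add: E'_def B(3) divide_inverse)
    qed
    fix p q :: complex assume pq: "Re (p + q) < real (Suc J) - 2"
    let ?e = "exp (pi * \<bar>Im (p - q)\<bar>)"
    let ?K = "1 + norm p + norm q"
    \<comment> \<open>Lowering \<open>p\<close> or \<open>q\<close> by one leaves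
      \<open>Im (p - q)\<close> alone and at most doubles \<open>?K\<close>, which accounts for the
      constant \<open>2 ^ J * C\<close>.\<close>
    have key: "norm (E n (p', q')) \<le> C * (2 * ?K) ^ J * ?e * (real n)\<^sup>2 / real n ^ J"
      if *: "Re (p' + q') < real J - 2" "norm p' + norm q' \<le> 1 + norm p + norm q" "Im (p' - q') = Im (p - q)" for p' q'
    proof -
      have "norm (E n (p', q')) \<le> C * (1 + norm p' + norm q') ^ J * ?e * (real n)\<^sup>2 / real n ^ J"
        using E(3)[OF n *(1)] unfolding *(3) .
      also have "\<dots> \<le> C * (2 * ?K) ^ J * ?e * (real n)\<^sup>2 / real n ^ J"
        using C order_trans[OF *(2), of "1 + 2 * norm p + 2 * norm q"]
        by (intro divide_right_mono mult_right_mono mult_left_mono power_mono) auto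
      finally show ?thesis .
    qed
    have k1: "norm (E n (p - 1, q)) \<le> C * (2 * ?K) ^ J * ?e * (real n)\<^sup>2 / real n ^ J"
      using pq norm_triangle_ineq4[of p 1] by (intro key) auto
    have k2: "norm (E n (p, q - 1)) \<le> C * (2 * ?K) ^ J * ?e * (real n)\<^sup>2 / real n ^ J"
      using pq norm_triangle_ineq4[of q 1] by (intro key) auto
    let ?b = "C * (2 * ?K) ^ J * ?e * (real n)\<^sup>2 / real n ^ J"
    have b0: "?b \<ge> 0" using C by simp
    have "norm (p * E n (p - 1, q) + q * E n (p, q - 1)) \<le> norm p * ?b + norm q * ?b"
      by (intro order_trans[OF norm_triangle_ineq] add_mono)
        (simp_all only: norm_mult mult_left_mono[OF k1 norm_ge_zero] mult_left_mono[OF k2 norm_ge_zero])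
    also have "\<dots> = (norm p + norm q) * ?b" by (rule distrib_right[symmetric])
    also have "\<dots> \<le> ?K * ?b" using b0 by (intro mult_right_mono) auto
    finally have "norm (p * E n (p - 1, q) + q * E n (p, q - 1)) * inverse (real n) \<le> ?K * ?b * inverse (real n)"
      by (rule mult_right_mono) simp
    also have "?K * ?b * inverse (real n) = 2 ^ J * C * ?K ^ Suc J * ?e * (real n)\<^sup>2 / real n ^ Suc J"
      unfolding power_mult_distrib by (simp add: divide_inverse mult_ac)
    finally show "norm (E' n (p, q)) \<le> 2 ^ J * C * ?K ^ Suc J * ?e * (real n)\<^sup>2 / real n ^ Suc J"
      by (simp add: E'_def norm_mult norm_inverse)
  qed
qed

text \<open>\<open>kern\<close> is the restriction of a holomorphic function on the strip
  \<open>\<bar>Im z\<bar> < 1\<close>, which is convex and misses both branch cuts. Values of the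
  primitive later replace a change of variables in the integral over the line.\<close>

lemma kern_primitive:
  obtains G where "\<And>x. (G has_vector_derivative kern p q x) (at x)"
proof -
  define S where "S = {z. Im z < 1} \<inter> {z. Im z > - 1}"
  have conv: "convex S" unfolding S_def by (intro convex_Int convex_halfspace_Im_lt convex_halfspace_Im_gt)
  have S: "open S" unfolding S_def by (intro open_Int open_halfspace_Im_lt open_halfspace_Im_gt)
  have "z + \<i> \<notin> \<real>\<^sub>\<le>\<^sub>0" "z - \<i> \<notin> \<real>\<^sub>\<le>\<^sub>0" if "z \<in> S" for z
    using that by (auto simp: S_def complex_nonpos_Reals_iff)
  then have hol: "(\<lambda>z. (z + \<i>) powr p * (z - \<i>) powr q) holomorphic_on S"
    by (auto intro!: holomorphic_intros)
  obtain G where G: "\<And>z. z \<in> S \<Longrightarrow> (G has_field_derivative (z + \<i>) powr p * (z - \<i>) powr q) (at z within S)"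
    using holomorphic_convex_primitive'[OF conv S hol] by metis
  have "(G has_field_derivative kern p q x) (at (of_real x))" for x
  proof -
    have x: "of_real x \<in> S" by (simp add: S_def)
    show ?thesis using G[OF x] unfolding at_within_open[OF x S] kern_def .
  qed
  then have "((\<lambda>x. G (of_real x)) has_vector_derivative kern p q x) (at x)" for x
    by (rule has_vector_derivative_real_field)
  then show ?thesis by (rule that)
qed

text \<open>Both sides are \<open>n\<close> times the integral of \<open>kern p q\<close> over the
  line. Writing \<open>m = n * l + r\<close> groups \<open>n\<close> cells of length
  \<open>1 / n\<close> into the unit cell at \<open>l\<close>, where the primitive
  telescopes.\<close>

lemma row_int_one_scale:
  assumes n: "n \<ge> 1" and pq: "Re (p + q) \<le> -2"
  shows "row_int (\<lambda>_. 1) n p q = of_nat n * row_int (\<lambda>_. 1) 1 p q"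
proof -
  obtain G where G: "\<And>x. (G has_vector_derivative kern p q x) (at x)" using kern_primitive by blast
  define I where "I = (\<lambda>n. cell_int (\<lambda>_. 1) n p q)"
  have I: "I n m = of_nat n * (G ((of_int m + 1) / of_nat n) - G (of_int m / of_nat n))" if n: "n \<ge> 1" for n m
  proof -
    have "((\<lambda>t. of_nat n * G ((of_int m + t) / real n)) has_vector_derivative kern p q ((of_int m + t) / real n))
       (at t within {0..1})" for t
    proof -
      have "((\<lambda>t. (of_int m + t) / real n) has_real_derivative (1 / real n)) (at t within {0..1})"
        using n by (auto intro!: derivative_eq_intros)
      then have "((\<lambda>t. (of_int m + t) / real n) has_vector_derivative (1 / real n)) (at t within {0..1})"
        by (simp add: has_real_derivative_iff_has_vector_derivative)
      from vector_diff_chain_within[OF this has_vector_derivative_at_within[OF G]]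
      have "((\<lambda>t. G ((of_int m + t) / real n)) has_vector_derivative (1 / real n) *\<^sub>R kern p q ((of_int m + t) / real n)) (at t within {0..1})"
        by (simp add: o_def)
      from has_vector_derivative_mult_right[OF this, of "of_nat n"] show ?thesis
        using n by (simp add: scaleR_conv_of_real)
    qed
    then have "((\<lambda>t. kern p q ((of_int m + t) / real n)) has_integral
        (of_nat n * G ((of_int m + 1) / real n) - of_nat n * G ((of_int m + 0) / real n))) {0..1}"
      by (intro fundamental_theorem_of_calculus) auto
    then show ?thesis unfolding I_def cell_int_def by (simp add: integral_unique algebra_simps)
  qed
  have sm: "I n summable_on UNIV"
    unfolding I_def by (rule abs_summable_summable[OF summable_on_cell_int[OF _ pq n]]) auto
  have bij: "bij_betw (\<lambda>(l, r). int n * l + int r) (UNIV \<times> {..<n}) UNIV"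
  proof (rule bij_betwI[where g = "\<lambda>m. (m div int n, nat (m mod int n))"])
    show "(\<lambda>m. (m div int n, nat (m mod int n))) \<in> UNIV \<rightarrow> UNIV \<times> {..<n}"
      using n by (auto simp: nat_less_iff)
  qed (use n in auto)
  have "row_int (\<lambda>_. 1) n p q = infsum (I n) UNIV" by (simp add: row_int_def I_def)
  also have "\<dots> = infsum (\<lambda>(l, r). I n (int n * l + int r)) (UNIV \<times> {..<n})"
    by (subst infsum_reindex_bij_betw[OF bij, symmetric]) (simp add: case_prod_unfold)
  also have "\<dots> = infsum (\<lambda>l. infsum (\<lambda>r. I n (int n * l + int r)) {..<n}) UNIV"
  proof (rule infsum_Sigma'_banach[symmetric])
    show "(\<lambda>(l, r). I n (int n * l + int r)) summable_on UNIV \<times> {..<n}"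
      using summable_on_reindex_bij_betw[OF bij, of "I n"] sm by (simp add: case_prod_unfold)
  qed
  also have "(\<lambda>l. infsum (\<lambda>r. I n (int n * l + int r)) {..<n}) = (\<lambda>l. of_nat n * I 1 l)"
  proof
    fix l :: int
    define H where "H = (\<lambda>r::nat. G ((of_int (int n * l) + of_nat r) / of_nat n))"
    have "infsum (\<lambda>r. I n (int n * l + int r)) {..<n} = (\<Sum>r<n. of_nat n * (H (Suc r) - H r))"
      by (simp add: I[OF n] H_def add_ac)
    also have "\<dots> = of_nat n * (H n - H 0)"
      by (simp add: sum_lessThan_telescope flip: sum_distrib_left)
    also have "H n = G (of_int l + 1)"
      using n by (simp add: H_def add_divide_distrib)
    also have "H 0 = G (of_int l)"
      using n by (simp add: H_def)
    also have "G (of_int l + 1) - G (of_int l) = I 1 l"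
      using I[of 1 l] by simp
    finally show "infsum (\<lambda>r. I n (int n * l + int r)) {..<n} = of_nat n * I 1 l" .
  qed
  also have "infsum (\<lambda>l. of_nat n * I 1 l) UNIV = of_nat n * row_int (\<lambda>_. 1) 1 p q"
    by (simp add: infsum_cmult_right' row_int_def I_def)
  finally show ?thesis .
qed

text \<open>Integrating the derivative of \<open>kern p (q + 1)\<close> relates the exponents
  \<open>(p - 1, q + 1)\<close> and \<open>(p, q)\<close>, and
  \<open>x - \<i> = (x + \<i>) - 2 * \<i>\<close> eliminates the former. The integral is of Beta
  type, and this is its analogue of the recurrence of the Gamma function. The bound
  \<open>-3\<close> is what integration by parts at \<open>(p, q + 1)\<close> requires.\<close>

lemma row_int_one_rec:
  assumes pq: "Re (p + q) \<le> -3"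
  shows "(p + q + 1) * row_int (\<lambda>_. 1) 1 p q = 2 * \<i> * p * row_int (\<lambda>_. 1) 1 (p - 1) q"
proof -
  let ?f = "cell_int (\<lambda>_. 1) 1"
  \<comment> \<open>Weight \<open>0\<close> with antiderivative \<open>1\<close>: the integral of a
    derivative over the line vanishes.\<close>
  have "0 = row_int (\<lambda>_. 0) 1 p (q + 1)" by (simp add: row_int_def cell_int_def)
  also have "\<dots> = - (p * row_int (\<lambda>_. 1) 1 (p - 1) (q + 1) + (q + 1) * row_int (\<lambda>_. 1) 1 p q)"
    using pq by (subst row_int_by_parts[where B = "\<lambda>_. 1"]) auto
  finally have 1: "p * row_int (\<lambda>_. 1) 1 (p - 1) (q + 1) + (q + 1) * row_int (\<lambda>_. 1) 1 p q = 0"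
    by (simp only: neg_0_equal_iff_equal)
  have "kern (p - 1) (q + 1) x = kern p q x - 2 * \<i> * kern (p - 1) q x" for x
  proof -
    have a: "kern (p - 1) (q + 1) x = kern (p - 1) q x * (of_real x - \<i>)"
      using kern_add[of "p - 1" 0 q 1 x] by (simp add: kern_def)
    have b: "kern p q x = kern (p - 1) q x * (of_real x + \<i>)"
      using kern_add[of "p - 1" 1 q 0 x] by (simp add: kern_def)
    show ?thesis unfolding a b by (simp add: algebra_simps)
  qed
  then have cell: "?f (p - 1) (q + 1) m = ?f p q m + (- (2 * \<i>)) * ?f (p - 1) q m" for m
  proof -
    have "((\<lambda>t. of_real 1 * kern p q ((of_int m + t) / of_nat 1) + (- (2 * \<i>)) * (of_real 1 * kern (p - 1) q ((of_int m + t) / of_nat 1)))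
       has_integral (?f p q m + (- (2 * \<i>)) * ?f (p - 1) q m)) {0..1}"
      unfolding cell_int_def
      by (intro has_integral_add has_integral_mult_right integrable_integral integrable_continuous_interval continuous_intros) auto
    then show ?thesis
      using \<open>\<And>x. kern (p - 1) (q + 1) x = _\<close> by (simp add: cell_int_def integral_unique)
  qed
  have hs: "(?f p' q' has_sum row_int (\<lambda>_. 1) 1 p' q') UNIV" if "Re (p' + q') \<le> -2" for p' q'
    unfolding row_int_def
    by (rule has_sum_infsum, rule abs_summable_summable[OF summable_on_cell_int]) (use that in auto)
  have "((\<lambda>m. ?f p q m + (- (2 * \<i>)) * ?f (p - 1) q m) has_sum
      (row_int (\<lambda>_. 1) 1 p q + (- (2 * \<i>)) * row_int (\<lambda>_. 1) 1 (p - 1) q)) UNIV"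
    using pq by (intro has_sum_add has_sum_cmult_right hs) auto
  then have "row_int (\<lambda>_. 1) 1 (p - 1) (q + 1) = row_int (\<lambda>_. 1) 1 p q + (- (2 * \<i>)) * row_int (\<lambda>_. 1) 1 (p - 1) q"
    unfolding row_int_def[of _ _ "p - 1" "q + 1"] cell by (rule infsumI)
  with 1 have 2: "p * (row_int (\<lambda>_. 1) 1 p q + (- (2 * \<i>)) * row_int (\<lambda>_. 1) 1 (p - 1) q)
      + (q + 1) * row_int (\<lambda>_. 1) 1 p q = 0" by simp
  have "(p + q + 1) * a - 2 * \<i> * p * b = p * (a + (- (2 * \<i>)) * b) + (q + 1) * a" for a b
    by (simp add: algebra_simps)
  from this[of "row_int (\<lambda>_. 1) 1 p q" "row_int (\<lambda>_. 1) 1 (p - 1) q"] show ?thesis unfolding 2 by simp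
qed

text \<open>The right-hand side makes sense for \<open>Re (p + q) < real N - 2\<close>, so this
  continues the integral as a quotient. The product on the left depends on \<open>p + q\<close>
  only, hence not on \<open>k\<close> when \<open>p = k - s\<close> and
  \<open>q = - k - s - v\<close>.\<close>

lemma row_int_one_continuation:
  assumes pq: "Re (p + q) \<le> -3"
  shows "(\<Prod>j<N. p + q + 1 - of_nat j) * row_int (\<lambda>_. 1) 1 p q =
    (2 * \<i>) ^ N * (\<Prod>j<N. p - of_nat j) * row_int (\<lambda>_. 1) 1 (p - of_nat N) q"
proof (induction N)
  case (Suc N)
  have "(\<Prod>j<Suc N. p + q + 1 - of_nat j) * row_int (\<lambda>_. 1) 1 p q =
     (p + q + 1 - of_nat N) * ((\<Prod>j<N. p + q + 1 - of_nat j) * row_int (\<lambda>_. 1) 1 p q)"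
    by (simp add: mult_ac)
  also have "\<dots> = (2 * \<i>) ^ N * (\<Prod>j<N. p - of_nat j) * ((p - of_nat N + q + 1) * row_int (\<lambda>_. 1) 1 (p - of_nat N) q)"
    unfolding Suc by (simp add: algebra_simps)
  also have "(p - of_nat N + q + 1) * row_int (\<lambda>_. 1) 1 (p - of_nat N) q =
      2 * \<i> * (p - of_nat N) * row_int (\<lambda>_. 1) 1 (p - of_nat N - 1) q"
    using pq by (intro row_int_one_rec) auto
  finally show ?case by (simp add: mult_ac diff_diff_eq add.commute)
qed simp

subsection \<open>Binomial remainders and the zeta function\<close>

definition binom_rem :: "nat \<Rightarrow> complex \<Rightarrow> complex \<Rightarrow> complex" where
  "binom_rem N c z = (1 + z) powr c - (\<Sum>i<N. (c gchoose i) * z ^ i)"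

lemma holomorphic_on_gchoose [holomorphic_intros]:
  assumes "f holomorphic_on S"
  shows "(\<lambda>z. (f z :: complex) gchoose k) holomorphic_on S"
  unfolding gbinomial_prod_rev using assms by (intro holomorphic_intros) auto

text \<open>Induction by the mean value inequality: the derivative of the remainder of order
  \<open>N + 1\<close> for \<open>c\<close> is \<open>c\<close> times the remainder of order
  \<open>N\<close> for \<open>c - 1\<close>, and the former vanishes at \<open>0\<close>. The radius
  is arbitrary in the induction since \<open>c - 1\<close> needs \<open>R + 1\<close>.\<close>

lemma binom_rem_bound:
  "\<exists>C\<ge>0. \<forall>c x. norm c \<le> R \<longrightarrow> 0 \<le> x \<longrightarrow> x \<le> 1 \<longrightarrow> norm (binom_rem N c (of_real x)) \<le> C * x ^ N"
proof (induction N arbitrary: R)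
  case 0
  show ?case
  proof (intro exI[of _ "2 powr \<bar>R\<bar>"] conjI allI impI)
    fix c :: complex and x :: real assume *: "norm c \<le> R" "0 \<le> x" "x \<le> 1"
    have "norm ((1 + of_real x) powr c) = (1 + x) powr Re c"
      using *(2) by (subst norm_powr_real_powr) simp_all
    also have "\<dots> \<le> (1 + x) powr \<bar>R\<bar>"
      using * abs_Re_le_cmod[of c] by (intro powr_mono) auto
    also have "\<dots> \<le> 2 powr \<bar>R\<bar>" using * by (intro powr_mono2) auto
    finally show "norm (binom_rem 0 c (of_real x)) \<le> 2 powr \<bar>R\<bar> * x ^ 0"
      by (simp add: binom_rem_def)
  qed auto
next
  case (Suc N)
  obtain C where C: "C \<ge> 0" "\<And>c x. norm c \<le> R + 1 \<Longrightarrow> 0 \<le> x \<Longrightarrow> x \<le> 1 \<Longrightarrow> norm (binom_rem N c (of_real x)) \<le> C * x ^ N"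
    using Suc[of "R + 1"] by blast
  show ?case
  proof (intro exI[of _ "\<bar>R\<bar> * C"] conjI allI impI)
    show "0 \<le> \<bar>R\<bar> * C" using C by simp
    fix c :: complex and x :: real assume *: "norm c \<le> R" "0 \<le> x" "x \<le> 1"
    have d: "(binom_rem (Suc N) c has_field_derivative c * binom_rem N (c - 1) z) (at z within S)"
      if "z \<in> closed_segment 0 (of_real x)" for z S
    proof -
      from that obtain u where u: "0 \<le> u" "z = of_real (u * x)"
        by (auto simp: closed_segment_def scaleR_conv_of_real)
      have z: "1 + z \<notin> \<real>\<^sub>\<le>\<^sub>0"
      proof -
        have "u * x \<ge> 0" using u(1) *(2) by simp
        then show ?thesis unfolding u(2) by (simp add: complex_nonpos_Reals_iff)
      qed
      have "((\<lambda>z. (1 + z) powr c - (\<Sum>i<Suc N. (c gchoose i) * z ^ i)) has_field_derivative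
          c * (1 + z) powr (c - 1) - (\<Sum>i<Suc N. (c gchoose i) * (of_nat i * z ^ (i - 1)))) (at z within S)"
        using z by (auto intro!: derivative_eq_intros DERIV_sum sum.cong simp del: sum.lessThan_Suc)
      also have "(\<Sum>i<Suc N. (c gchoose i) * (of_nat i * z ^ (i - 1))) = (\<Sum>i<N. (of_nat (Suc i) * (c gchoose Suc i)) * z ^ i)"
        by (subst sum.lessThan_Suc_shift) (simp add: mult_ac del: of_nat_Suc)
      also have "\<dots> = c * (\<Sum>i<N. ((c - 1) gchoose i) * z ^ i)"
        unfolding gbinomial_absorption by (simp add: sum_distrib_left mult_ac)
      finally show ?thesis by (simp add: binom_rem_def[abs_def] algebra_simps)
    qed
    have "norm (binom_rem (Suc N) c (of_real x) - binom_rem (Suc N) c 0) \<le> (\<bar>R\<bar> * C * x ^ N) * norm (complex_of_real x - 0)"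
    proof (rule field_differentiable_bound[OF convex_closed_segment[of 0 "of_real x"] d])
      fix z assume "z \<in> closed_segment 0 (complex_of_real x)"
      then obtain u where u: "0 \<le> u" "u \<le> 1" "z = of_real (u * x)"
        by (auto simp: closed_segment_def scaleR_conv_of_real)
      have ux: "0 \<le> u * x" "u * x \<le> x" using u *(2) by (auto intro: mult_left_le_one_le)
      have "norm (binom_rem N (c - 1) z) \<le> C * (u * x) ^ N"
        unfolding u(3) using ux *(1,3) norm_triangle_ineq4[of c 1] by (intro C(2)) auto
      also have "\<dots> \<le> C * x ^ N" using ux C(1) by (intro mult_left_mono power_mono) auto
      finally show "norm (c * binom_rem N (c - 1) z) \<le> \<bar>R\<bar> * C * x ^ N"
        unfolding norm_mult mult.assoc using *(1) by (intro mult_mono) auto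
    qed auto
    moreover have "binom_rem (Suc N) c 0 = 0"
      unfolding binom_rem_def by (subst sum.lessThan_Suc_shift) simp
    ultimately show "norm (binom_rem (Suc N) c (of_real x)) \<le> \<bar>R\<bar> * C * x ^ Suc N"
      using *(2) by (simp add: mult_ac)
  qed
qed

section \<open>Continuation of the Riemann zeta function\<close>

definition zeta0 :: "complex \<Rightarrow> complex" where
  "zeta0 z = (\<Sum>\<^sub>\<infinity>n\<in>{1..}. of_nat n powr (- z))"

lemma norm_of_nat_powr: "norm (of_nat n powr z :: complex) = real n powr Re z"
  by (subst norm_powr_real_powr) auto

lemma summable_on_real_powr:
  assumes "a < -1"
  shows "(\<lambda>n. real n powr a) summable_on {1..}"
proof -
  have "summable (\<lambda>n. real n powr a)" using assms by (simp add: summable_real_powr_iff)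
  then have "(\<lambda>n. real n powr a) summable_on UNIV" by (intro summable_nonneg_imp_summable_on) auto
  then show ?thesis by (rule summable_on_subset_banach) auto
qed

lemma abs_summable_on_of_nat_powr:
  assumes "Re z > 1"
  shows "(\<lambda>n. norm (of_nat n powr (- z) :: complex)) summable_on {1..}"
  using summable_on_real_powr[of "- Re z"] assms by (simp add: norm_of_nat_powr)

lemma zeta0_has_sum:
  assumes "Re z > 1"
  shows "((\<lambda>n. of_nat n powr (- z)) has_sum zeta0 z) {1..}"
  unfolding zeta0_def by (rule has_sum_infsum, rule abs_summable_summable[OF abs_summable_on_of_nat_powr[OF assms]])

lemma of_nat_powr_mult_power:
  assumes "n \<ge> (1::nat)"
  shows "of_nat n powr z * (1 / of_nat n) ^ i = (of_nat n powr (z - of_nat i) :: complex)"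
  using assms by (simp add: powr_diff power_one_over divide_inverse powr_nat power_inverse)

lemma Suc_powr_expand:
  assumes n: "n \<ge> (1::nat)"
  shows "of_nat (Suc n) powr c = (\<Sum>i<J. (c gchoose i) * of_nat n powr (c - of_nat i))
     + of_nat n powr c * binom_rem J c (of_real (1 / real n))"
proof -
  have "of_nat (Suc n) = of_real (real n) * (1 + complex_of_real (1 / real n))"
    using n by (simp add: field_simps)
  also have "\<dots> powr c = of_nat n powr c * (1 + complex_of_real (1 / real n)) powr c"
    using n by (subst powr_times_real) (auto simp: complex_eq_iff)
  also have "(1 + complex_of_real (1 / real n)) powr c =
      (\<Sum>i<J. (c gchoose i) * (1 / of_nat n) ^ i) + binom_rem J c (of_real (1 / real n))"
    by (simp add: binom_rem_def)
  finally show ?thesis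
    using of_nat_powr_mult_power[OF n] by (simp add: algebra_simps sum_distrib_left)
qed

lemma has_sum_sum:
  fixes f :: "'i \<Rightarrow> 'a \<Rightarrow> 'b::topological_comm_monoid_add"
  assumes "finite I" "\<And>i. i \<in> I \<Longrightarrow> (f i has_sum S i) A"
  shows "((\<lambda>x. \<Sum>i\<in>I. f i x) has_sum (\<Sum>i\<in>I. S i)) A"
  using assms by (induction I rule: finite_induct) (auto intro!: has_sum_add)

text \<open>Summing \<open>(n + 1) powr (1 - z)\<close> gives \<open>zeta0 (z - 1) - 1\<close>. When
  each term is expanded in powers of \<open>n\<close> instead, the part \<open>i = 0\<close> cancels
  \<open>zeta0 (z - 1)\<close>, the part \<open>i = 1\<close> is \<open>(1 - z) * zeta0 z\<close>,
  and all others are zeta values to the right of \<open>z\<close>.\<close>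

lemma zeta0_recursion:
  assumes z: "Re z > 2" and J: "J \<ge> 2"
  shows "((\<lambda>n. of_nat n powr (1 - z) * binom_rem J (1 - z) (of_real (1 / real n))) has_sum
     ((z - 1) * zeta0 z - 1 - (\<Sum>i\<in>{2..<J}. ((1 - z) gchoose i) * zeta0 (z + of_nat i - 1)))) {1..}"
proof -
  have h0: "((\<lambda>n. of_nat n powr (1 - z)) has_sum zeta0 (z - 1)) {1..}"
    using zeta0_has_sum[of "z - 1"] z by simp
  have set: "{1..} - {1::nat} = {2..}" by auto
  have "((\<lambda>n. of_nat n powr (1 - z)) has_sum (zeta0 (z - 1) - (1::complex))) {2..}"
    using has_sum_Diff[OF h0, of "{1}" 1] has_sum_finite[of "{1::nat}" "\<lambda>n. of_nat n powr (1 - z)"]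
    unfolding set by simp
  moreover have "bij_betw Suc {1..} {2..}"
    by (rule bij_betwI[where g = "\<lambda>n. n - 1"]) auto
  ultimately have h1: "((\<lambda>n. of_nat (Suc n) powr (1 - z)) has_sum (zeta0 (z - 1) - 1)) {1..}"
    using has_sum_reindex_bij_betw[of Suc "{1..}" "{2..}" "\<lambda>n. of_nat n powr (1 - z)"] by blast
  have hi: "((\<lambda>n. ((1 - z) gchoose i) * of_nat n powr (1 - z - of_nat i)) has_sum
      (((1 - z) gchoose i) * zeta0 (z + of_nat i - 1))) {1..}" for i
  proof -
    have "- (z + of_nat i - 1) = 1 - z - of_nat i" by simp
    then have "((\<lambda>n. of_nat n powr (1 - z - of_nat i)) has_sum zeta0 (z + of_nat i - 1)) {1..}"
      using zeta0_has_sum[of "z + of_nat i - 1"] z by (simp only:) simp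
    then show ?thesis by (rule has_sum_cmult_right)
  qed
  have hs: "((\<lambda>n. \<Sum>i<J. ((1 - z) gchoose i) * of_nat n powr (1 - z - of_nat i)) has_sum
      (\<Sum>i<J. ((1 - z) gchoose i) * zeta0 (z + of_nat i - 1))) {1..}"
    by (intro has_sum_sum hi) auto
  have "((\<lambda>n. of_nat (Suc n) powr (1 - z) + - (\<Sum>i<J. ((1 - z) gchoose i) * of_nat n powr (1 - z - of_nat i))) has_sum
     (zeta0 (z - 1) - 1 + - (\<Sum>i<J. ((1 - z) gchoose i) * zeta0 (z + of_nat i - 1)))) {1..}"
    by (intro has_sum_add h1 has_sum_uminusI hs)
  moreover have "of_nat (Suc n) powr (1 - z) + - (\<Sum>i<J. ((1 - z) gchoose i) * of_nat n powr (1 - z - of_nat i))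
      = of_nat n powr (1 - z) * binom_rem J (1 - z) (of_real (1 / real n))" if "n \<in> {1..}" for n
    using Suc_powr_expand[of n "1 - z" J] that by simp
  moreover have "(\<Sum>i<J. ((1 - z) gchoose i) * zeta0 (z + of_nat i - 1)) =
      zeta0 (z - 1) + (1 - z) * zeta0 z + (\<Sum>i\<in>{2..<J}. ((1 - z) gchoose i) * zeta0 (z + of_nat i - 1))"
  proof -
    have "{..<J} = insert 0 (insert 1 {2..<J})" using J by auto
    then show ?thesis by simp
  qed
  ultimately show ?thesis
    by (subst has_sum_cong[symmetric]) (auto simp: algebra_simps)
qed

text \<open>\<open>zeta0\<close> is the sum of the Dirichlet series and stands for zeta only where
  that converges; the continuation is the separate function \<open>g\<close>, with the pole at
  \<open>1\<close> removed. Each step of the induction gains a strip of width \<open>1\<close> from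
  \<open>zeta0_recursion\<close>.\<close>

lemma zeta0_continuation:
  "\<exists>g. g holomorphic_on {z. Re z > 2 - real N} \<and> (\<forall>z. Re z > 2 \<longrightarrow> g z = (z - 1) * zeta0 z)"
proof (induction N)
  case 0
  have "zeta0 holomorphic_on {z. Re z > 2}"
    unfolding zeta0_def
  proof (rule holomorphic_on_infsum)
    show "(\<lambda>z. of_nat n powr (- z) :: complex) holomorphic_on {z. Re z > 2}" if "n \<in> {1..}" for n :: nat
      using that by (auto intro!: holomorphic_intros)
    show "\<exists>M. M summable_on {1..} \<and> (\<forall>n\<in>{1..}. \<forall>z\<in>{z. Re z > 2}. norm z \<le> R \<longrightarrow> norm (of_nat n powr (- z) :: complex) \<le> M n)" for R
      by (intro exI[of _ "\<lambda>n. real n powr (-2)"])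
        (use summable_on_real_powr[of "-2"] in \<open>auto simp: norm_of_nat_powr intro!: powr_mono\<close>)
  qed (simp add: open_halfspace_Re_gt)
  then show ?case
    by (intro exI[of _ "\<lambda>z. (z - 1) * zeta0 z"]) (auto intro!: holomorphic_intros)
next
  case (Suc N)
  then obtain g where g: "g holomorphic_on {z. Re z > 2 - real N}" "\<And>z. Re z > 2 \<Longrightarrow> g z = (z - 1) * zeta0 z"
    by blast
  \<comment> \<open>For \<open>Re z > 1 - N\<close> the factor \<open>n powr (1 - z)\<close> is at
    most \<open>n powr N\<close> in modulus, so this order of expansion leaves
    \<open>n powr (-4)\<close>.\<close>
  define J where "J = N + 4"
  define T where "T = (\<lambda>z. \<Sum>\<^sub>\<infinity>n\<in>{1..}. of_nat n powr (1 - z) * binom_rem J (1 - z) (of_real (1 / real n)))"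
  \<comment> \<open>The coefficient \<open>(1 - z) gchoose i\<close> contains the factor
    \<open>- (z + i - 2) / i\<close>, which is just what turns \<open>zeta0 (z + i - 1)\<close> into
    \<open>g (z + i - 1)\<close>; so no new denominator appears.\<close>
  define g' where "g' = (\<lambda>z. 1 + (\<Sum>i\<in>{2..<J}. (- (1 / of_nat i)) * ((1 - z) gchoose (i - 1)) * g (z + of_nat i - 1)) + T z)"
  let ?U = "{z. Re z > 2 - real (Suc N)}"
  have T: "T holomorphic_on ?U"
    unfolding T_def
  proof (rule holomorphic_on_infsum)
    show "open ?U" by (rule open_halfspace_Re_gt)
    show "(\<lambda>z. of_nat n powr (1 - z) * binom_rem J (1 - z) (of_real (1 / real n))) holomorphic_on ?U" if n: "n \<in> {1..}" for n :: nat
    proof -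
      have "1 + complex_of_real (1 / real n) \<noteq> 0"
        using n by (auto simp: complex_eq_iff add_nonneg_eq_0_iff)
      then show ?thesis unfolding binom_rem_def using n by (auto intro!: holomorphic_intros)
    qed
    fix R :: real
    obtain C where C: "C \<ge> 0" "\<And>c x. norm c \<le> R + 1 \<Longrightarrow> 0 \<le> x \<Longrightarrow> x \<le> 1 \<Longrightarrow> norm (binom_rem J c (of_real x)) \<le> C * x ^ J"
      using binom_rem_bound[of "R + 1" J] by blast
    show "\<exists>M. M summable_on {1..} \<and> (\<forall>n\<in>{1..}. \<forall>z\<in>?U. norm z \<le> R \<longrightarrow>
        norm (of_nat n powr (1 - z) * binom_rem J (1 - z) (of_real (1 / real n))) \<le> M n)"
    proof (intro exI[of _ "\<lambda>n. C * real n powr (-4)"] conjI ballI impI)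
      show "(\<lambda>n. C * real n powr (-4)) summable_on {1..}"
        by (intro summable_on_cmult_right summable_on_real_powr) auto
      fix n :: nat and z :: complex assume n: "n \<in> {1..}" and z: "z \<in> ?U" "norm z \<le> R"
      have "norm (of_nat n powr (1 - z) * binom_rem J (1 - z) (of_real (1 / real n)))
         \<le> real n powr real N * (C * (1 / real n) ^ J)"
        unfolding norm_mult norm_of_nat_powr using n z norm_triangle_ineq4[of 1 z]
        by (intro mult_mono powr_mono C(2)) auto
      also have "(1 / real n) ^ J = real n powr (- real J)"
        using n by (simp add: powr_minus powr_realpow power_one_over divide_inverse power_inverse)
      also have "real n powr real N * (C * real n powr (- real J)) = C * real n powr (-4)"
        by (simp add: J_def flip: powr_add)
      finally show "norm (of_nat n powr (1 - z) * binom_rem J (1 - z) (of_real (1 / real n))) \<le> C * real n powr (-4)" .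
    qed
  qed
  have "g' holomorphic_on ?U"
    unfolding g'_def
    by (intro holomorphic_intros T holomorphic_on_compose_gen[OF _ g(1), unfolded o_def]) auto
  moreover have "g' z = (z - 1) * zeta0 z" if z: "Re z > 2" for z
  proof -
    have "T z = (z - 1) * zeta0 z - 1 - (\<Sum>i\<in>{2..<J}. ((1 - z) gchoose i) * zeta0 (z + of_nat i - 1))"
      unfolding T_def by (rule infsumI, rule zeta0_recursion) (use z in \<open>auto simp: J_def\<close>)
    moreover have "(- (1 / of_nat i)) * ((1 - z) gchoose (i - 1)) * g (z + of_nat i - 1) = ((1 - z) gchoose i) * zeta0 (z + of_nat i - 1)"
      if i: "i \<in> {2..<J}" for i
    proof -
      obtain k where k: "i = Suc k" using i by (cases i) auto
      have "of_nat (Suc k) * ((1 - z) gchoose Suc k) = (1 - z - of_nat k) * ((1 - z) gchoose k)"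
        using gbinomial_mult_1[of "1 - z" k] by (simp add: algebra_simps)
      then have "((1 - z) gchoose i) = (- (1 / of_nat i)) * ((1 - z) gchoose (i - 1)) * (z + of_nat i - 2)"
        unfolding k by (simp add: field_simps del: of_nat_Suc) (simp add: algebra_simps)
      moreover have "g (z + of_nat i - 1) = (z + of_nat i - 2) * zeta0 (z + of_nat i - 1)"
        using z i by (subst g(2)) (auto simp: algebra_simps)
      ultimately show ?thesis by simp
    qed
    ultimately show ?thesis unfolding g'_def by simp
  qed
  ultimately show ?case by blast
qed

subsection \<open>Sums over the upper half plane\<close>

lemma summable_on_product_real:
  fixes f :: "'a \<Rightarrow> real" and g :: "'b \<Rightarrow> real"
  assumes f: "f summable_on A" "\<And>x. x \<in> A \<Longrightarrow> f x \<ge> 0" and g: "g summable_on B" "\<And>y. y \<in> B \<Longrightarrow> g y \<ge> 0"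
  shows "(\<lambda>(x, y). f x * g y) summable_on (A \<times> B)"
proof (rule summable_on_SigmaI)
  show "((\<lambda>y. case (x, y) of (x, y) \<Rightarrow> f x * g y) has_sum (f x * infsum g B)) B" for x
    using g by (auto intro!: has_sum_cmult_right)
  show "(\<lambda>x. f x * infsum g B) summable_on A" by (intro summable_on_cmult_left f)
qed (use f g in auto)

definition lat_index :: "(nat \<times> int) set" where "lat_index = {1..} \<times> UNIV"

text \<open>With \<open>a = m + n \<i>\<close> the summand is \<open>n powr v * a powr (k - s) * cnj a powr (- k - s - v)\<close>,
  rescaled by \<open>n\<close> so that \<open>kern\<close> only depends on \<open>m / n\<close>.\<close>
definition lat_term :: "nat \<Rightarrow> complex \<Rightarrow> complex \<Rightarrow> nat \<times> int \<Rightarrow> complex" where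
  "lat_term k s v = (\<lambda>(n, m). of_nat n powr (-2 * s) * kern (of_nat k - s) (- of_nat k - s - v) (of_int m / of_nat n))"

definition lat :: "nat \<Rightarrow> complex \<Rightarrow> complex \<Rightarrow> complex" where
  "lat k s v = infsum (lat_term k s v) lat_index"

definition lat_bound :: "real \<Rightarrow> nat \<times> int \<Rightarrow> real" where
  "lat_bound a = (\<lambda>(n, m). real n powr a * inverse (1 + (of_int m)\<^sup>2))"

lemma lat_bound_summable: "a < -1 \<Longrightarrow> lat_bound a summable_on lat_index"
  unfolding lat_bound_def lat_index_def
  by (intro summable_on_product_real summable_on_real_powr summable_on_inverse_int_square) auto

text \<open>\<open>k\<close> drops out of the bound: it cancels in the sum of the two exponents and
  adds only a real number to their difference.\<close>

lemma norm_lat_term_le: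
  assumes "x \<in> lat_index" "Re (2 * s + v) \<ge> 2"
  shows "norm (lat_term k s v x) \<le> 3 * exp (pi * \<bar>Im v\<bar>) * lat_bound (2 - 2 * Re s) x"
proof -
  obtain n m where x: "x = (n, m)" "n \<ge> 1" using assms(1) by (auto simp: lat_index_def)
  have "norm (kern (of_nat k - s) (- of_nat k - s - v) ((of_int m + 0) / of_nat n)) \<le>
      3 * exp (pi * \<bar>Im (of_nat k - s - (- of_nat k - s - v))\<bar>) * (real n)\<^sup>2 * inverse (1 + (of_int m)\<^sup>2)"
    using assms x by (intro norm_kern_lattice_le) auto
  then have "real n powr (- 2 * Re s) * norm (kern (of_nat k - s) (- of_nat k - s - v) (of_int m / of_nat n)) \<le>
      real n powr (- 2 * Re s) * (3 * exp (pi * \<bar>Im v\<bar>) * (real n)\<^sup>2 * inverse (1 + (of_int m)\<^sup>2))"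
    by (intro mult_left_mono) auto
  also have "\<dots> = 3 * exp (pi * \<bar>Im v\<bar>) * ((real n powr (- 2 * Re s) * real n powr 2) * inverse (1 + (of_int m)\<^sup>2))"
    using x(2) by (simp add: powr_numeral)
  also have "real n powr (- 2 * Re s) * real n powr 2 = real n powr (2 - 2 * Re s)"
    unfolding powr_add[symmetric] by (simp add: add.commute)
  finally show ?thesis
    by (simp add: x lat_term_def lat_bound_def norm_mult norm_of_nat_powr)
qed

lemma lat_term_summable:
  assumes "Re s > 3" "Re v > -1"
  shows "(\<lambda>x. norm (lat_term k s v x)) summable_on lat_index"
proof (rule Infinite_Sum.abs_summable_on_comparison_test')
  show "(\<lambda>x. (3 * exp (pi * \<bar>Im v\<bar>)) * lat_bound (2 - 2 * Re s) x) summable_on lat_index"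
    using assms by (intro summable_on_cmult_right lat_bound_summable) auto
  show "norm (lat_term k s v x) \<le> 3 * exp (pi * \<bar>Im v\<bar>) * lat_bound (2 - 2 * Re s) x" if "x \<in> lat_index" for x
    using assms that by (intro norm_lat_term_le) auto
qed

lemma norm_lat_le:
  assumes "Re s > 3" "Re v > -1"
  shows "norm (lat k s v) \<le> 3 * exp (pi * \<bar>Im v\<bar>) * infsum (lat_bound (2 - 2 * Re s)) lat_index"
proof -
  have "norm (lat k s v) \<le> infsum (\<lambda>x. norm (lat_term k s v x)) lat_index"
    unfolding lat_def by (rule norm_infsum_bound[OF lat_term_summable[OF assms]])
  also have "\<dots> \<le> infsum (\<lambda>x. 3 * exp (pi * \<bar>Im v\<bar>) * lat_bound (2 - 2 * Re s) x) lat_index"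
    using assms by (intro infsum_mono lat_term_summable summable_on_cmult_right lat_bound_summable norm_lat_term_le) auto
  also have "\<dots> = 3 * exp (pi * \<bar>Im v\<bar>) * infsum (lat_bound (2 - 2 * Re s)) lat_index"
    by (rule infsum_cmult_right')
  finally show ?thesis .
qed

abbreviation half_space2 :: "real \<Rightarrow> real \<Rightarrow> (complex \<times> complex) set" where
  "half_space2 x y \<equiv> {(s, w). Re s > x \<and> Re w > y}"

lemma open_half_space2: "open (half_space2 x y)"
  unfolding case_prod_unfold by (intro open_Collect_conj open_Collect_less continuous_intros)

lemma convex_half_space2: "convex (half_space2 x y)"
proof -
  have "half_space2 x y = {s. Re s > x} \<times> {w. Re w > y}" by auto
  then show ?thesis by (auto intro: convex_Times convex_halfspace_Re_gt)
qed

text \<open>In each row the sum over \<open>m\<close> is replaced by the integral with the first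
  Euler-Maclaurin error, which comes from the antiderivative \<open>t - 1 / 2\<close> of
  \<open>1\<close>. The integral scales like \<open>n\<close>, so the main terms add up to
  \<open>zeta0 (2 * s - 1)\<close>.\<close>

lemma lat_eq_row_int:
  fixes k :: nat
  assumes s: "Re s > 3" "Re v > -1"
  defines "p \<equiv> of_nat k - s" and "q \<equiv> - of_nat k - s - v"
  shows "lat k s v = zeta0 (2 * s - 1) * row_int (\<lambda>_. 1) 1 p q
    + (\<Sum>\<^sub>\<infinity>n\<in>{1..}. of_nat n powr (- 2 * s - 1) *
         (p * row_int (\<lambda>t. t - 1 / 2) n (p - 1) q + q * row_int (\<lambda>t. t - 1 / 2) n p (q - 1)))"
proof -
  let ?B = "\<lambda>t::real. t - 1 / 2"
  let ?r = "\<lambda>n. p * row_int ?B n (p - 1) q + q * row_int ?B n p (q - 1)"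
  have pq: "Re (p + q) \<le> -3"
  proof -
    have "Re (p + q) = - 2 * Re s - Re v" by (simp add: p_def q_def)
    then show ?thesis using s by linarith
  qed
  have row: "(\<Sum>\<^sub>\<infinity>m::int. kern p q (of_int m / of_nat n)) = of_nat n * row_int (\<lambda>_. 1) 1 p q + ?r n / of_nat n" if n: "n \<ge> 1" for n
  proof -
    have "row_int (\<lambda>_. 1) n p q = (\<Sum>\<^sub>\<infinity>m::int. kern p q (of_int m / of_nat n)) - ?r n / of_nat n"
    proof -
      have "(?B has_real_derivative 1) (at t within {0..1})" for t
        by (auto intro!: derivative_eq_intros)
      then show ?thesis using row_int_by_parts[of "\<lambda>_. 1" ?B p q n] n pq by simp
    qed
    moreover have "row_int (\<lambda>_. 1) n p q = of_nat n * row_int (\<lambda>_. 1) 1 p q"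
      using row_int_one_scale[OF n, of p q] pq by simp
    ultimately show ?thesis by (simp only: eq_diff_eq)
  qed
  have summand: "of_nat n powr (- 2 * s) * (\<Sum>\<^sub>\<infinity>m::int. kern p q (of_int m / of_nat n)) =
      of_nat n powr (- (2 * s - 1)) * row_int (\<lambda>_. 1) 1 p q + of_nat n powr (- 2 * s - 1) * ?r n" if n: "n \<ge> 1" for n
  proof -
    have "of_nat n powr (- (2 * s - 1)) = of_nat n powr (- 2 * s) * (of_nat n :: complex)"
      using n powr_add[of "of_nat n :: complex" "- 2 * s" 1] by (simp add: algebra_simps)
    moreover have "of_nat n powr (- 2 * s - 1) = of_nat n powr (- 2 * s) / (of_nat n :: complex)"
      using n by (simp add: powr_diff)
    ultimately show ?thesis unfolding row[OF n] by (simp add: algebra_simps add_divide_distrib)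
  qed
  have sm: "lat_term k s v summable_on {1..} \<times> UNIV"
    using abs_summable_summable[OF lat_term_summable[OF s]] by (simp add: lat_index_def)
  have "lat k s v = (\<Sum>\<^sub>\<infinity>n\<in>{1..}. \<Sum>\<^sub>\<infinity>m\<in>UNIV. lat_term k s v (n, m))"
    unfolding lat_def lat_index_def using sm by (rule infsum_Sigma_banach[symmetric])
  also have "\<dots> = (\<Sum>\<^sub>\<infinity>n\<in>{1..}. of_nat n powr (- 2 * s) * (\<Sum>\<^sub>\<infinity>m::int. kern p q (of_int m / of_nat n)))"
    by (simp add: lat_term_def infsum_cmult_right' p_def q_def)
  also have "\<dots> = (\<Sum>\<^sub>\<infinity>n\<in>{1..}. of_nat n powr (- (2 * s - 1)) * row_int (\<lambda>_. 1) 1 p q + of_nat n powr (- 2 * s - 1) * ?r n)"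
    by (intro infsum_cong summand) auto
  finally have 1: "lat k s v = \<dots>" .
  have "(\<lambda>n. \<Sum>\<^sub>\<infinity>m\<in>UNIV. lat_term k s v (n, m)) summable_on {1..}"
    using summable_on_Sigma_banach[of "\<lambda>n m. lat_term k s v (n, m)" "{1..}" "\<lambda>_. UNIV"] sm by simp
  then have "(\<lambda>n. of_nat n powr (- 2 * s) * (\<Sum>\<^sub>\<infinity>m::int. kern p q (of_int m / of_nat n))) summable_on {1..}"
    by (simp add: lat_term_def infsum_cmult_right' p_def q_def)
  then have 2: "(\<lambda>n. of_nat n powr (- (2 * s - 1)) * row_int (\<lambda>_. 1) 1 p q + of_nat n powr (- 2 * s - 1) * ?r n) summable_on {1..}"
    by (subst summable_on_cong[OF summand[symmetric]]) auto
  have 3: "((\<lambda>n. of_nat n powr (- (2 * s - 1)) * row_int (\<lambda>_. 1) 1 p q) has_sum zeta0 (2 * s - 1) * row_int (\<lambda>_. 1) 1 p q) {1..}"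
    using s by (intro has_sum_cmult_left zeta0_has_sum) auto
  \<comment> \<open>The error series is summed as the difference of two convergent series.\<close>
  have "((\<lambda>n. (of_nat n powr (- (2 * s - 1)) * row_int (\<lambda>_. 1) 1 p q + of_nat n powr (- 2 * s - 1) * ?r n)
      + - (of_nat n powr (- (2 * s - 1)) * row_int (\<lambda>_. 1) 1 p q)) has_sum
      (lat k s v + - (zeta0 (2 * s - 1) * row_int (\<lambda>_. 1) 1 p q))) {1..}"
    unfolding 1 by (intro has_sum_add has_sum_infsum 2 has_sum_uminusI 3)
  then have "((\<lambda>n. of_nat n powr (- 2 * s - 1) * ?r n) has_sum (lat k s v + - (zeta0 (2 * s - 1) * row_int (\<lambda>_. 1) 1 p q))) {1..}"
    by simp
  from infsumI[OF this] show ?thesis by simp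
qed

lemma bounded_on_cball:
  fixes f :: "complex \<Rightarrow> complex"
  assumes "f holomorphic_on {z. Re z > a}" "a < b"
  obtains C where "C \<ge> 0" "\<And>z. Re z \<ge> b \<Longrightarrow> norm z \<le> R \<Longrightarrow> norm (f z) \<le> C"
proof -
  have "compact (cball 0 R \<inter> {z. Re z \<ge> b})"
    by (intro compact_Int_closed compact_cball closed_halfspace_Re_ge)
  moreover have "continuous_on (cball 0 R \<inter> {z. Re z \<ge> b}) f"
    using assms by (intro holomorphic_on_imp_continuous_on holomorphic_on_subset[OF assms(1)]) auto
  ultimately have "bounded (f ` (cball 0 R \<inter> {z. Re z \<ge> b}))"
    by (intro compact_imp_bounded compact_continuous_image)
  then obtain C where "\<forall>x\<in>f ` (cball 0 R \<inter> {z. Re z \<ge> b}). norm x \<le> C" by (auto simp: bounded_iff)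
  then show ?thesis by (intro that[of "max C 0"]) force+
qed

text \<open>\<open>2 * s - 2\<close> removes the pole of zeta at \<open>2 * s - 1 = 1\<close>, and
  the product is the factor of \<open>row_int_one_continuation\<close> at
  \<open>p + q = - 2 * s - v\<close>.\<close>

definition lat_denom :: "nat \<Rightarrow> complex \<times> complex \<Rightarrow> complex" where
  "lat_denom N = (\<lambda>(s, v). (2 * s - 2) * (\<Prod>j<N. - 2 * s - v + 1 - of_nat j))"

lemma lat_denom_holomorphic2: "holomorphic2_on (lat_denom N) UNIV"
  unfolding lat_denom_def case_prod_unfold
  by (intro holomorphic2_on_mult holomorphic2_on_prod holomorphic2_on_diff holomorphic2_on_add
      holomorphic2_on_fst holomorphic2_on_snd holomorphic2_on_const open_UNIV)

lemma lat_denom_nonzero: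
  assumes "Re s > 3" "Re v > -1"
  shows "lat_denom N (s, v) \<noteq> 0"
proof -
  have "- 2 * s - v + 1 - of_nat j \<noteq> 0" for j :: nat
  proof
    assume "- 2 * s - v + 1 - of_nat j = 0"
    then have "Re (- 2 * s - v + 1 - of_nat j) = 0" by simp
    then show False using assms by simp
  qed
  moreover have "2 * s - 2 \<noteq> 0" using assms by (auto simp: complex_eq_iff)
  ultimately show ?thesis by (simp add: lat_denom_def)
qed

lemma lat_denom_bound: "\<exists>C\<ge>0. \<forall>s v. norm s \<le> R \<longrightarrow> norm v \<le> R \<longrightarrow> norm (lat_denom N (s, v)) \<le> C"
proof -
  have "compact (cball (0::complex) R \<times> cball (0::complex) R)" by (intro compact_Times compact_cball)
  moreover have "continuous_on (cball 0 R \<times> cball 0 R) (lat_denom N)"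
    using holomorphic2_on_imp_continuous_on[OF lat_denom_holomorphic2] by (rule continuous_on_subset) auto
  ultimately have "bounded (lat_denom N ` (cball 0 R \<times> cball 0 R))"
    by (intro compact_imp_bounded compact_continuous_image)
  then obtain C where "\<forall>x\<in>lat_denom N ` (cball 0 R \<times> cball 0 R). norm x \<le> C" by (auto simp: bounded_iff)
  then show ?thesis by (intro exI[of _ "max C 0"]) force
qed

text \<open>\<open>N\<close> integrations by parts bound the integrals of row \<open>n\<close> by a
  multiple of \<open>n powr (2 - N)\<close> at the cost of \<open>N\<close> factors of size
  \<open>O(1 + k)\<close>; one more such factor stands in front of the integrals. The bound on
  \<open>N\<close> makes the sum over \<open>n\<close> converge for \<open>Re s > x\<close> and puts
  the exponents inside the half plane of \<open>row_int_continuation\<close>.\<close>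

lemma lat_tail_continuation:
  assumes N: "real N \<ge> 4 + 2 * \<bar>x\<bar> + \<bar>y\<bar>"
  obtains T where "\<And>k. holomorphic2_on (T k) (half_space2 x y)"
    "\<And>R. \<exists>C\<ge>0. \<forall>k s v. (s, v) \<in> half_space2 x y \<longrightarrow> norm s \<le> R \<longrightarrow> norm v \<le> R \<longrightarrow> norm (T k (s, v)) \<le> C * (1 + real k) ^ Suc N"
    "\<And>k s v. (s, v) \<in> half_space2 x y \<Longrightarrow> Re s > 3 \<Longrightarrow> Re v > -1 \<Longrightarrow>
       lat k s v = zeta0 (2 * s - 1) * row_int (\<lambda>_. 1) 1 (of_nat k - s) (- of_nat k - s - v) + T k (s, v)"
proof -
  let ?B = "\<lambda>t::real. t - 1 / 2"
  have "integral {0..1} ?B = 0"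
  proof -
    have "((\<lambda>t. t - 1 / 2) has_integral ((1\<^sup>2 / 2 - 1 / 2 * 1) - (0\<^sup>2 / 2 - 1 / 2 * 0))) {0..1::real}"
      by (rule fundamental_theorem_of_calculus)
        (auto intro!: derivative_eq_intros simp flip: has_real_derivative_iff_has_vector_derivative)
    then show ?thesis by (simp add: integral_unique)
  qed
  moreover have "continuous_on {0..1} ?B" by (intro continuous_intros)
  ultimately obtain E C where C: "C \<ge> 0" and E: "\<And>n. n \<ge> 1 \<Longrightarrow> holomorphic2_on (E n) {(p, q). Re (p + q) < real N - 2}"
      "\<And>n p q. n \<ge> 1 \<Longrightarrow> Re (p + q) < -2 \<Longrightarrow> E n (p, q) = row_int ?B n p q"
      "\<And>n p q. n \<ge> 1 \<Longrightarrow> Re (p + q) < real N - 2 \<Longrightarrow>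
         norm (E n (p, q)) \<le> C * (1 + norm p + norm q) ^ N * exp (pi * \<bar>Im (p - q)\<bar>) * (real n)\<^sup>2 / real n ^ N"
    using row_int_continuation[of ?B N] by blast
  define F where "F = (\<lambda>k n z. of_nat n powr (- 2 * fst z - 1) *
     ((of_nat k - fst z) * E n (of_nat k - fst z - 1, - of_nat k - fst z - snd z)
      + (- of_nat k - fst z - snd z) * E n (of_nat k - fst z, - of_nat k - fst z - snd z - 1)))"
  let ?U = "half_space2 x y"
  have Fb: "norm (F k n (s, v)) \<le> 2 * C * exp (pi * R) * (3 + 3 * R) ^ Suc N * (1 + real k) ^ Suc N * real n powr (-2)"
    if "n \<ge> 1" "(s, v) \<in> ?U" "norm s \<le> R" "norm v \<le> R" for k n s v R
  proof -
    note n = that(1)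
    have R: "R \<ge> 0" using that(3) norm_ge_zero order_trans by blast
    define p where "p = of_nat k - s"
    define q where "q = - of_nat k - s - v"
    \<comment> \<open>\<open>K\<close> dominates \<open>1 + norm p + norm q\<close>, also after
      lowering one exponent by \<open>1\<close>, and separates the dependence on \<open>R\<close>
      from that on \<open>k\<close>.\<close>
    define K where "K = (3 + 3 * R) * (1 + real k)"
    have K: "2 + 2 * real k + 3 * R \<le> K" using R by (simp add: K_def algebra_simps)
    have K0: "K \<ge> 0" using R by (simp add: K_def)
    have np: "norm p \<le> real k + R" using norm_triangle_ineq4[of "of_nat k" s] that by (simp add: p_def)
    have nq: "norm q \<le> real k + 2 * R"
      using norm_triangle_ineq4[of "- of_nat k - s" v] norm_triangle_ineq4[of "- of_nat k" s] that by (simp add: q_def)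
    have np1: "norm (p - 1) \<le> real k + R + 1" using norm_triangle_ineq4[of p 1] np by simp
    have nq1: "norm (q - 1) \<le> real k + 2 * R + 1" using norm_triangle_ineq4[of q 1] nq by simp
    have Re: "Re (p + q) < 2 * \<bar>x\<bar> + \<bar>y\<bar>"
    proof -
      have "Re s > - \<bar>x\<bar>" "Re v > - \<bar>y\<bar>" using that(2) by auto
      then show ?thesis by (simp add: p_def q_def)
    qed
    have Im: "\<bar>Im v\<bar> \<le> R" using abs_Im_le_cmod[of v] that(4) by linarith
    let ?D = "C * K ^ N * exp (pi * R) * (real n)\<^sup>2 / real n ^ N"
    have bd: "norm (E n (p', q')) \<le> ?D" if *: "Re (p' + q') < real N - 2" "1 + norm p' + norm q' \<le> K" "Im (p' - q') = Im v" for p' q'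
    proof -
      have "norm (E n (p', q')) \<le> C * (1 + norm p' + norm q') ^ N * exp (pi * \<bar>Im v\<bar>) * (real n)\<^sup>2 / real n ^ N"
        using E(3)[OF n *(1)] unfolding *(3) .
      also have "\<dots> \<le> ?D"
        using C *(2) Im K0 by (intro divide_right_mono mult_right_mono mult_mono mult_left_mono power_mono mult_nonneg_nonneg zero_le_power) auto
      finally show ?thesis .
    qed
    have D: "?D \<ge> 0" using C R by (simp add: K_def)
    have b1: "norm (E n (p - 1, q)) \<le> ?D"
      using Re N np1 nq K R by (intro bd) (auto simp: p_def q_def)
    have b2: "norm (E n (p, q - 1)) \<le> ?D"
      using Re N np nq1 K R by (intro bd) (auto simp: p_def q_def)
    have "norm (p * E n (p - 1, q) + q * E n (p, q - 1)) \<le> K * ?D + K * ?D"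
      using np nq K R D by (intro order_trans[OF norm_triangle_ineq] add_mono; unfold norm_mult)
        (intro mult_mono b1 b2; simp)+
    moreover have "real n powr (- 2 * Re s - 1) \<le> real n powr (2 * \<bar>x\<bar> - 1)"
      using n that(2) by (intro powr_mono) auto
    ultimately have "norm (F k n (s, v)) \<le> real n powr (2 * \<bar>x\<bar> - 1) * (K * ?D + K * ?D)"
      unfolding F_def norm_mult fst_conv snd_conv norm_of_nat_powr p_def[symmetric] q_def[symmetric]
      using norm_ge_zero by (intro mult_mono) (auto simp: norm_of_nat_powr)
    also have "K * ?D + K * ?D = 2 * C * exp (pi * R) * K ^ Suc N * (real n powr 2 * real n powr (- real N))"
      using n by (simp add: powr_minus powr_realpow divide_inverse mult_ac powr_numeral)
    also have "real n powr (2 * \<bar>x\<bar> - 1) * (2 * C * exp (pi * R) * K ^ Suc N * (real n powr 2 * real n powr (- real N))) =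
       2 * C * exp (pi * R) * K ^ Suc N * real n powr (2 * \<bar>x\<bar> - 1 + (2 + - real N))"
      unfolding powr_add by (simp only: mult_ac)
    also have "\<dots> \<le> 2 * C * exp (pi * R) * K ^ Suc N * real n powr (-2)"
      using n N C R by (intro mult_left_mono powr_mono) (auto simp: K_def)
    also have "K ^ Suc N = (3 + 3 * R) ^ Suc N * (1 + real k) ^ Suc N"
      unfolding K_def by (rule power_mult_distrib)
    finally show ?thesis by (simp only: mult.assoc)
  qed
  have S2: "(\<lambda>n. real n powr (-2)) summable_on {1..}" by (rule summable_on_real_powr) simp
  define T where "T = (\<lambda>k z. \<Sum>\<^sub>\<infinity>n\<in>{1..}. F k n z)"
  show ?thesis
  proof (rule that[of T])
    show "holomorphic2_on (T k) ?U" for k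
      unfolding T_def
    proof (rule holomorphic2_on_infsum[OF open_half_space2])
      fix n :: nat assume "n \<in> {1..}"
      then have n: "n \<ge> 1" by simp
      have powr: "holomorphic2_on (\<lambda>z. of_nat n powr (- 2 * fst z - 1) :: complex) ?U"
      proof (rule holomorphic2_on_compose1[where g = fst and f = "\<lambda>z. of_nat n powr (- 2 * z - 1)" and S = UNIV])
        show "(\<lambda>z. of_nat n powr (- 2 * z - 1) :: complex) holomorphic_on UNIV"
          using n by (auto intro!: holomorphic_intros)
      qed (rule holomorphic2_on_fst open_half_space2 open_UNIV UNIV_I)+
      have dom: "(of_nat k - fst z - 1, - of_nat k - fst z - snd z) \<in> {(p, q). Re (p + q) < real N - 2}"
        "(of_nat k - fst z, - of_nat k - fst z - snd z - 1) \<in> {(p, q). Re (p + q) < real N - 2}" if "z \<in> ?U" for z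
      proof -
        obtain s v where z: "z = (s, v)" by fastforce
        have "Re s > - \<bar>x\<bar>" "Re v > - \<bar>y\<bar>" using that unfolding z by auto
        then show "(of_nat k - fst z - 1, - of_nat k - fst z - snd z) \<in> {(p, q). Re (p + q) < real N - 2}"
          "(of_nat k - fst z, - of_nat k - fst z - snd z - 1) \<in> {(p, q). Re (p + q) < real N - 2}"
          using N by (simp_all add: z)
      qed
      show "holomorphic2_on (F k n) ?U"
        unfolding F_def
        by (intro holomorphic2_on_mult powr holomorphic2_on_add holomorphic2_on_compose2[OF E(1)[OF n]] holomorphic2_on_diff
            holomorphic2_on_fst holomorphic2_on_snd holomorphic2_on_const open_half_space2) (erule dom)+
    next
      fix R :: real
      let ?c = "2 * C * exp (pi * R) * (3 + 3 * R) ^ Suc N * (1 + real k) ^ Suc N"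
      show "\<exists>M. M summable_on {1..} \<and> (\<forall>n\<in>{1..}. \<forall>p\<in>?U. norm p \<le> R \<longrightarrow> norm (F k n p) \<le> M n)"
      proof (rule exI[of _ "\<lambda>n. ?c * real n powr (-2)"], intro conjI ballI impI)
        show "(\<lambda>n. ?c * real n powr (-2)) summable_on {1..}" by (rule summable_on_cmult_right[OF S2])
        fix n :: nat and p assume *: "n \<in> {1..}" "p \<in> ?U" "norm p \<le> R"
        obtain s v where p: "p = (s, v)" by fastforce
        have "norm s \<le> R" "norm v \<le> R"
          using *(3) norm_fst_le[of s v] norm_snd_le[of v s] unfolding p by linarith+
        then show "norm (F k n p) \<le> ?c * real n powr (-2)"
          using * unfolding p by (intro Fb) auto
      qed
    qed
    show "\<exists>C\<ge>0. \<forall>k s v. (s, v) \<in> ?U \<longrightarrow> norm s \<le> R \<longrightarrow> norm v \<le> R \<longrightarrow> norm (T k (s, v)) \<le> C * (1 + real k) ^ Suc N" for R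
    proof (cases "R \<ge> 0")
      case True
      define Z where "Z = (\<Sum>\<^sub>\<infinity>n\<in>{1..}. real n powr (-2))"
      have Z: "Z \<ge> 0" unfolding Z_def by (rule infsum_nonneg) auto
      let ?c = "2 * C * exp (pi * R) * (3 + 3 * R) ^ Suc N * Z"
      show ?thesis
      proof (intro exI[of _ ?c] conjI allI impI)
        show "?c \<ge> 0" using C Z True by simp
        fix k :: nat and s v assume *: "(s, v) \<in> ?U" "norm s \<le> R" "norm v \<le> R"
        let ?d = "2 * C * exp (pi * R) * (3 + 3 * R) ^ Suc N * (1 + real k) ^ Suc N"
        have Fb': "norm (F k n (s, v)) \<le> ?d * real n powr (-2)" if "n \<in> {1..}" for n
          using that * by (intro Fb) auto
        have sm: "(\<lambda>n. norm (F k n (s, v))) summable_on {1..}"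
          by (rule Infinite_Sum.abs_summable_on_comparison_test'[OF summable_on_cmult_right[OF S2] Fb'])
        have "norm (T k (s, v)) \<le> (\<Sum>\<^sub>\<infinity>n\<in>{1..}. norm (F k n (s, v)))"
          unfolding T_def by (rule norm_infsum_bound[OF sm])
        also have "\<dots> \<le> (\<Sum>\<^sub>\<infinity>n\<in>{1..}. ?d * real n powr (-2))"
          by (rule infsum_mono[OF sm summable_on_cmult_right[OF S2] Fb'])
        also have "\<dots> = ?d * Z" unfolding Z_def by (rule infsum_cmult_right')
        finally show "norm (T k (s, v)) \<le> ?c * (1 + real k) ^ Suc N" by (simp only: mult_ac)
      qed
    next
      case False
      have "\<not> norm s \<le> R" for s :: complex using False norm_ge_zero order_trans by blast
      then show ?thesis by (intro exI[of _ 0]) auto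
    qed
    fix k :: nat and s v assume *: "(s, v) \<in> ?U" "Re s > 3" "Re v > -1"
    have "T k (s, v) = (\<Sum>\<^sub>\<infinity>n\<in>{1..}. of_nat n powr (- 2 * s - 1) *
         ((of_nat k - s) * row_int ?B n (of_nat k - s - 1) (- of_nat k - s - v)
        + (- of_nat k - s - v) * row_int ?B n (of_nat k - s) (- of_nat k - s - v - 1)))"
      unfolding T_def F_def fst_conv snd_conv using *
      by (intro infsum_cong) (simp add: E(2))
    then show "lat k s v = zeta0 (2 * s - 1) * row_int (\<lambda>_. 1) 1 (of_nat k - s) (- of_nat k - s - v) + T k (s, v)"
      using lat_eq_row_int[OF *(2,3), of k] by simp
  qed
qed

text \<open>The form suits summation over \<open>k\<close>: \<open>h\<close> is common to all
  \<open>k\<close>, and \<open>g k\<close> grows at most like a fixed power of \<open>k\<close>. In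
  the main term this power comes from the product over \<open>k - s - j\<close>, while the row
  integral itself is bounded independently of \<open>k\<close>.\<close>

lemma lat_continuation:
  obtains h g N where "holomorphic2_on h UNIV" "\<And>s v. Re s > 3 \<Longrightarrow> Re v > -1 \<Longrightarrow> h (s, v) \<noteq> 0"
    "\<And>k. holomorphic2_on (g k) (half_space2 x y)"
    "\<And>R. \<exists>C\<ge>0. \<forall>k s v. (s, v) \<in> half_space2 x y \<longrightarrow> norm s \<le> R \<longrightarrow> norm v \<le> R \<longrightarrow> norm (g k (s, v)) \<le> C * (1 + real k) ^ N"
    "\<And>k s v. (s, v) \<in> half_space2 x y \<Longrightarrow> Re s > 3 \<Longrightarrow> Re v > -1 \<Longrightarrow> g k (s, v) = h (s, v) * lat k s v"
proof -
  obtain N where N: "real N \<ge> 4 + 2 * \<bar>x\<bar> + \<bar>y\<bar>" using real_arch_simple by blast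
  obtain T where T: "\<And>k. holomorphic2_on (T k) (half_space2 x y)"
    "\<And>R. \<exists>C\<ge>0. \<forall>k s v. (s, v) \<in> half_space2 x y \<longrightarrow> norm s \<le> R \<longrightarrow> norm v \<le> R \<longrightarrow> norm (T k (s, v)) \<le> C * (1 + real k) ^ Suc N"
    "\<And>k s v. (s, v) \<in> half_space2 x y \<Longrightarrow> Re s > 3 \<Longrightarrow> Re v > -1 \<Longrightarrow>
       lat k s v = zeta0 (2 * s - 1) * row_int (\<lambda>_. 1) 1 (of_nat k - s) (- of_nat k - s - v) + T k (s, v)"
    using lat_tail_continuation[OF N] by blast
  obtain gz where gz: "gz holomorphic_on {z. Re z > 2 - real N}" "\<And>z. Re z > 2 \<Longrightarrow> gz z = (z - 1) * zeta0 z"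
    using zeta0_continuation by blast
  have one: "continuous_on {0..1} (\<lambda>_::real. 1::real)" by simp
  obtain CI where CI: "CI \<ge> 0" "\<And>n p q. n \<ge> 1 \<Longrightarrow> Re (p + q) \<le> -2 \<Longrightarrow>
    norm (row_int (\<lambda>_. 1) n p q) \<le> CI * exp (pi * \<bar>Im (p - q)\<bar>) * (real n)\<^sup>2"
    using row_int_bound[OF one] by blast
  let ?U = "half_space2 x y"
  let ?h = "lat_denom N"
  \<comment> \<open>The main term multiplied by \<open>lat_denom\<close>: the pole-free zeta factor
    times the right-hand side of \<open>row_int_one_continuation\<close>.\<close>
  define M where "M = (\<lambda>k z. gz (2 * fst z - 1) * ((2 * \<i>) ^ N * (\<Prod>j<N. of_nat k - fst z - of_nat j) *
     row_int (\<lambda>_. 1) 1 (of_nat k - fst z - of_nat N) (- of_nat k - fst z - snd z)))"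
  define g where "g = (\<lambda>k z. M k z + ?h z * T k z)"
  have dom: "Re s > - \<bar>x\<bar>" "Re v > - \<bar>y\<bar>" if "(s, v) \<in> ?U" for s v using that by auto
  show ?thesis
  proof (rule that[of ?h g "Suc N"])
    show "holomorphic2_on ?h UNIV" by (rule lat_denom_holomorphic2)
    show "?h (s, v) \<noteq> 0" if "Re s > 3" "Re v > -1" for s v using lat_denom_nonzero[OF that] .
    have z: "holomorphic2_on (\<lambda>z. gz (2 * fst z - 1)) ?U"
    proof (rule holomorphic2_on_compose1[OF _ gz(1)])
      show "holomorphic2_on (\<lambda>z. 2 * fst z - 1) ?U"
        by (intro holomorphic2_on_mult holomorphic2_on_diff holomorphic2_on_fst holomorphic2_on_const open_half_space2)
      show "2 * fst z - 1 \<in> {z. 2 - real N < Re z}" if "z \<in> ?U" for z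
        using that dom[of "fst z" "snd z"] N by auto
    qed (rule open_halfspace_Re_gt)
    have r: "holomorphic2_on (\<lambda>z. (\<lambda>(p, q). row_int (\<lambda>_. 1) 1 p q) (of_nat k - fst z - of_nat N, - of_nat k - fst z - snd z)) ?U" for k
    proof (rule holomorphic2_on_compose2[OF row_int_holomorphic2[OF one order_refl]])
      show "(of_nat k - fst z - of_nat N, - of_nat k - fst z - snd z) \<in> {(p, q). Re (p + q) < -2}" if "z \<in> ?U" for z
        using that dom[of "fst z" "snd z"] N by auto
    qed (intro holomorphic2_on_diff holomorphic2_on_fst holomorphic2_on_snd holomorphic2_on_const open_half_space2)+
    have Mh: "holomorphic2_on (M k) ?U" for k
      unfolding M_def
      by (intro holomorphic2_on_mult holomorphic2_on_prod holomorphic2_on_diff holomorphic2_on_fst holomorphic2_on_const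
          open_half_space2 z r[unfolded case_prod_conv])
    show "holomorphic2_on (g k) ?U" for k
      unfolding g_def
      by (intro holomorphic2_on_add holomorphic2_on_mult Mh T(1)
          holomorphic2_on_subset[OF lat_denom_holomorphic2 open_half_space2 subset_UNIV])
    show "\<exists>C\<ge>0. \<forall>k s v. (s, v) \<in> ?U \<longrightarrow> norm s \<le> R \<longrightarrow> norm v \<le> R \<longrightarrow> norm (g k (s, v)) \<le> C * (1 + real k) ^ Suc N" for R
    proof (cases "R \<ge> 0")
      case R: True
      obtain Cz where Cz: "Cz \<ge> 0" "\<And>z. Re z \<ge> - 2 * \<bar>x\<bar> - 1 \<Longrightarrow> norm z \<le> 2 * R + 1 \<Longrightarrow> norm (gz z) \<le> Cz"
      proof -
        have "2 - real N < - 2 * \<bar>x\<bar> - 1" using N by linarith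
        then show ?thesis by (rule bounded_on_cball[OF gz(1)]) (rule that)
      qed
      obtain Ch where Ch: "Ch \<ge> 0" "\<And>s v. norm s \<le> R \<Longrightarrow> norm v \<le> R \<Longrightarrow> norm (?h (s, v)) \<le> Ch"
        using lat_denom_bound[of R N] by blast
      obtain CT where CT: "CT \<ge> 0" "\<And>k s v. (s, v) \<in> ?U \<Longrightarrow> norm s \<le> R \<Longrightarrow> norm v \<le> R \<Longrightarrow> norm (T k (s, v)) \<le> CT * (1 + real k) ^ Suc N"
        using T(2)[of R] by blast
      define c where "c = Cz * (2 ^ N * (1 + R + real N) ^ N * (CI * exp (pi * R)))"
      have c: "c \<ge> 0" using Cz(1) CI(1) R by (simp add: c_def)
      show ?thesis
      proof (intro exI[of _ "c + Ch * CT"] conjI allI impI)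
        show "0 \<le> c + Ch * CT" using c Ch CT by simp
        fix k :: nat and s v assume *: "(s, v) \<in> ?U" "norm s \<le> R" "norm v \<le> R"
        have "norm (2 * s - 1) \<le> 2 * R + 1" using norm_triangle_ineq4[of "2 * s" 1] *(2) by (simp add: norm_mult)
        then have 1: "norm (gz (2 * s - 1)) \<le> Cz" using dom[OF *(1)] by (intro Cz(2)) auto
        have "norm (of_nat k - s - of_nat j) \<le> (1 + R + real N) * (1 + real k)" if "j < N" for j
        proof -
          have "norm (of_nat k - s - of_nat j) \<le> real k + R + real j"
            using norm_triangle_ineq4[of "of_nat k - s" "of_nat j"] norm_triangle_ineq4[of "of_nat k" s] *(2) by simp
          also have "\<dots> \<le> real k + R + real N" using that by simp
          also have "\<dots> \<le> (1 + R + real N) * (1 + real k)" using R by (simp add: algebra_simps)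
          finally show ?thesis .
        qed
        then have "(\<Prod>j<N. norm (of_nat k - s - of_nat j)) \<le> (\<Prod>j<N. (1 + R + real N) * (1 + real k))"
          by (intro prod_mono) auto
        then have 2: "norm (\<Prod>j<N. of_nat k - s - of_nat j) \<le> (1 + R + real N) ^ N * (1 + real k) ^ N"
          by (simp add: prod_norm power_mult_distrib)
        have "norm (row_int (\<lambda>_. 1) 1 (of_nat k - s - of_nat N) (- of_nat k - s - v)) \<le>
            CI * exp (pi * \<bar>Im (of_nat k - s - of_nat N - (- of_nat k - s - v))\<bar>) * (real 1)\<^sup>2"
          using dom[OF *(1)] N by (intro CI(2)) auto
        also have "\<dots> \<le> CI * exp (pi * R) * (real 1)\<^sup>2"
          using CI(1) abs_Im_le_cmod[of v] *(3) by (intro mult_right_mono mult_left_mono) auto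
        finally have 3: "norm (row_int (\<lambda>_. 1) 1 (of_nat k - s - of_nat N) (- of_nat k - s - v)) \<le> CI * exp (pi * R)" by simp
        have "norm (M k (s, v)) \<le> Cz * (2 ^ N * ((1 + R + real N) ^ N * (1 + real k) ^ N) * (CI * exp (pi * R)))"
          unfolding M_def fst_conv snd_conv norm_mult norm_power
          using Cz(1) CI(1) R by (intro mult_mono 1 2 3) (auto simp: norm_mult)
        also have "\<dots> = c * (1 + real k) ^ N" by (simp only: c_def mult_ac)
        also have "\<dots> \<le> c * (1 + real k) ^ Suc N" using c by (intro mult_left_mono power_increasing) auto
        finally have 4: "norm (M k (s, v)) \<le> c * (1 + real k) ^ Suc N" .
        have "norm (?h (s, v) * T k (s, v)) \<le> Ch * (CT * (1 + real k) ^ Suc N)"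
          unfolding norm_mult using * Ch(1) by (intro mult_mono Ch(2) CT(2)) auto
        with 4 have "norm (g k (s, v)) \<le> c * (1 + real k) ^ Suc N + Ch * (CT * (1 + real k) ^ Suc N)"
          unfolding g_def by (intro order_trans[OF norm_triangle_ineq] add_mono) auto
        then show "norm (g k (s, v)) \<le> (c + Ch * CT) * (1 + real k) ^ Suc N" by (simp only: distrib_right mult.assoc)
      qed
    next
      case False
      have "\<not> norm s \<le> R" for s :: complex using False norm_ge_zero order_trans by blast
      then show ?thesis by (intro exI[of _ 0]) auto
    qed
    fix k :: nat and s v assume *: "(s, v) \<in> ?U" "Re s > 3" "Re v > -1"
    have I: "(\<Prod>j<N. - 2 * s - v + 1 - of_nat j) * row_int (\<lambda>_. 1) 1 (of_nat k - s) (- of_nat k - s - v) =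
       (2 * \<i>) ^ N * (\<Prod>j<N. of_nat k - s - of_nat j) * row_int (\<lambda>_. 1) 1 (of_nat k - s - of_nat N) (- of_nat k - s - v)"
    proof -
      have "of_nat k - s + (- of_nat k - s - v) = - 2 * s - v" by simp
      with row_int_one_continuation[where p = "of_nat k - s" and q = "- of_nat k - s - v" and N = N]
      moreover have "- (2 * Re s) - Re v \<le> - 3" using *(2,3) by linarith
      ultimately show ?thesis by (simp only:) simp
    qed
    have Z: "gz (2 * s - 1) = (2 * s - 2) * zeta0 (2 * s - 1)"
      using *(2) by (subst gz(2)) auto
    have "?h (s, v) * (zeta0 (2 * s - 1) * row_int (\<lambda>_. 1) 1 (of_nat k - s) (- of_nat k - s - v)) = M k (s, v)"
      unfolding M_def fst_conv snd_conv I[symmetric] Z lat_denom_def case_prod_conv by (simp only: mult_ac)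
    then show "g k (s, v) = ?h (s, v) * lat k s v"
      unfolding g_def T(3)[OF *] by (simp add: algebra_simps)
  qed
qed

subsection \<open>Binomial coefficients of large index\<close>

text \<open>As \<open>x\<close> tends to \<open>0\<close>, \<open>x k\<close> is minus the sum of
  all later increments. The sum of \<open>1 / m ^ (l + 2)\<close> over \<open>m \<ge> k\<close> is
  compared with the telescoping \<open>1 / m - 1 / (m + 1)\<close>; the \<open>2\<close> comes from
  \<open>m\<^sup>2 \<ge> m * (m + 1) / 2\<close>.\<close>

lemma decay_step:
  fixes x :: "nat \<Rightarrow> complex"
  assumes lim: "x \<longlonglongrightarrow> 0" and c: "c \<ge> 0"
    and step: "\<And>k. k \<ge> 1 \<Longrightarrow> norm (x (Suc k) - x k) \<le> c / real k ^ (l + 2)" and k: "k \<ge> 1"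
  shows "norm (x k) \<le> 2 * c / real k ^ Suc l"
proof -
  define a where "a = 2 * c / real k ^ l"
  have a: "a \<ge> 0" using c by (simp add: a_def)
  have "norm (x k) \<le> norm (x m) + a * (1 / real k - 1 / real m)" if "m \<ge> k" for m
    using that
  proof (induction m rule: dec_induct)
    case (step m)
    have m: "m \<ge> 1" using step.hyps k by simp
    have "real m ^ (l + 2) \<ge> real k ^ l * (real m)\<^sup>2"
      unfolding power_add using step.hyps by (intro mult_right_mono power_mono) auto
    moreover have "(real m)\<^sup>2 \<ge> real m * (real m + 1) / 2"
      using m by (simp add: power2_eq_square field_simps)
    ultimately have "real m ^ (l + 2) \<ge> real k ^ l * (real m * (real m + 1) / 2)"
      by (meson mult_left_mono order_trans zero_le_power of_nat_0_le_iff)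
    then have "c / real m ^ (l + 2) \<le> c / (real k ^ l * (real m * (real m + 1) / 2))"
      using c k m by (intro divide_left_mono) auto
    also have "\<dots> = a * (1 / real m - 1 / real (Suc m))"
      using m k by (simp add: a_def divide_simps)
    finally have "norm (x (Suc m) - x m) \<le> a * (1 / real m - 1 / real (Suc m))"
      using assms(3)[OF m] by linarith
    moreover have "norm (x m) \<le> norm (x (Suc m)) + norm (x (Suc m) - x m)"
      using norm_triangle_sub[of "x m" "x (Suc m)"] by (simp add: norm_minus_commute)
    ultimately show ?case using step.IH by (simp add: algebra_simps)
  qed simp
  then have "norm (x k) \<le> norm (x m) + a * (1 / real k)" if "m \<ge> k" for m
    using that a by (smt (verit) divide_nonneg_nonneg mult_left_mono of_nat_0_le_iff)
  then have "\<forall>\<^sub>F m in sequentially. norm (x k) \<le> norm (x m) + a * (1 / real k)"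
    unfolding eventually_sequentially by blast
  moreover have "(\<lambda>m. norm (x m) + a * (1 / real k)) \<longlonglongrightarrow> 0 + a * (1 / real k)"
    by (intro tendsto_add tendsto_const tendsto_norm_zero lim)
  ultimately have "norm (x k) \<le> 0 + a * (1 / real k)"
    by (intro tendsto_lowerbound[of _ _ sequentially]) auto
  then show ?thesis by (simp add: a_def field_simps)
qed

text \<open>Summing the increments backwards from infinity gains one power of \<open>1 / k\<close> each time, up to the
  power allowed by the forcing term.\<close>
lemma decay_bootstrap:
  assumes "a \<ge> 0" "b \<ge> 0" "J \<ge> 1" "M \<ge> 0"
  shows "\<exists>D\<ge>0. \<forall>x :: nat \<Rightarrow> complex. x \<longlonglongrightarrow> 0 \<longrightarrow> norm (x 1) \<le> M \<longrightarrow>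
    (\<forall>k\<ge>1. norm (x (Suc k) - x k) \<le> a / (real k)\<^sup>2 * norm (x k) + b / real k ^ Suc J) \<longrightarrow>
    (\<forall>k\<ge>1. norm (x k) \<le> D / real k ^ J)"
proof -
  have "\<exists>D\<ge>0. \<forall>x :: nat \<Rightarrow> complex. x \<longlonglongrightarrow> 0 \<longrightarrow> norm (x 1) \<le> M \<longrightarrow>
    (\<forall>k\<ge>1. norm (x (Suc k) - x k) \<le> a / (real k)\<^sup>2 * norm (x k) + b / real k ^ Suc J) \<longrightarrow>
    (\<forall>k\<ge>1. norm (x k) \<le> D / real k ^ l)" if "l \<le> J" for l
    using that
  proof (induction l)
    case 0
    \<comment> \<open>A discrete Gronwall argument: \<open>norm (x k) + 1\<close> grows at most by
      the factor \<open>1 + (a + b) / k\<^sup>2\<close>, and these factors are bounded by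
      exponentials with telescoping exponents. The bound depends on \<open>M\<close> but not on
      \<open>x\<close>, which later gives uniformity in \<open>w\<close>.\<close>
    define c where "c = 2 * (a + b)"
    have c: "c \<ge> 0" using assms by (simp add: c_def)
    show ?case
    proof (intro exI[of _ "(M + 1) * exp c"] conjI allI impI)
      show "(M + 1) * exp c \<ge> 0" using assms by simp
      fix x :: "nat \<Rightarrow> complex" and k :: nat
      assume x1: "norm (x 1) \<le> M" and k: "k \<ge> 1"
        and step: "\<forall>k\<ge>1. norm (x (Suc k) - x k) \<le> a / (real k)\<^sup>2 * norm (x k) + b / real k ^ Suc J"
      have "norm (x k) + 1 \<le> (M + 1) * exp (c * (1 - 1 / real k))"
        using k
      proof (induction k rule: dec_induct)
        case base
        then show ?case using x1 by simp
      next
        case (step k)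
        have k: "real k \<ge> 1" using step.hyps by simp
        have "b / real k ^ Suc J \<le> b / (real k)\<^sup>2"
          using k assms by (intro divide_left_mono power_increasing) auto
        then have "norm (x (Suc k) - x k) \<le> a / (real k)\<^sup>2 * norm (x k) + b / (real k)\<^sup>2"
          using \<open>\<forall>k\<ge>1. _\<close> step.hyps by (meson add_left_mono order_trans)
        also have "\<dots> \<le> (a + b) / (real k)\<^sup>2 * (norm (x k) + 1)"
        proof -
          have "(a + b) / (real k)\<^sup>2 * (norm (x k) + 1) = a / (real k)\<^sup>2 * norm (x k) + b / (real k)\<^sup>2
             + (a / (real k)\<^sup>2 + b / (real k)\<^sup>2 * norm (x k))"
            by (simp add: add_divide_distrib algebra_simps)
          moreover have "0 \<le> a / (real k)\<^sup>2 + b / (real k)\<^sup>2 * norm (x k)" using assms by simp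
          ultimately show ?thesis by linarith
        qed
        finally have "norm (x (Suc k)) + 1 \<le> (norm (x k) + 1) * (1 + (a + b) / (real k)\<^sup>2)"
          using norm_triangle_sub[of "x (Suc k)" "x k"] by (simp add: algebra_simps)
        also have "\<dots> \<le> (norm (x k) + 1) * exp (c * (1 / real k - 1 / real (Suc k)))"
        proof (intro mult_left_mono)
          have "(a + b) / (real k)\<^sup>2 \<le> (a + b) / (real k * (real k + 1) / 2)"
            using k assms by (intro divide_left_mono) (auto simp: power2_eq_square)
          also have "\<dots> = c * (1 / real k - 1 / real (Suc k))"
          proof -
            have "1 / real k - 1 / real (Suc k) = 1 / (real k * (real k + 1))" using k by (simp add: field_simps)
            then show ?thesis by (simp only:) (simp add: c_def mult.commute)
          qed
          finally show "1 + (a + b) / (real k)\<^sup>2 \<le> exp (c * (1 / real k - 1 / real (Suc k)))"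
            using exp_ge_add_one_self[of "c * (1 / real k - 1 / real (Suc k))"] by linarith
        qed simp
        also have "\<dots> \<le> (M + 1) * exp (c * (1 - 1 / real k)) * exp (c * (1 / real k - 1 / real (Suc k)))"
          using step.IH by (intro mult_right_mono) auto
        also have "\<dots> = (M + 1) * exp (c * (1 - 1 / real (Suc k)))"
          by (simp only: mult.assoc exp_add[symmetric] distrib_left[symmetric]) simp
        finally show ?case .
      qed
      also have "\<dots> \<le> (M + 1) * exp c"
        using assms c k by (intro mult_left_mono) (auto intro: mult_left_le)
      finally show "norm (x k) \<le> (M + 1) * exp c / real k ^ 0" by simp
    qed
  next
    case (Suc l)
    then obtain D where D: "D \<ge> 0" "\<And>x :: nat \<Rightarrow> complex. x \<longlonglongrightarrow> 0 \<Longrightarrow> norm (x 1) \<le> M \<Longrightarrow>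
      (\<forall>k\<ge>1. norm (x (Suc k) - x k) \<le> a / (real k)\<^sup>2 * norm (x k) + b / real k ^ Suc J) \<Longrightarrow>
      (\<forall>k\<ge>1. norm (x k) \<le> D / real k ^ l)" by auto
    show ?case
    proof (intro exI[of _ "2 * (a * D + b)"] conjI allI impI)
      show "2 * (a * D + b) \<ge> 0" using D assms by simp
      fix x :: "nat \<Rightarrow> complex" and k :: nat
      assume lim: "x \<longlonglongrightarrow> 0" and x1: "norm (x 1) \<le> M" and k: "k \<ge> 1"
        and step: "\<forall>k\<ge>1. norm (x (Suc k) - x k) \<le> a / (real k)\<^sup>2 * norm (x k) + b / real k ^ Suc J"
      show "norm (x k) \<le> 2 * (a * D + b) / real k ^ Suc l"
      proof (rule decay_step[OF lim _ _ k])
        show "0 \<le> a * D + b" using D assms by simp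
        fix k :: nat assume k: "k \<ge> 1"
        have "norm (x (Suc k) - x k) \<le> a / (real k)\<^sup>2 * norm (x k) + b / real k ^ Suc J"
          using step k by blast
        also have "\<dots> \<le> a / (real k)\<^sup>2 * (D / real k ^ l) + b / real k ^ (l + 2)"
          using D(2)[OF lim x1 step] k assms Suc.prems
          by (intro add_mono mult_left_mono divide_left_mono power_increasing) auto
        also have "\<dots> = (a * D + b) / real k ^ (l + 2)"
          by (simp add: power_add add_divide_distrib power2_eq_square mult_ac)
        finally show "norm (x (Suc k) - x k) \<le> (a * D + b) / real k ^ (l + 2)" .
      qed
    qed
  qed
  then show ?thesis by blast
qed

section \<open>Asymptotic expansion of the binomial coefficients\<close>

definition binom_coeff :: "nat \<Rightarrow> complex \<Rightarrow> complex" where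
  "binom_coeff k w = (-1) ^ k * ((w - 1) gchoose k)"

lemma binom_coeff_0 [simp]: "binom_coeff 0 w = 1"
  by (simp add: binom_coeff_def)

lemma binom_coeff_Suc: "of_nat (Suc k) * binom_coeff (Suc k) w = (of_nat (Suc k) - w) * binom_coeff k w"
proof -
  have "of_nat (Suc k) * ((w - 1) gchoose Suc k) = (w - 1 - of_nat k) * ((w - 1) gchoose k)"
    using gbinomial_mult_1[of "w - 1" k] by (simp add: algebra_simps)
  moreover have "of_nat (Suc k) * binom_coeff (Suc k) w = - ((-1) ^ k) * (of_nat (Suc k) * ((w - 1) gchoose Suc k))"
    by (simp add: binom_coeff_def)
  moreover have "(of_nat (Suc k) - w) * binom_coeff k w = - ((-1) ^ k) * ((w - 1 - of_nat k) * ((w - 1) gchoose k))"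
    by (simp add: binom_coeff_def algebra_simps)
  ultimately show ?thesis by simp
qed

lemma binom_coeff_pochhammer: "binom_coeff k w = pochhammer (1 - w) k / fact k"
  by (simp add: binom_coeff_def gbinomial_pochhammer flip: power_mult_distrib)

lemma binom_coeff_holomorphic: "binom_coeff k holomorphic_on S"
  unfolding binom_coeff_def by (intro holomorphic_intros)

text \<open>In terms of Pochhammer symbols the left-hand side is the series defining
  \<open>rGamma (1 - w)\<close> up to the factor \<open>(k + 1 - w) / k\<close>, which tends to
  \<open>1\<close>.\<close>

lemma binom_coeff_tendsto: "(\<lambda>k. binom_coeff k w * of_nat k powr w) \<longlonglongrightarrow> rGamma (1 - w)"
proof -
  have "(\<lambda>k. rGamma_series (1 - w) k * inverse (1 + (1 - w) * inverse (of_nat k))) \<longlonglongrightarrow> rGamma (1 - w) * inverse (1 + (1 - w) * 0)"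
    by (intro tendsto_intros lim_inverse_n) simp
  moreover have "\<forall>\<^sub>F k in sequentially. rGamma_series (1 - w) k * inverse (1 + (1 - w) * inverse (of_nat k)) = binom_coeff k w * of_nat k powr w"
    \<comment> \<open>Beyond \<open>norm w\<close> the factor \<open>k + 1 - w\<close> is nonzero
      and can be divided out.\<close>
    using eventually_gt_at_top[of "nat \<lceil>norm w\<rceil>"]
  proof eventually_elim
    case (elim k)
    then have k: "real k > norm w" "k > 0" by linarith+
    have nz: "of_nat k + 1 - w \<noteq> 0"
    proof
      assume "of_nat k + 1 - w = 0"
      then have "w = of_nat (Suc k)" by (simp add: algebra_simps)
      then show False using k(1) by (simp del: of_nat_Suc)
    qed
    have "rGamma_series (1 - w) k = pochhammer (1 - w) k * (1 - w + of_nat k) / (fact k * exp ((1 - w) * of_real (ln (of_nat k))))"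
      by (simp add: rGamma_series_def pochhammer_Suc)
    also have "exp ((1 - w) * of_real (ln (of_nat k))) = (of_nat k powr (1 - w) :: complex)"
      using k(2) by (simp add: powr_def Ln_of_nat)
    also have "\<dots> = of_nat k / of_nat k powr w"
      using k(2) by (simp add: powr_diff)
    finally have "rGamma_series (1 - w) k = binom_coeff k w * of_nat k powr w * ((of_nat k + 1 - w) / of_nat k)"
      by (simp add: binom_coeff_pochhammer algebra_simps)
    moreover have "1 + (1 - w) * inverse (of_nat k) = (of_nat k + 1 - w) / of_nat k"
      using k(2) by (simp add: field_simps)
    ultimately show ?case using nz k(2) by simp
  qed
  ultimately show ?thesis using tendsto_cong by fastforce
qed

text \<open>Gives the termination proof of the next definition the information \<open>j < l\<close>
  inside the sum.\<close>

declare sum.cong [fundef_cong]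

text \<open>Coefficients of the asymptotic series of \<open>\<Gamma> (1 - w) * binom_coeff k w\<close> in powers of \<open>k\<close>,
  read off from the recurrence \<open>(k + 1) b\<^sub>k\<^sub>+\<^sub>1 = (k + 1 - w) b\<^sub>k\<close>.\<close>
fun asym_coeff :: "nat \<Rightarrow> complex \<Rightarrow> complex" where
  "asym_coeff l w = (if l = 0 then 1 else
     (\<Sum>j<l. asym_coeff j w * ((1 - w - of_nat j) gchoose (l + 1 - j))) / of_nat l)"

declare asym_coeff.simps [simp del]

lemma asym_coeff_0 [simp]: "asym_coeff 0 w = 1"
  by (simp add: asym_coeff.simps)

lemma asym_coeff_rec:
  "of_nat l * asym_coeff l w = (\<Sum>j<l. asym_coeff j w * ((1 - w - of_nat j) gchoose (l + 1 - j)))"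
  by (cases "l = 0") (simp, subst asym_coeff.simps, simp)

lemma asym_coeff_holomorphic: "asym_coeff l holomorphic_on S"
proof (induction l rule: less_induct)
  case (less l)
  show ?case
  proof (cases "l = 0")
    case True
    then have "asym_coeff l = (\<lambda>_. 1)" by (simp add: fun_eq_iff)
    then show ?thesis by simp
  next
    case False
    then have "asym_coeff l = (\<lambda>w. (\<Sum>j<l. asym_coeff j w * ((1 - w - of_nat j) gchoose (l + 1 - j))) / of_nat l)"
      by (subst fun_eq_iff, subst asym_coeff.simps) simp
    moreover have "(\<lambda>w. (\<Sum>j<l. asym_coeff j w * ((1 - w - of_nat j) gchoose (l + 1 - j))) / of_nat l) holomorphic_on S"
      using less False by (intro holomorphic_intros) auto
    ultimately show ?thesis by simp
  qed
qed

definition asym_sum :: "nat \<Rightarrow> nat \<Rightarrow> complex \<Rightarrow> complex" where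
  "asym_sum J k w = (\<Sum>j<J. asym_coeff j w * of_nat k powr (- w - of_nat j))"

text \<open>What is left over when \<open>asym_sum\<close> is put into the recurrence of
  \<open>binom_coeff\<close>. The expansion of \<open>(k + 1) powr (1 - w - j)\<close> is cut at
  \<open>J + 1 - j\<close> so that every summand has the order
  \<open>k powr (- w - J)\<close>.\<close>

definition asym_defect :: "nat \<Rightarrow> nat \<Rightarrow> complex \<Rightarrow> complex" where
  "asym_defect J k w = (\<Sum>j<J. asym_coeff j w * (of_nat k powr (1 - w - of_nat j) *
     binom_rem (J + 1 - j) (1 - w - of_nat j) (of_real (1 / real k))))"

text \<open>For each \<open>j\<close> the first two terms of the expansion of
  \<open>(k + 1) powr (1 - w - j)\<close> give \<open>k + 1 - w - j\<close> times
  \<open>k powr (- w - j)\<close>. The surplus \<open>- j\<close> is cancelled by the higher terms: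
  collected by powers of \<open>k\<close>, they have the coefficients
  \<open>l * asym_coeff l w\<close>, by the recursion that defines
  \<open>asym_coeff\<close>.\<close>

lemma asym_sum_rec:
  assumes k: "k \<ge> 1"
  shows "of_nat (Suc k) * asym_sum J (Suc k) w = (of_nat (Suc k) - w) * asym_sum J k w + asym_defect J k w"
proof -
  define e where "e = (\<lambda>j. asym_coeff j w)"
  define P where "P = (\<lambda>z. of_nat k powr (z - w) :: complex)"
  define B where "B = (\<lambda>j i. (1 - w - of_nat j) gchoose i)"
  have P1: "P (1 - of_nat j) = of_nat k * P (- of_nat j)" for j
  proof -
    have "(1 - of_nat j - w) = 1 + (- of_nat j - w)" by simp
    then show ?thesis unfolding P_def using k by (simp only: powr_add) simp
  qed
  have mult_Suc: "of_nat (Suc k) * of_nat (Suc k) powr (- w - of_nat j) = (of_nat (Suc k) powr (1 - w - of_nat j) :: complex)" for j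
  proof -
    have "(1 - w - of_nat j) = 1 + (- w - of_nat j)" by simp
    then show ?thesis by (simp only: powr_add) simp
  qed
  have split: "(\<Sum>i<J + 1 - j. B j i * P (1 - of_nat j - of_nat i)) =
     P (1 - of_nat j) + (1 - w - of_nat j) * P (- of_nat j) + (\<Sum>l\<in>{j<..<J}. B j (l + 1 - j) * P (- of_nat l))"
    if j: "j < J" for j
  proof -
    have "{..<J + 1 - j} = insert 0 (insert 1 {2..<J + 1 - j})" using j by auto
    then have "(\<Sum>i<J + 1 - j. B j i * P (1 - of_nat j - of_nat i)) =
      B j 0 * P (1 - of_nat j) + (B j 1 * P (- of_nat j) + (\<Sum>i\<in>{2..<J + 1 - j}. B j i * P (1 - of_nat j - of_nat i)))"
      by simp
    also have "(\<Sum>i\<in>{2..<J + 1 - j}. B j i * P (1 - of_nat j - of_nat i)) = (\<Sum>l\<in>{j<..<J}. B j (l + 1 - j) * P (- of_nat l))"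
      by (rule sum.reindex_bij_witness[where i = "\<lambda>l. l + 1 - j" and j = "\<lambda>i. i + j - 1"])
        (use j in \<open>auto simp: of_nat_diff algebra_simps\<close>)
    finally show ?thesis by (simp add: B_def)
  qed
  have tri: "(\<Sum>j<J. \<Sum>l\<in>{j<..<J}. e j * (B j (l + 1 - j) * P (- of_nat l))) = (\<Sum>l<J. of_nat l * e l * P (- of_nat l))"
  proof -
    have "(\<Sum>j<J. \<Sum>l\<in>{j<..<J}. e j * (B j (l + 1 - j) * P (- of_nat l))) =
        (\<Sum>j<J. \<Sum>l<J. if j < l then e j * (B j (l + 1 - j) * P (- of_nat l)) else 0)"
      by (intro sum.cong refl sum.mono_neutral_cong_left) auto
    also have "\<dots> = (\<Sum>l<J. \<Sum>j<J. if j < l then e j * (B j (l + 1 - j) * P (- of_nat l)) else 0)"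
      by (rule sum.swap)
    also have "\<dots> = (\<Sum>l<J. \<Sum>j<l. e j * (B j (l + 1 - j) * P (- of_nat l)))"
      by (intro sum.cong refl sum.mono_neutral_cong_right) auto
    also have "\<dots> = (\<Sum>l<J. of_nat l * e l * P (- of_nat l))"
      unfolding e_def asym_coeff_rec B_def by (simp add: sum_distrib_left sum_distrib_right mult_ac)
    finally show ?thesis .
  qed
  have "of_nat (Suc k) * asym_sum J (Suc k) w = (\<Sum>j<J. e j * of_nat (Suc k) powr (1 - w - of_nat j))"
    unfolding asym_sum_def e_def sum_distrib_left mult_Suc[symmetric] by (simp add: mult_ac)
  also have "\<dots> = (\<Sum>j<J. e j * ((\<Sum>i<J + 1 - j. B j i * P (1 - of_nat j - of_nat i)) +
      of_nat k powr (1 - w - of_nat j) * binom_rem (J + 1 - j) (1 - w - of_nat j) (of_real (1 / real k))))"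
  proof (intro sum.cong refl)
    fix j
    have "1 - w - of_nat j - of_nat i = 1 - of_nat j - of_nat i - w" for i by simp
    then show "e j * of_nat (Suc k) powr (1 - w - of_nat j) = e j * ((\<Sum>i<J + 1 - j. B j i * P (1 - of_nat j - of_nat i)) +
      of_nat k powr (1 - w - of_nat j) * binom_rem (J + 1 - j) (1 - w - of_nat j) (of_real (1 / real k)))"
      unfolding Suc_powr_expand[OF k, of "1 - w - of_nat j" "J + 1 - j"] B_def P_def by (simp only:)
  qed
  also have "\<dots> = (\<Sum>j<J. e j * (\<Sum>i<J + 1 - j. B j i * P (1 - of_nat j - of_nat i))) + asym_defect J k w"
    unfolding asym_defect_def e_def by (simp add: distrib_left sum.distrib)
  also have "(\<Sum>j<J. e j * (\<Sum>i<J + 1 - j. B j i * P (1 - of_nat j - of_nat i))) =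
     (\<Sum>j<J. e j * (P (1 - of_nat j) + (1 - w - of_nat j) * P (- of_nat j))
        + (\<Sum>l\<in>{j<..<J}. e j * (B j (l + 1 - j) * P (- of_nat l))))"
    by (intro sum.cong refl) (simp only: lessThan_iff split distrib_left sum_distrib_left add.assoc)
  also have "\<dots> = (\<Sum>j<J. e j * (P (1 - of_nat j) + (1 - w - of_nat j) * P (- of_nat j))) + (\<Sum>l<J. of_nat l * e l * P (- of_nat l))"
    unfolding sum.distrib tri ..
  also have "\<dots> = (\<Sum>j<J. (of_nat (Suc k) - w) * (e j * P (- of_nat j)))"
    unfolding sum.distrib[symmetric] P1 by (intro sum.cong refl) (simp add: algebra_simps)
  also have "\<dots> = (of_nat (Suc k) - w) * asym_sum J k w"
    unfolding asym_sum_def e_def P_def by (simp add: sum_distrib_left add.commute[of "- _"] minus_diff_commute)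
  finally show ?thesis .
qed

lemma continuous_bounded_cball:
  fixes f :: "complex \<Rightarrow> complex"
  assumes "f holomorphic_on UNIV"
  obtains C where "C \<ge> 0" "\<And>z. norm z \<le> R \<Longrightarrow> norm (f z) \<le> C"
proof -
  obtain C where "C \<ge> 0" "\<And>z. Re z \<ge> - \<bar>R\<bar> \<Longrightarrow> norm z \<le> R \<Longrightarrow> norm (f z) \<le> C"
    using bounded_on_cball[of f "- \<bar>R\<bar> - 1" "- \<bar>R\<bar>" R] holomorphic_on_subset[OF assms] by auto
  moreover have "Re z \<ge> - \<bar>R\<bar>" if "norm z \<le> R" for z
    using abs_Re_le_cmod[of z] that by linarith
  ultimately show ?thesis using that by blast
qed

text \<open>The factor \<open>(k + 1) powr (w - 1)\<close> appears when the recurrence is divided by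
  \<open>k + 1\<close> and its solutions are normalised by \<open>k powr w\<close>. Up to a constant
  it compensates \<open>k powr (1 - w)\<close>.\<close>

lemma asym_defect_bound:
  "\<exists>C\<ge>0. \<forall>w k. norm w \<le> R \<longrightarrow> k \<ge> 1 \<longrightarrow>
     norm (of_nat (Suc k) powr (w - 1) * asym_defect J k w) \<le> C / real k ^ Suc J"
proof -
  have "\<exists>C\<ge>0. \<forall>w k. norm w \<le> R \<longrightarrow> k \<ge> 1 \<longrightarrow> norm (of_nat (Suc k) powr (w - 1) * (asym_coeff j w *
      (of_nat k powr (1 - w - of_nat j) * binom_rem (J + 1 - j) (1 - w - of_nat j) (of_real (1 / real k))))) \<le> C / real k ^ Suc J"
    if j: "j < J" for j
  proof -
    obtain A where A: "A \<ge> 0" "\<And>w. norm w \<le> R \<Longrightarrow> norm (asym_coeff j w) \<le> A"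
      by (rule continuous_bounded_cball[OF asym_coeff_holomorphic, of R j]) (rule that)
    obtain C where C: "C \<ge> 0" "\<And>c x. norm c \<le> 1 + R + real j \<Longrightarrow> 0 \<le> x \<Longrightarrow> x \<le> 1 \<Longrightarrow>
        norm (binom_rem (J + 1 - j) c (of_real x)) \<le> C * x ^ (J + 1 - j)"
      using binom_rem_bound[of "1 + R + real j" "J + 1 - j"] by blast
    show ?thesis
    proof (intro exI[of _ "2 powr (\<bar>R\<bar> + 1) * A * C"] conjI allI impI)
      show "0 \<le> 2 powr (\<bar>R\<bar> + 1) * A * C" using A C by simp
      fix w :: complex and k :: nat assume w: "norm w \<le> R" and k: "k \<ge> 1"
      have kr: "real k \<ge> 1" using k by simp
      have Rew: "\<bar>Re w\<bar> \<le> R" using abs_Re_le_cmod[of w] w by linarith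
      have 1: "real (Suc k) powr (Re w - 1) * real k powr (1 - Re w) \<le> 2 powr (\<bar>R\<bar> + 1)"
      proof -
        have "real (Suc k) powr (Re w - 1) * real k powr (1 - Re w) = (real (Suc k) / real k) powr (Re w - 1)"
          using k powr_minus[of "real k" "Re w - 1"] by (subst powr_divide) (simp_all add: divide_inverse)
        also have "\<dots> \<le> (real (Suc k) / real k) powr (\<bar>R\<bar> + 1)"
          using Rew k by (intro powr_mono) auto
        also have "\<dots> \<le> 2 powr (\<bar>R\<bar> + 1)"
          using k by (intro powr_mono2) (auto simp: field_simps)
        finally show ?thesis .
      qed
      have 2: "norm (binom_rem (J + 1 - j) (1 - w - of_nat j) (of_real (1 / real k))) \<le> C * (1 / real k) ^ (J + 1 - j)"
      proof (rule C(2))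
        show "norm (1 - w - of_nat j) \<le> 1 + R + real j"
          using norm_triangle_ineq4[of "1 - w" "of_nat j"] norm_triangle_ineq4[of 1 w] w by simp
      qed (use kr in auto)
      have "norm (of_nat (Suc k) powr (w - 1) * (asym_coeff j w *
        (of_nat k powr (1 - w - of_nat j) * binom_rem (J + 1 - j) (1 - w - of_nat j) (of_real (1 / real k)))))
        \<le> real (Suc k) powr (Re w - 1) * (A * (real k powr (1 - Re w - real j) * (C * (1 / real k) ^ (J + 1 - j))))"
        unfolding norm_mult norm_of_nat_powr using A(1) A(2)[OF w] C(1)
        by (intro mult_mono 2 mult_nonneg_nonneg) auto
      also have "\<dots> = (real (Suc k) powr (Re w - 1) * real k powr (1 - Re w)) * (A * C * (real k powr (- real j) * (1 / real k) ^ (J + 1 - j)))"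
        using k by (simp add: powr_diff powr_minus divide_inverse mult_ac)
      also have "real k powr (- real j) * (1 / real k) ^ (J + 1 - j) = (1 / real k) ^ Suc J"
      proof -
        have "real k powr (- real j) = (1 / real k) ^ j"
          using k by (simp add: powr_minus powr_realpow power_one_over inverse_eq_divide)
        moreover have "j + (J + 1 - j) = Suc J" using j by simp
        ultimately show ?thesis by (simp only: power_add[symmetric])
      qed
      also have "(real (Suc k) powr (Re w - 1) * real k powr (1 - Re w)) * (A * C * (1 / real k) ^ Suc J)
         \<le> 2 powr (\<bar>R\<bar> + 1) * (A * C * (1 / real k) ^ Suc J)"
        using A C by (intro mult_right_mono 1) auto
      finally show "norm (of_nat (Suc k) powr (w - 1) * (asym_coeff j w *
        (of_nat k powr (1 - w - of_nat j) * binom_rem (J + 1 - j) (1 - w - of_nat j) (of_real (1 / real k)))))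
        \<le> 2 powr (\<bar>R\<bar> + 1) * A * C / real k ^ Suc J"
        by (simp only: power_one_over power_inverse divide_inverse mult_ac mult_1_left mult_1_right)
    qed
  qed
  then obtain C where C: "\<And>j. j < J \<Longrightarrow> C j \<ge> 0" "\<And>j w k. j < J \<Longrightarrow> norm w \<le> R \<Longrightarrow> k \<ge> 1 \<Longrightarrow> norm (of_nat (Suc k) powr (w - 1) * (asym_coeff j w *
      (of_nat k powr (1 - w - of_nat j) * binom_rem (J + 1 - j) (1 - w - of_nat j) (of_real (1 / real k))))) \<le> C j / real k ^ Suc J"
    by metis
  show ?thesis
  proof (intro exI[of _ "\<Sum>j<J. C j"] conjI allI impI)
    show "0 \<le> (\<Sum>j<J. C j)" using C(1) by (intro sum_nonneg) auto
    fix w :: complex and k :: nat assume w: "norm w \<le> R" and k: "k \<ge> 1"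
    show "norm (of_nat (Suc k) powr (w - 1) * asym_defect J k w) \<le> (\<Sum>j<J. C j) / real k ^ Suc J"
      unfolding asym_defect_def sum_distrib_left sum_divide_distrib
      by (intro order_trans[OF norm_sum] sum_mono C(2) w k) auto
  qed
qed

text \<open>The difference times \<open>k powr w\<close> tends to \<open>0\<close> by
  \<open>binom_coeff_tendsto\<close>, and the two recurrences show that its increments are
  \<open>O(1 / k\<^sup>2)\<close> times itself plus \<open>O(1 / k ^ (J + 1))\<close>. Then
  \<open>decay_bootstrap\<close> applies with constants that are uniform in
  \<open>w\<close>.\<close>

lemma binom_coeff_asymptotics_pos:
  assumes J: "J \<ge> 1"
  shows "\<exists>C\<ge>0. \<forall>w k. norm w \<le> R \<longrightarrow> k \<ge> 1 \<longrightarrow>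
     norm (binom_coeff k w - rGamma (1 - w) * asym_sum J k w) \<le> C * real k powr (- Re w - real J)"
proof -
  obtain a where a: "a \<ge> 0" "\<And>w k. norm w \<le> R \<Longrightarrow> k \<ge> 1 \<Longrightarrow>
     norm (of_nat (Suc k) powr (w - 1) * asym_defect 1 k w) \<le> a / (real k)\<^sup>2"
    using asym_defect_bound[of R 1] by (auto simp: numeral_2_eq_2)
  obtain b where b: "b \<ge> 0" "\<And>w k. norm w \<le> R \<Longrightarrow> k \<ge> 1 \<Longrightarrow>
     norm (of_nat (Suc k) powr (w - 1) * asym_defect J k w) \<le> b / real k ^ Suc J"
    using asym_defect_bound[of R J] by blast
  have rG: "(\<lambda>w::complex. rGamma (1 - w)) holomorphic_on UNIV"
    by (intro holomorphic_intros)
  obtain G where G: "G \<ge> 0" "\<And>w::complex. norm w \<le> R \<Longrightarrow> norm (rGamma (1 - w)) \<le> G"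
    by (rule continuous_bounded_cball[OF rG, of R]) (rule that)
  define x where "x = (\<lambda>w k. (binom_coeff k w - rGamma (1 - w) * asym_sum J k w) * of_nat k powr w)"
  have "(\<lambda>w. x w 1) holomorphic_on UNIV"
    unfolding x_def asym_sum_def
    by (auto intro!: holomorphic_intros binom_coeff_holomorphic asym_coeff_holomorphic)
  then obtain M where M: "M \<ge> 0" "\<And>w. norm w \<le> R \<Longrightarrow> norm (x w 1) \<le> M"
    by (rule continuous_bounded_cball) (rule that)
  have "G * b \<ge> 0" using G b by simp
  from decay_bootstrap[OF a(1) this J M(1)] obtain D where D: "D \<ge> 0" "\<And>x :: nat \<Rightarrow> complex. x \<longlonglongrightarrow> 0 \<Longrightarrow> norm (x 1) \<le> M \<Longrightarrow>
    (\<forall>k\<ge>1. norm (x (Suc k) - x k) \<le> a / (real k)\<^sup>2 * norm (x k) + G * b / real k ^ Suc J) \<Longrightarrow>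
    (\<forall>k\<ge>1. norm (x k) \<le> D / real k ^ J)"
    by blast
  show ?thesis
  proof (intro exI[of _ D] conjI D(1) allI impI)
    fix w :: complex and k :: nat assume w: "norm w \<le> R" and k: "k \<ge> 1"
    have pw: "of_nat k powr w * of_nat k powr (- w - of_nat j) = (of_nat k powr (- of_nat j) :: complex)" for k j
      by (simp flip: powr_add)
    have xk: "x w k = binom_coeff k w * of_nat k powr w - rGamma (1 - w) * (\<Sum>j<J. asym_coeff j w * of_nat k powr (- of_nat j))" for k
      unfolding x_def asym_sum_def pw[symmetric] by (simp add: algebra_simps sum_distrib_left sum_distrib_right)
    have lim: "x w \<longlonglongrightarrow> 0"
    proof -
      have t: "(\<lambda>k. of_nat k powr (- of_nat j) :: complex) \<longlonglongrightarrow> (if j = 0 then 1 else 0)" for j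
      proof (cases "j = 0")
        case True
        have ev: "\<forall>\<^sub>F k in sequentially. of_nat k powr (- of_nat j) = (1 :: complex)"
          using eventually_gt_at_top[of 0] by eventually_elim (simp add: True)
        show ?thesis using tendsto_eventually[OF ev] True by simp
      next
        case False
        have "(\<lambda>k. real k powr (- real j)) \<longlonglongrightarrow> 0"
          using False by (intro tendsto_neg_powr filterlim_real_sequentially) auto
        then have "(\<lambda>k. norm (of_nat k powr (- of_nat j) :: complex)) \<longlonglongrightarrow> 0" by (simp add: norm_of_nat_powr)
        then show ?thesis using False by (simp add: tendsto_norm_zero_iff)
      qed
      have "x w \<longlonglongrightarrow> rGamma (1 - w) - rGamma (1 - w) * (\<Sum>j<J. asym_coeff j w * (if j = 0 then 1 else 0))"
        unfolding xk[abs_def] by (intro tendsto_intros binom_coeff_tendsto t)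
      also have "(\<Sum>j<J. asym_coeff j w * (if j = 0 then 1 else 0)) = 1"
        using J by (subst sum.remove[of _ 0]) auto
      finally show ?thesis by simp
    qed
    have "norm (x w (Suc k) - x w k) \<le> a / (real k)\<^sup>2 * norm (x w k) + G * b / real k ^ Suc J" if k: "k \<ge> 1" for k
    proof -
      define V where "V = (\<lambda>k. binom_coeff k w - rGamma (1 - w) * asym_sum J k w)"
      define S where "S = (of_nat (Suc k) powr (w - 1) :: complex)"
      have S: "of_nat (Suc k) powr w = of_nat (Suc k) * S"
        using powr_add[of "of_nat (Suc k)" 1 "w - 1"] by (simp add: S_def del: of_nat_Suc)
      have "of_nat (Suc k) * V (Suc k) = (of_nat (Suc k) - w) * V k - rGamma (1 - w) * asym_defect J k w"
      proof -
        have "of_nat (Suc k) * V (Suc k) = of_nat (Suc k) * binom_coeff (Suc k) w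
            - rGamma (1 - w) * (of_nat (Suc k) * asym_sum J (Suc k) w)"
          by (simp only: V_def right_diff_distrib mult.left_commute)
        then show ?thesis
          unfolding binom_coeff_Suc asym_sum_rec[OF k] by (simp add: V_def algebra_simps)
      qed
      moreover have "x w (Suc k) = S * (of_nat (Suc k) * V (Suc k))"
        unfolding x_def V_def S by (simp only: mult_ac)
      ultimately have 1: "x w (Suc k) = S * ((of_nat (Suc k) - w) * V k) - rGamma (1 - w) * (S * asym_defect J k w)"
        by (simp only: right_diff_distrib mult_ac)
      \<comment> \<open>The defect for \<open>J = 1\<close> measures how far
        \<open>k powr (- w)\<close> is from solving the homogeneous recurrence; this is the
        \<open>O(1 / k\<^sup>2)\<close> factor.\<close>
      have "asym_sum 1 k w = of_nat k powr (- w)" for k by (simp add: asym_sum_def)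
      then have "(of_nat (Suc k) - w) * of_nat k powr (- w) = of_nat (Suc k) * of_nat (Suc k) powr (- w) - asym_defect 1 k w"
        using asym_sum_rec[OF k, of 1 w] by (simp del: of_nat_Suc)
      moreover have "S * (of_nat (Suc k) * of_nat (Suc k) powr (- w)) = 1"
      proof -
        have "of_nat (Suc k) powr w * of_nat (Suc k) powr (- w) = (1 :: complex)"
          by (simp flip: powr_add del: of_nat_Suc)
        then show ?thesis unfolding S by (simp only: mult_ac)
      qed
      ultimately have 2: "S * ((of_nat (Suc k) - w) * of_nat k powr (- w)) = 1 - S * asym_defect 1 k w"
        by (simp add: right_diff_distrib)
      have "V k = of_nat k powr (- w) * x w k"
        using k by (simp add: x_def V_def powr_minus)
      then have E: "S * ((of_nat (Suc k) - w) * V k) = (1 - S * asym_defect 1 k w) * x w k"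
        unfolding 2[symmetric] by (simp only: mult_ac)
      have "x w (Suc k) - x w k = - (S * asym_defect 1 k w) * x w k - rGamma (1 - w) * (S * asym_defect J k w)"
        unfolding 1 E by (simp add: algebra_simps)
      also have "norm \<dots> \<le> norm (S * asym_defect 1 k w) * norm (x w k) + norm (rGamma (1 - w)) * norm (S * asym_defect J k w)"
        using norm_triangle_ineq4[of "- (S * asym_defect 1 k w) * x w k" "rGamma (1 - w) * (S * asym_defect J k w)"]
        by (simp only: norm_mult norm_minus_cancel)
      also have "\<dots> \<le> a / (real k)\<^sup>2 * norm (x w k) + G * (b / real k ^ Suc J)"
        unfolding S_def using G(1) by (intro add_mono mult_right_mono mult_mono a(2) b(2) G(2) w k) auto
      finally show ?thesis by simp
    qed
    then have "norm (x w k) \<le> D / real k ^ J"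
      using D(2)[OF lim M(2)[OF w]] k by blast
    then have "norm (x w k) * real k powr (- Re w) \<le> D / real k ^ J * real k powr (- Re w)"
      by (intro mult_right_mono) auto
    also have "D / real k ^ J * real k powr (- Re w) = D * real k powr (- Re w - real J)"
      using k by (simp add: powr_diff powr_realpow)
    also have "norm (x w k) * real k powr (- Re w) = norm (binom_coeff k w - rGamma (1 - w) * asym_sum J k w)"
      using k by (simp add: x_def norm_mult norm_of_nat_powr powr_minus)
    finally show "norm (binom_coeff k w - rGamma (1 - w) * asym_sum J k w) \<le> D * real k powr (- Re w - real J)" .
  qed
qed

lemma binom_coeff_bound:
  "\<exists>C\<ge>0. \<forall>k\<ge>1. norm (binom_coeff k w) \<le> C * real k powr (- Re w)"
proof -
  obtain C where C: "C \<ge> 0" "\<And>k. k \<ge> 1 \<Longrightarrow>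
     norm (binom_coeff k w - rGamma (1 - w) * asym_sum 1 k w) \<le> C * real k powr (- Re w - 1)"
    using binom_coeff_asymptotics_pos[OF order_refl, of "norm w"] by auto
  show ?thesis
  proof (intro exI[of _ "C + norm (rGamma (1 - w))"] conjI allI impI)
    fix k :: nat assume k: "k \<ge> 1"
    have "norm (binom_coeff k w) \<le> norm (binom_coeff k w - rGamma (1 - w) * asym_sum 1 k w) + norm (rGamma (1 - w) * asym_sum 1 k w)"
      by (metis add.commute norm_triangle_sub)
    also have "\<dots> \<le> C * real k powr (- Re w) + norm (rGamma (1 - w)) * real k powr (- Re w)"
    proof (intro add_mono)
      have "real k powr (- Re w - 1) \<le> real k powr (- Re w)" using k by (intro powr_mono) auto
      then show "norm (binom_coeff k w - rGamma (1 - w) * asym_sum 1 k w) \<le> C * real k powr (- Re w)"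
        using C(1) C(2)[OF k] by (meson mult_left_mono order_trans)
      show "norm (rGamma (1 - w) * asym_sum 1 k w) \<le> norm (rGamma (1 - w)) * real k powr (- Re w)"
        by (simp add: asym_sum_def norm_mult norm_of_nat_powr)
    qed
    finally show "norm (binom_coeff k w) \<le> (C + norm (rGamma (1 - w))) * real k powr (- Re w)"
      by (simp add: distrib_right)
  qed (use C in auto)
qed

section \<open>Summing the binomial series over the lattice\<close>

lemma binom_coeff_summable:
  assumes "Re w > 1"
  shows "(\<lambda>k. norm (binom_coeff k w)) summable_on UNIV"
proof -
  obtain C where C: "C \<ge> 0" "\<And>k. k \<ge> 1 \<Longrightarrow> norm (binom_coeff k w) \<le> C * real k powr (- Re w)"
    using binom_coeff_bound by blast
  have "(\<lambda>k. norm (binom_coeff k w)) summable_on {1..}"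
    by (rule Infinite_Sum.abs_summable_on_comparison_test'[OF summable_on_cmult_right[OF summable_on_real_powr]])
      (use assms C in auto)
  then have "(\<lambda>k. norm (binom_coeff k w)) summable_on insert 0 {1..}"
    by (simp add: summable_on_insert_iff)
  also have "insert (0::nat) {1..} = UNIV" by auto
  finally show ?thesis .
qed

text \<open>Abel's limit on the unit circle: the coefficients are absolutely summable, so the series
  converges uniformly on the radius through \<open>z\<close> and the identity passes from
  \<open>r < 1\<close> to \<open>r = 1\<close>. The points \<open>1 - r * z\<close> have positive
  real part, where the principal power is continuous.\<close>

lemma infsum_binom_coeff:
  assumes w: "Re w > 1" and z: "norm z = 1" "z \<noteq> 1"
  shows "(\<Sum>\<^sub>\<infinity>k. binom_coeff k w * z ^ k) = (1 - z) powr (w - 1)"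
proof -
  define S where "S = (\<lambda>r. \<Sum>\<^sub>\<infinity>k. binom_coeff k w * (of_real r * z) ^ k)"
  have "uniform_limit {0..1} (\<lambda>F r. \<Sum>k\<in>F. binom_coeff k w * (of_real r * z) ^ k) S (finite_subsets_at_top UNIV)"
    unfolding S_def
  proof (rule Weierstrass_m_test_general[OF _ binom_coeff_summable[OF w]])
    show "norm (binom_coeff k w * (of_real r * z) ^ k) \<le> norm (binom_coeff k w)" if "r \<in> {0..1}" for k r
      using that z(1) by (auto simp: norm_mult norm_power intro!: mult_left_le power_le_one)
  qed
  then have Sc: "continuous_on {0..1} S"
    by (rule uniform_limit_theorem[rotated])
      (auto intro!: continuous_intros always_eventually)
  have pos: "Re (1 - of_real r * z) > 0" if r: "r \<in> {0..1}" for r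
  proof -
    have "Re z < 1"
    proof (rule ccontr)
      assume "\<not> Re z < 1"
      with z(1) have re: "Re z = 1" using complex_Re_le_cmod[of z] by simp
      have "(Re z)\<^sup>2 + (Im z)\<^sup>2 = 1" using z(1) cmod_power2[of z] by simp
      with re have "Im z = 0" by simp
      with re z(2) show False by (simp add: complex_eq_iff)
    qed
    have "r * Re z < 1"
    proof (cases "Re z \<le> 0")
      case True
      then have "r * Re z \<le> 0" using r by (simp add: mult_nonneg_nonpos)
      then show ?thesis by simp
    next
      case False
      then have "r * Re z \<le> Re z" using r by (simp add: mult_left_le_one_le)
      then show ?thesis using \<open>Re z < 1\<close> by simp
    qed
    then show ?thesis by simp
  qed
  have Pc: "continuous_on {0..1} (\<lambda>r. (1 - of_real r * z) powr (w - 1))"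
  proof (rule continuous_on_powr_complex)
    show "{0..1} \<subseteq> {r. 0 \<le> Re (1 - of_real r * z) \<or> Im (1 - of_real r * z) \<noteq> 0}"
      using pos less_imp_le by blast
    show "Re (w - 1) > 0" using w by simp
  qed (intro continuous_intros)+
  have eq: "S r = (1 - of_real r * z) powr (w - 1)" if r: "r \<in> {0..<1}" for r
  proof -
    have nr: "norm (- (of_real r * z)) < 1" using r z(1) by (simp add: norm_mult)
    have "(\<lambda>n. ((w - 1) gchoose n) * (- (of_real r * z)) ^ n) sums (1 + - (of_real r * z)) powr (w - 1)"
      by (rule gen_binomial_complex[OF nr])
    moreover have "((w - 1) gchoose n) * (- (of_real r * z)) ^ n = binom_coeff n w * (of_real r * z) ^ n" for n
      by (simp add: binom_coeff_def power_minus[of "of_real r * z"])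
    ultimately have "(\<lambda>n. binom_coeff n w * (of_real r * z) ^ n) sums (1 - of_real r * z) powr (w - 1)" by simp
    moreover have "(\<lambda>n. norm (binom_coeff n w * (of_real r * z) ^ n)) summable_on UNIV"
      by (rule Infinite_Sum.abs_summable_on_comparison_test'[OF binom_coeff_summable[OF w]])
        (use r z(1) in \<open>auto simp: norm_mult norm_power intro!: mult_left_le power_le_one\<close>)
    then have "(\<lambda>n. binom_coeff n w * (of_real r * z) ^ n) sums S r"
      unfolding S_def by (rule has_sum_imp_sums[OF has_sum_infsum[OF abs_summable_summable]])
    ultimately show ?thesis by (rule sums_unique2[symmetric])
  qed
  have "continuous_on (closure {0..<1}) (\<lambda>r. S r - (1 - of_real r * z) powr (w - 1))"
    using continuous_on_diff[OF Sc Pc] by simp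
  then have "S 1 - (1 - of_real 1 * z) powr (w - 1) = 0"
    by (rule continuous_constant_on_closure) (use eq in auto)
  then show ?thesis by (simp add: S_def)
qed

text \<open>With \<open>z = (x + \<i>) / (x - \<i>)\<close> of modulus one,
  \<open>1 - z = - 2 * \<i> / (x - \<i>)\<close>: the binomial series in \<open>k\<close> adds up to
  a shift of the exponent of \<open>x - \<i>\<close>.\<close>

lemma kern_binomial:
  assumes w: "Re w > 1"
  shows "(\<Sum>\<^sub>\<infinity>k. binom_coeff k w * kern (of_nat k - s) (- of_nat k - s) x) =
    (- 2 * \<i>) powr (w - 1) * kern (- s) (- s - (w - 1)) x"
proof -
  define u where "u = (complex_of_real x - \<i>)"
  define z where "z = (of_real x + \<i>) / u"
  have u0: "u \<noteq> 0" by (simp add: u_def)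
  have "norm (of_real x + \<i>) = norm u"
    by (simp add: u_def cmod_def)
  then have nz: "norm z = 1" using u0 by (simp add: z_def norm_divide)
  have z1: "1 - z = - 2 * \<i> / u" using u0 by (simp add: z_def u_def field_simps)
  then have z_ne: "z \<noteq> 1" using u0 by auto
  have k: "kern (of_nat k - s) (- of_nat k - s) x = kern (- s) (- s) x * z ^ k" for k :: nat
  proof -
    have "kern (of_nat k) (- of_nat k) x = z ^ k"
      using u0 by (simp add: kern_def z_def u_def powr_minus powr_nat power_divide divide_inverse power_mult_distrib power_inverse)
    then show ?thesis
      using kern_add[of "- s" "of_nat k" "- s" "- of_nat k" x] by (simp add: minus_diff_commute)
  qed
  \<comment> \<open>The argument of \<open>u\<close> lies between \<open>- pi\<close> and
    \<open>0\<close> and that of \<open>- 2 * \<i>\<close> is \<open>- pi / 2\<close>, so the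
    difference stays within the principal range.\<close>
  have "Ln (- 2 * \<i> / u) = Ln (- 2 * \<i>) - Ln u"
  proof -
    have "Ln u = cnj (Ln (of_real x + \<i>))" unfolding u_def by (rule Ln_minus_i)
    then have "Im (Ln u) = - Im (Ln (of_real x + \<i>))" by simp
    moreover have "0 < Im (Ln (of_real x + \<i>)) \<and> Im (Ln (of_real x + \<i>)) < pi"
      by (subst Im_Ln_pos_lt) auto
    moreover have "Im (Ln (- 2 * \<i>)) = - pi / 2"
    proof -
      have "- 2 * \<i> = of_real 2 * (- \<i>)" by simp
      then have "Ln (- 2 * \<i>) = of_real (ln 2) + Ln (- \<i>)" using Ln_of_real[of 2] by (simp only:) (subst Ln_times_of_real, auto)
      then show ?thesis by (simp add: Ln_minus_ii)
    qed
    ultimately have "- pi < Im (Ln (- 2 * \<i>) - Ln u)" "Im (Ln (- 2 * \<i>) - Ln u) < pi"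
      using pi_gt_zero by simp_all
    then have "Ln (exp (Ln (- 2 * \<i>) - Ln u)) = Ln (- 2 * \<i>) - Ln u" by (intro Ln_exp) auto
    moreover have "exp (Ln (- 2 * \<i>) - Ln u) = - 2 * \<i> / u"
      using u0 by (simp add: exp_diff)
    ultimately show ?thesis by simp
  qed
  then have "(1 - z) powr (w - 1) = exp ((w - 1) * (Ln (- 2 * \<i>) - Ln u))"
    unfolding z1 using u0 by (simp add: powr_def)
  also have "(w - 1) * (Ln (- 2 * \<i>) - Ln u) = (w - 1) * Ln (- 2 * \<i>) + - (w - 1) * Ln u"
    by (simp add: algebra_simps)
  also have "exp \<dots> = (- 2 * \<i>) powr (w - 1) * u powr (- (w - 1))"
    unfolding exp_add using u0 by (simp add: powr_def)
  finally have "(1 - z) powr (w - 1) = (- 2 * \<i>) powr (w - 1) * u powr (- (w - 1))" .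
  moreover have "kern (- s) (- s - (w - 1)) x = kern (- s) (- s) x * u powr (- (w - 1))"
  proof -
    have e: "- s - (w - 1) = - s + - (w - 1)" by simp
    show ?thesis unfolding e using kern_add[of "- s" 0 "- s" "- (w - 1)" x] by (simp add: kern_def u_def)
  qed
  ultimately show ?thesis
    using infsum_binom_coeff[OF w nz z_ne]
    by (simp add: k mult.left_commute[of "binom_coeff _ _"] infsum_cmult_right')
qed

text \<open>\<open>lat_term\<close> has a majorant independent of \<open>k\<close>, and the
  coefficients are absolutely summable for \<open>Re w > 1\<close>, so the two sums can be
  exchanged. The outcome is one lattice sum with \<open>v = w - 1\<close>, which
  \<open>lat_continuation\<close> extends in both variables.\<close>

lemma lat_binomial:
  assumes s: "Re s > 3" and w: "Re w > 1"
  shows "((\<lambda>k. binom_coeff k w * lat k s 0) has_sum ((- 2 * \<i>) powr (w - 1) * lat 0 s (w - 1))) UNIV"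
proof -
  let ?f = "\<lambda>k x. binom_coeff k w * lat_term k s 0 x"
  have bd: "norm (?f k x) \<le> norm (binom_coeff k w) * (3 * lat_bound (2 - 2 * Re s) x)" if "x \<in> lat_index" for k x
    unfolding norm_mult using norm_lat_term_le[OF that, of s 0 k] s by (intro mult_left_mono) auto
  have lb: "lat_bound a x \<ge> 0" for a x by (cases x) (simp add: lat_bound_def)
  have "(\<lambda>(k, x). norm (binom_coeff k w) * (3 * lat_bound (2 - 2 * Re s) x)) summable_on UNIV \<times> lat_index"
    using s lb by (intro summable_on_product_real binom_coeff_summable[OF w] summable_on_cmult_right lat_bound_summable) auto
  then have "(\<lambda>y. norm (case y of (k, x) \<Rightarrow> ?f k x)) summable_on UNIV \<times> lat_index"
    by (rule Infinite_Sum.abs_summable_on_comparison_test') (use bd in auto)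
  then have sm: "(\<lambda>(k, x). ?f k x) summable_on UNIV \<times> lat_index"
    by (rule abs_summable_summable)
  have inner: "infsum (?f k) lat_index = binom_coeff k w * lat k s 0" for k
    by (simp add: lat_def infsum_cmult_right')
  have "(\<lambda>k. binom_coeff k w * lat k s 0) summable_on UNIV"
    using summable_on_Sigma_banach[OF sm] by (simp add: inner)
  moreover have "(\<Sum>\<^sub>\<infinity>k. binom_coeff k w * lat k s 0) = (- 2 * \<i>) powr (w - 1) * lat 0 s (w - 1)"
  proof -
    have "(\<Sum>\<^sub>\<infinity>k. binom_coeff k w * lat k s 0) = (\<Sum>\<^sub>\<infinity>k. infsum (?f k) lat_index)" by (simp add: inner)
    also have "\<dots> = (\<Sum>\<^sub>\<infinity>x\<in>lat_index. \<Sum>\<^sub>\<infinity>k. ?f k x)" by (rule infsum_swap_banach[OF sm])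
    also have "\<dots> = (\<Sum>\<^sub>\<infinity>x\<in>lat_index. (- 2 * \<i>) powr (w - 1) * lat_term 0 s (w - 1) x)"
    proof (rule infsum_cong)
      fix x :: "nat \<times> int"
      obtain n m where x: "x = (n, m)" by fastforce
      show "(\<Sum>\<^sub>\<infinity>k. ?f k x) = (- 2 * \<i>) powr (w - 1) * lat_term 0 s (w - 1) x"
        using kern_binomial[OF w, of s "of_int m / of_nat n"]
        by (simp add: x lat_term_def mult.left_commute[of "binom_coeff _ _"] mult.left_commute[of "_ powr (w - 1)"] infsum_cmult_right')
    qed
    also have "\<dots> = (- 2 * \<i>) powr (w - 1) * lat 0 s (w - 1)"
      by (simp add: lat_def infsum_cmult_right')
    finally show ?thesis .
  qed
  ultimately show ?thesis by (simp add: has_sum_iff)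
qed

subsection \<open>Meromorphic continuation from a quadrant\<close>

text \<open>Inside the quadrant the denominator may vanish only where \<open>w \<in> \<int>\<close>, a condition stable under
  products and under shifts of \<open>w\<close> by natural numbers.\<close>
definition continuation_pair ::
  "(complex \<Rightarrow> complex \<Rightarrow> complex) \<Rightarrow> real \<Rightarrow> real \<Rightarrow> (complex \<times> complex \<Rightarrow> complex) \<Rightarrow> (complex \<times> complex \<Rightarrow> complex) \<Rightarrow> bool" where
  "continuation_pair f x y g h \<longleftrightarrow> holomorphic2_on g (half_space2 x y) \<and> holomorphic2_on h (half_space2 x y) \<and>
     (\<forall>s w. (s, w) \<in> half_space2 x y \<longrightarrow> Re s > 4 \<longrightarrow> Re w > 4 \<longrightarrow>
        g (s, w) = h (s, w) * f s w \<and> (w \<notin> \<int> \<longrightarrow> h (s, w) \<noteq> 0))"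

definition continues_to :: "(complex \<Rightarrow> complex \<Rightarrow> complex) \<Rightarrow> real \<Rightarrow> real \<Rightarrow> bool" where
  "continues_to f x y \<longleftrightarrow> (\<exists>g h. continuation_pair f x y g h)"

lemma continues_toI:
  assumes "holomorphic2_on g (half_space2 x y)" "holomorphic2_on h (half_space2 x y)"
    "\<And>s w. (s, w) \<in> half_space2 x y \<Longrightarrow> Re s > 4 \<Longrightarrow> Re w > 4 \<Longrightarrow> g (s, w) = h (s, w) * f s w"
    "\<And>s w. (s, w) \<in> half_space2 x y \<Longrightarrow> Re s > 4 \<Longrightarrow> Re w > 4 \<Longrightarrow> w \<notin> \<int> \<Longrightarrow> h (s, w) \<noteq> 0"
  shows "continues_to f x y"
  unfolding continues_to_def continuation_pair_def using assms by blast

lemma continuation_pairD: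
  assumes "continuation_pair f x y g h"
  shows "holomorphic2_on g (half_space2 x y)" "holomorphic2_on h (half_space2 x y)"
    "(s, w) \<in> half_space2 x y \<Longrightarrow> Re s > 4 \<Longrightarrow> Re w > 4 \<Longrightarrow> g (s, w) = h (s, w) * f s w"
    "(s, w) \<in> half_space2 x y \<Longrightarrow> Re s > 4 \<Longrightarrow> Re w > 4 \<Longrightarrow> w \<notin> \<int> \<Longrightarrow> h (s, w) \<noteq> 0"
  using assms unfolding continuation_pair_def by blast+

lemma continues_to_cong:
  assumes "continues_to f x y" "\<And>s w. Re s > 4 \<Longrightarrow> Re w > 4 \<Longrightarrow> f s w = f' s w"
  shows "continues_to f' x y"
proof -
  obtain g h where "continuation_pair f x y g h"
    using assms(1) unfolding continues_to_def by blast
  note gh = continuation_pairD[OF this]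
  show ?thesis
    by (rule continues_toI[OF gh(1,2)]) (use gh(3,4) assms(2) in metis)+
qed

lemma continues_to_holomorphic2:
  assumes "holomorphic2_on (\<lambda>(s, w). f s w) (half_space2 x y)"
  shows "continues_to f x y"
  by (rule continues_toI[OF assms holomorphic2_on_const[OF open_half_space2, of 1]]) auto

lemma continues_to_mult:
  assumes "continues_to f1 x y" "continues_to f2 x y"
  shows "continues_to (\<lambda>s w. f1 s w * f2 s w) x y"
proof -
  obtain g1 h1 where "continuation_pair f1 x y g1 h1"
    using assms(1) unfolding continues_to_def by blast
  note 1 = continuation_pairD[OF this]
  obtain g2 h2 where "continuation_pair f2 x y g2 h2"
    using assms(2) unfolding continues_to_def by blast
  note 2 = continuation_pairD[OF this]
  show ?thesis
  proof (rule continues_toI)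
    show "holomorphic2_on (\<lambda>p. g1 p * g2 p) (half_space2 x y)" by (intro holomorphic2_on_mult 1 2)
    show "holomorphic2_on (\<lambda>p. h1 p * h2 p) (half_space2 x y)" by (intro holomorphic2_on_mult 1 2)
    show "g1 (s, w) * g2 (s, w) = h1 (s, w) * h2 (s, w) * (f1 s w * f2 s w)"
      if "(s, w) \<in> half_space2 x y" "Re s > 4" "Re w > 4" for s w
      unfolding 1(3)[OF that] 2(3)[OF that] by (simp only: mult_ac)
    show "h1 (s, w) * h2 (s, w) \<noteq> 0" if "(s, w) \<in> half_space2 x y" "Re s > 4" "Re w > 4" "w \<notin> \<int>" for s w
      using 1(4)[OF that] 2(4)[OF that] by simp
  qed
qed

lemma continues_to_add:
  assumes "continues_to f1 x y" "continues_to f2 x y"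
  shows "continues_to (\<lambda>s w. f1 s w + f2 s w) x y"
proof -
  obtain g1 h1 where "continuation_pair f1 x y g1 h1"
    using assms(1) unfolding continues_to_def by blast
  note 1 = continuation_pairD[OF this]
  obtain g2 h2 where "continuation_pair f2 x y g2 h2"
    using assms(2) unfolding continues_to_def by blast
  note 2 = continuation_pairD[OF this]
  show ?thesis
  proof (rule continues_toI)
    show "holomorphic2_on (\<lambda>p. g1 p * h2 p + g2 p * h1 p) (half_space2 x y)"
      by (intro holomorphic2_on_mult holomorphic2_on_add 1 2)
    show "holomorphic2_on (\<lambda>p. h1 p * h2 p) (half_space2 x y)" by (intro holomorphic2_on_mult 1 2)
    show "g1 (s, w) * h2 (s, w) + g2 (s, w) * h1 (s, w) = h1 (s, w) * h2 (s, w) * (f1 s w + f2 s w)"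
      if "(s, w) \<in> half_space2 x y" "Re s > 4" "Re w > 4" for s w
      unfolding 1(3)[OF that] 2(3)[OF that] by (simp only: mult_ac distrib_left)
    show "h1 (s, w) * h2 (s, w) \<noteq> 0" if "(s, w) \<in> half_space2 x y" "Re s > 4" "Re w > 4" "w \<notin> \<int>" for s w
      using 1(4)[OF that] 2(4)[OF that] by simp
  qed
qed

lemma continues_to_sum:
  assumes "\<And>i. i \<in> I \<Longrightarrow> continues_to (f i) x y"
  shows "continues_to (\<lambda>s w. \<Sum>i\<in>I. f i s w) x y"
proof -
  have zero: "continues_to (\<lambda>s w. 0) x y"
    by (rule continues_to_holomorphic2) (use holomorphic2_on_const[OF open_half_space2, of 0 x y] in \<open>simp add: case_prod_unfold\<close>)
  show ?thesis
    using assms by (induction I rule: infinite_finite_induct) (auto intro!: continues_to_add zero)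
qed

text \<open>Meant for \<open>\<phi> w = rGamma (1 - w)\<close>, whose zeros are the positive
  integers; the factor moves into the denominator.\<close>

lemma continues_to_cancel:
  assumes "continues_to (\<lambda>s w. \<phi> w * f s w) x y" "\<phi> holomorphic_on UNIV"
    and nz: "\<And>w. w \<notin> \<int> \<Longrightarrow> \<phi> w \<noteq> 0"
  shows "continues_to f x y"
proof -
  obtain g h where "continuation_pair (\<lambda>s w. \<phi> w * f s w) x y g h"
    using assms(1) unfolding continues_to_def by blast
  note gh = continuation_pairD[OF this]
  have "holomorphic2_on (\<lambda>p. \<phi> (snd p)) (half_space2 x y)"
    by (rule holomorphic2_on_compose1[OF holomorphic2_on_snd[OF open_half_space2] assms(2)]) auto
  then have "holomorphic2_on (\<lambda>p. h p * \<phi> (snd p)) (half_space2 x y)" by (intro holomorphic2_on_mult gh)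
  then show ?thesis
    by (rule continues_toI[OF gh(1)]) (use gh(3,4) nz in \<open>auto simp: mult.assoc\<close>)
qed

text \<open>In an induction that moves \<open>y\<close> to the left by one, the shifted arguments
  fall into the half plane reached before.\<close>

lemma continues_to_shift:
  assumes "continues_to f x (y + 1)" "j \<ge> (1::nat)"
  shows "continues_to (\<lambda>s w. f s (w + of_nat j)) x y"
proof -
  obtain g h where "continuation_pair f x (y + 1) g h"
    using assms(1) unfolding continues_to_def by blast
  note gh = continuation_pairD[OF this]
  have dom: "(s, w + of_nat j) \<in> half_space2 x (y + 1)" if "(s, w) \<in> half_space2 x y" for s w
  proof -
    have "real j \<ge> 1" using assms(2) by simp
    with that show ?thesis by simp
  qed
  have comp: "holomorphic2_on (\<lambda>p. k (fst p, snd p + of_nat j)) (half_space2 x y)"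
    if "holomorphic2_on k (half_space2 x (y + 1))" for k
    by (rule holomorphic2_on_compose2[OF that];
        (intro holomorphic2_on_add holomorphic2_on_fst holomorphic2_on_snd holomorphic2_on_const open_half_space2)?)
      (use dom in auto)
  have int: "w + of_nat j \<in> \<int> \<longleftrightarrow> w \<in> \<int>" for w :: complex
    by (metis Ints_add Ints_diff Ints_of_nat add_diff_cancel_right')
  show ?thesis
    by (rule continues_toI[OF comp[OF gh(1)] comp[OF gh(2)]])
      (use gh(3,4) dom int assms(2) in auto)
qed

lemma continues_to_fst:
  assumes "g holomorphic_on {z. Re z > x}" "h holomorphic_on {z. Re z > x}"
    "\<And>z. Re z > x \<Longrightarrow> Re z > 4 \<Longrightarrow> g z = h z * f z" "\<And>z. Re z > x \<Longrightarrow> Re z > 4 \<Longrightarrow> h z \<noteq> 0"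
  shows "continues_to (\<lambda>s w. f s) x y"
proof (rule continues_toI)
  show "holomorphic2_on (\<lambda>p. g (fst p)) (half_space2 x y)"
    by (rule holomorphic2_on_compose1[OF holomorphic2_on_fst[OF open_half_space2] assms(1) open_halfspace_Re_gt]) auto
  show "holomorphic2_on (\<lambda>p. h (fst p)) (half_space2 x y)"
    by (rule holomorphic2_on_compose1[OF holomorphic2_on_fst[OF open_half_space2] assms(2) open_halfspace_Re_gt]) auto
qed (use assms(3,4) in auto)

lemma continues_to_snd:
  assumes "g holomorphic_on {z. Re z > y}" "h holomorphic_on {z. Re z > y}"
    "\<And>z. Re z > y \<Longrightarrow> Re z > 4 \<Longrightarrow> g z = h z * f z" "\<And>z. Re z > y \<Longrightarrow> Re z > 4 \<Longrightarrow> h z \<noteq> 0"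
  shows "continues_to (\<lambda>s w. f w) x y"
proof (rule continues_toI)
  show "holomorphic2_on (\<lambda>p. g (snd p)) (half_space2 x y)"
    by (rule holomorphic2_on_compose1[OF holomorphic2_on_snd[OF open_half_space2] assms(1) open_halfspace_Re_gt]) auto
  show "holomorphic2_on (\<lambda>p. h (snd p)) (half_space2 x y)"
    by (rule holomorphic2_on_compose1[OF holomorphic2_on_snd[OF open_half_space2] assms(2) open_halfspace_Re_gt]) auto
qed (use assms(3,4) in auto)

lemma continues_to_entire_snd: "f holomorphic_on UNIV \<Longrightarrow> continues_to (\<lambda>s w. f w) x y"
  by (rule continues_to_snd[where g = f and h = "\<lambda>_. 1"]) (auto intro: holomorphic_on_subset)

lemma zeta0_continues_to:
  "continues_to (\<lambda>s w. zeta0 (2 * s)) x y" "continues_to (\<lambda>s w. zeta0 w) x y"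
proof -
  obtain N where N: "real N \<ge> 2 + 2 * \<bar>x\<bar> + \<bar>y\<bar>" using real_arch_simple by blast
  obtain g where g: "g holomorphic_on {z. Re z > 2 - real N}" "\<And>z. Re z > 2 \<Longrightarrow> g z = (z - 1) * zeta0 z"
    using zeta0_continuation by blast
  have nz: "z - 1 \<noteq> 0" if "Re z > 4" for z :: complex using that by auto
  show "continues_to (\<lambda>s w. zeta0 w) x y"
  proof (rule continues_to_snd)
    show "g holomorphic_on {z. Re z > y}" using g(1) by (rule holomorphic_on_subset) (use N in auto)
    show "(\<lambda>z. z - 1) holomorphic_on {z. Re z > y}" by (intro holomorphic_intros)
  qed (use g(2) nz in auto)
  show "continues_to (\<lambda>s w. zeta0 (2 * s)) x y"
  proof (rule continues_to_fst)
    show "(\<lambda>z. g (2 * z)) holomorphic_on {z. Re z > x}"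
      using N by (intro holomorphic_on_compose_gen[OF _ g(1), unfolded o_def] holomorphic_intros) auto
    show "(\<lambda>z. 2 * z - 1) holomorphic_on {z. Re z > x}" by (intro holomorphic_intros)
    show "2 * z - 1 \<noteq> 0" if "Re z > 4" for z :: complex using nz[of "2 * z"] that by auto
  qed (use g(2) in auto)
qed

text \<open>Two substitutions occur: \<open>\<phi> w = w - 1\<close>, from the binomial identity,
  and \<open>\<phi> w = 0\<close>, from the original lattice sums.\<close>

lemma lat_continues_to:
  assumes \<phi>: "\<phi> holomorphic_on UNIV" and y': "\<And>w. Re w > y \<Longrightarrow> Re (\<phi> w) > y'" "\<And>w. Re w > 4 \<Longrightarrow> Re (\<phi> w) > -1"
  shows "continues_to (\<lambda>s w. lat k s (\<phi> w)) x y"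
proof -
  obtain h g N where gh: "holomorphic2_on h UNIV" "\<And>s v. Re s > 3 \<Longrightarrow> Re v > -1 \<Longrightarrow> h (s, v) \<noteq> 0"
    "\<And>k. holomorphic2_on (g k) (half_space2 x y')"
    "\<And>R. \<exists>C\<ge>0. \<forall>k s v. (s, v) \<in> half_space2 x y' \<longrightarrow> norm s \<le> R \<longrightarrow> norm v \<le> R \<longrightarrow> norm (g k (s, v)) \<le> C * (1 + real k) ^ N"
    "\<And>k s v. (s, v) \<in> half_space2 x y' \<Longrightarrow> Re s > 3 \<Longrightarrow> Re v > -1 \<Longrightarrow> g k (s, v) = h (s, v) * lat k s v"
    by (rule lat_continuation[of x y']) (rule that)
  have snd: "holomorphic2_on (\<lambda>p. \<phi> (snd p)) (half_space2 x y)"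
    by (rule holomorphic2_on_compose1[OF holomorphic2_on_snd[OF open_half_space2] \<phi>]) auto
  show ?thesis
  proof (rule continues_toI)
    show "holomorphic2_on (\<lambda>p. g k (fst p, \<phi> (snd p))) (half_space2 x y)"
      by (rule holomorphic2_on_compose2[OF gh(3) holomorphic2_on_fst[OF open_half_space2] snd]) (use y'(1) in auto)
    show "holomorphic2_on (\<lambda>p. h (fst p, \<phi> (snd p))) (half_space2 x y)"
      by (rule holomorphic2_on_compose2[OF gh(1) holomorphic2_on_fst[OF open_half_space2] snd]) auto
  qed (use gh(2,5) y' in auto)
qed

lemma lat_shift_continues_to: "continues_to (\<lambda>s w. lat k s (w - 1)) x y"
  by (rule lat_continues_to[where y' = "y - 1"]) (auto intro!: holomorphic_intros)

lemma lat_zero_continues_to: "continues_to (\<lambda>s w. lat k s 0) x y"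
  by (rule lat_continues_to[where y' = "-1"]) (auto intro!: holomorphic_intros)

text \<open>\<open>N\<close> is fixed by the range of \<open>s\<close> before \<open>y\<close> and
  \<open>r\<close> are chosen: the growth of the continued \<open>lat k s 0\<close> in
  \<open>k\<close> does not involve \<open>w\<close>. Hence one \<open>N\<close> serves in all steps
  of the induction on strips.\<close>

lemma lat_weighted_sum_continues_to:
  "\<exists>N::nat. \<forall>y r. (\<forall>k\<ge>1. r k holomorphic_on {w. Re w > y}) \<longrightarrow>
     (\<forall>R. \<exists>C\<ge>0. \<forall>k\<ge>1. \<forall>w. Re w > y \<longrightarrow> norm w \<le> R \<longrightarrow> norm (r k w) \<le> C * real k powr (- real N)) \<longrightarrow>
     continues_to (\<lambda>s w. \<Sum>\<^sub>\<infinity>k\<in>{1..}. r k w * lat k s 0) x y"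
proof -
  obtain h g N where gh: "holomorphic2_on h UNIV" "\<And>s v. Re s > 3 \<Longrightarrow> Re v > -1 \<Longrightarrow> h (s, v) \<noteq> 0"
    "\<And>k. holomorphic2_on (g k) (half_space2 x (-1))"
    "\<And>R. \<exists>C\<ge>0. \<forall>k s v. (s, v) \<in> half_space2 x (-1) \<longrightarrow> norm s \<le> R \<longrightarrow> norm v \<le> R \<longrightarrow> norm (g k (s, v)) \<le> C * (1 + real k) ^ N"
    "\<And>k s v. (s, v) \<in> half_space2 x (-1) \<Longrightarrow> Re s > 3 \<Longrightarrow> Re v > -1 \<Longrightarrow> g k (s, v) = h (s, v) * lat k s v"
    by (rule lat_continuation[of x "-1"]) (rule that)
  show ?thesis
  proof (intro exI[of _ "N + 2"] allI impI)
    fix y and r :: "nat \<Rightarrow> complex \<Rightarrow> complex"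
    assume hol: "\<forall>k\<ge>1. r k holomorphic_on {w. Re w > y}"
      and bd: "\<forall>R. \<exists>C\<ge>0. \<forall>k\<ge>1. \<forall>w. Re w > y \<longrightarrow> norm w \<le> R \<longrightarrow> norm (r k w) \<le> C * real k powr (- real (N + 2))"
    let ?U = "half_space2 x y"
    have comp: "holomorphic2_on (\<lambda>p. G (fst p, 0)) ?U" if "holomorphic2_on G (half_space2 x (-1))" for G
      by (rule holomorphic2_on_compose2[OF that]; (intro holomorphic2_on_fst holomorphic2_on_const open_half_space2)?) auto
    show "continues_to (\<lambda>s w. \<Sum>\<^sub>\<infinity>k\<in>{1..}. r k w * lat k s 0) x y"
    proof (rule continues_toI)
      show "holomorphic2_on (\<lambda>p. \<Sum>\<^sub>\<infinity>k\<in>{1..}. r k (snd p) * g k (fst p, 0)) ?U"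
      proof (rule holomorphic2_on_infsum[OF open_half_space2])
        show "holomorphic2_on (\<lambda>p. r k (snd p) * g k (fst p, 0)) ?U" if "k \<in> {1..}" for k
          using hol that
          by (intro holomorphic2_on_mult comp gh holomorphic2_on_compose1[OF holomorphic2_on_snd[OF open_half_space2] _ open_halfspace_Re_gt]) auto
        fix R
        obtain C where C: "C \<ge> 0" "\<And>k w. k \<ge> 1 \<Longrightarrow> Re w > y \<Longrightarrow> norm w \<le> R \<Longrightarrow> norm (r k w) \<le> C * real k powr (- real (N + 2))"
          using bd by meson
        obtain C' where C': "C' \<ge> 0" "\<And>k s v. (s, v) \<in> half_space2 x (-1) \<Longrightarrow> norm s \<le> R \<Longrightarrow> norm v \<le> R \<Longrightarrow> norm (g k (s, v)) \<le> C' * (1 + real k) ^ N"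
          using gh(4)[of R] by blast
        show "\<exists>M. M summable_on {1..} \<and> (\<forall>k\<in>{1..}. \<forall>p\<in>?U. norm p \<le> R \<longrightarrow> norm (r k (snd p) * g k (fst p, 0)) \<le> M k)"
        proof (rule exI[of _ "\<lambda>k. (C * C' * 2 ^ N) * real k powr (-2)"], intro conjI ballI impI)
          show "(\<lambda>k. (C * C' * 2 ^ N) * real k powr (-2)) summable_on {1..}"
            by (intro summable_on_cmult_right summable_on_real_powr) auto
          fix k :: nat and p assume k: "k \<in> {1..}" and p: "p \<in> ?U" "norm p \<le> R"
          obtain s w where sw: "p = (s, w)" by fastforce
          have ns: "norm s \<le> R" "norm w \<le> R"
            using p(2) norm_fst_le[of s w] norm_snd_le[of w s] unfolding sw by linarith+
          have R: "0 \<le> R" using p(2) norm_ge_zero order_trans by blast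
          have 1: "norm (r k w) \<le> C * real k powr (- real (N + 2))"
            using k p ns unfolding sw by (intro C(2)) auto
          have "norm (g k (s, 0)) \<le> C' * (1 + real k) ^ N"
            using p ns R unfolding sw by (intro C'(2)) auto
          also have "\<dots> \<le> C' * (2 * real k) ^ N"
            using k C'(1) by (intro mult_left_mono power_mono) auto
          finally have 2: "norm (g k (s, 0)) \<le> C' * (2 * real k) ^ N" .
          have "norm (r k w * g k (s, 0)) \<le> (C * real k powr (- real (N + 2))) * (C' * (2 * real k) ^ N)"
            unfolding norm_mult using C(1) by (intro mult_mono 1 2) auto
          also have "\<dots> = (C * C' * 2 ^ N) * (real k powr (- real (N + 2)) * real k ^ N)"
            by (simp only: power_mult_distrib mult_ac)
          also have "real k powr (- real (N + 2)) * real k ^ N = real k powr (-2)"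
          proof -
            have "real k ^ N = real k powr (real N)" using k by (simp add: powr_realpow)
            then show ?thesis by (simp flip: powr_add)
          qed
          finally show "norm (r k (snd p) * g k (fst p, 0)) \<le> (C * C' * 2 ^ N) * real k powr (-2)"
            by (simp add: sw)
        qed
      qed
      show "holomorphic2_on (\<lambda>p. h (fst p, 0)) ?U"
        by (rule comp, rule holomorphic2_on_subset[OF gh(1) open_half_space2]) auto
      fix s w assume *: "(s, w) \<in> ?U" "Re s > 4" "Re w > 4"
      have "g k (s, 0) = h (s, 0) * lat k s 0" for k
        using * by (intro gh(5)) auto
      then show "(\<Sum>\<^sub>\<infinity>k\<in>{1..}. r k (snd (s, w)) * g k (fst (s, w), 0)) = h (fst (s, w), 0) * (\<Sum>\<^sub>\<infinity>k\<in>{1..}. r k w * lat k s 0)"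
        by (simp add: mult.left_commute[of "r _ w"] infsum_cmult_right')
    qed (use gh(2) in auto)
  qed
qed

section \<open>Continuation of the series over \<open>k\<close>\<close>

definition lat_series :: "complex \<Rightarrow> complex \<Rightarrow> complex" where
  "lat_series s w = (\<Sum>\<^sub>\<infinity>k\<in>{1..}. of_nat k powr (- w) * lat k s 0)"

lemma lat_weighted_summable:
  assumes s: "Re s > 3" and r: "\<And>k. k \<ge> 1 \<Longrightarrow> norm (r k) \<le> C * real k powr (- a)" and a: "a > 1"
  shows "(\<lambda>k. norm (r k * lat k s 0)) summable_on {1..}"
proof (rule Infinite_Sum.abs_summable_on_comparison_test')
  define L where "L = 3 * exp (pi * \<bar>Im 0\<bar>) * infsum (lat_bound (2 - 2 * Re s)) lat_index"
  show "(\<lambda>k. (C * L) * real k powr (- a)) summable_on {1..}"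
    using a by (intro summable_on_cmult_right summable_on_real_powr) auto
  show "norm (r k * lat k s 0) \<le> (C * L) * real k powr (- a)" if "k \<in> {1..}" for k
  proof -
    have "norm (r k * lat k s 0) \<le> (C * real k powr (- a)) * L"
      unfolding norm_mult L_def using r[of k] that norm_lat_le[OF s, of 0 k] order_trans[OF norm_ge_zero r[of k]]
      by (intro mult_mono) auto
    then show ?thesis by (simp only: mult_ac)
  qed
qed

lemma lat_series_has_sum:
  assumes "Re s > 3" "Re w > 1"
  shows "((\<lambda>k. of_nat k powr (- w) * lat k s 0) has_sum lat_series s w) {1..}"
  unfolding lat_series_def
  by (rule has_sum_infsum, rule abs_summable_summable, rule lat_weighted_summable[OF assms(1) _ assms(2), where C = 1])
    (simp add: norm_of_nat_powr)

text \<open>This is \<open>lat_binomial\<close> with each coefficient split into its truncated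
  asymptotic series and a remainder. The term \<open>k = 0\<close> is set apart because the
  expansion is in powers of \<open>k\<close>, and \<open>j = 0\<close> gives
  \<open>lat_series s w\<close> itself; the others sit at \<open>w + j\<close>.\<close>

lemma lat_series_recursion:
  assumes s: "Re s > 3" and w: "Re w > 1" and J: "J \<ge> 1"
  shows "rGamma (1 - w) * lat_series s w =
    (- 2 * \<i>) powr (w - 1) * lat 0 s (w - 1) + (-1) * lat 0 s 0
    + (- rGamma (1 - w)) * (\<Sum>j\<in>{1..<J}. asym_coeff j w * lat_series s (w + of_nat j))
    + (-1) * (\<Sum>\<^sub>\<infinity>k\<in>{1..}. (binom_coeff k w - rGamma (1 - w) * asym_sum J k w) * lat k s 0)"
proof -
  have "((\<lambda>k. binom_coeff k w * lat k s 0) has_sum ((- 2 * \<i>) powr (w - 1) * lat 0 s (w - 1))) UNIV"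
    by (rule lat_binomial[OF s w])
  moreover have "UNIV - {0::nat} = {1..}" by auto
  ultimately have 1: "((\<lambda>k. binom_coeff k w * lat k s 0) has_sum ((- 2 * \<i>) powr (w - 1) * lat 0 s (w - 1) - lat 0 s 0)) {1..}"
    using has_sum_Diff[of "\<lambda>k. binom_coeff k w * lat k s 0" UNIV _ "{0}" "lat 0 s 0"]
      has_sum_finite[of "{0::nat}" "\<lambda>k. binom_coeff k w * lat k s 0"] by simp
  have "((\<lambda>k. \<Sum>j<J. asym_coeff j w * (of_nat k powr (- (w + of_nat j)) * lat k s 0)) has_sum
     (\<Sum>j<J. asym_coeff j w * lat_series s (w + of_nat j))) {1..}"
    using w by (intro has_sum_sum has_sum_cmult_right lat_series_has_sum[OF s]) auto
  moreover have "asym_sum J k w * lat k s 0 = (\<Sum>j<J. asym_coeff j w * (of_nat k powr (- (w + of_nat j)) * lat k s 0))" for k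
    unfolding asym_sum_def sum_distrib_right by (intro sum.cong refl) (simp add: algebra_simps)
  ultimately have 2: "((\<lambda>k. asym_sum J k w * lat k s 0) has_sum (\<Sum>j<J. asym_coeff j w * lat_series s (w + of_nat j))) {1..}"
    by simp
  have "((\<lambda>k. binom_coeff k w * lat k s 0 + (- rGamma (1 - w)) * (asym_sum J k w * lat k s 0)) has_sum
      ((- 2 * \<i>) powr (w - 1) * lat 0 s (w - 1) - lat 0 s 0
      + (- rGamma (1 - w)) * (\<Sum>j<J. asym_coeff j w * lat_series s (w + of_nat j)))) {1..}"
    by (intro has_sum_add has_sum_cmult_right 1 2)
  then have "((\<lambda>k. (binom_coeff k w - rGamma (1 - w) * asym_sum J k w) * lat k s 0) has_sum
      ((- 2 * \<i>) powr (w - 1) * lat 0 s (w - 1) - lat 0 s 0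
      + (- rGamma (1 - w)) * (\<Sum>j<J. asym_coeff j w * lat_series s (w + of_nat j)))) {1..}"
    by (simp add: algebra_simps)
  note 3 = infsumI[OF this]
  have "{..<J} = insert 0 {1..<J}" using J by auto
  then have "(\<Sum>j<J. asym_coeff j w * lat_series s (w + of_nat j)) =
      lat_series s w + (\<Sum>j\<in>{1..<J}. asym_coeff j w * lat_series s (w + of_nat j))"
    by simp
  then show ?thesis unfolding 3 by (simp add: algebra_simps)
qed

text \<open>For \<open>Re w > N\<close> the weights \<open>k powr (- w)\<close> decay fast enough by
  themselves. Each further step moves the boundary in \<open>w\<close> by one to the left, as the
  recursion calls for the series only at \<open>w + j\<close> with \<open>j \<ge> 1\<close>.\<close>

lemma lat_series_continues_to: "continues_to lat_series x y"
proof -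
  obtain N :: nat where N: "\<And>y r. (\<forall>k\<ge>1. r k holomorphic_on {w. Re w > y}) \<Longrightarrow>
     (\<forall>R. \<exists>C\<ge>0. \<forall>k\<ge>1. \<forall>w. Re w > y \<longrightarrow> norm w \<le> R \<longrightarrow> norm (r k w) \<le> C * real k powr (- real N)) \<Longrightarrow>
     continues_to (\<lambda>s w. \<Sum>\<^sub>\<infinity>k\<in>{1..}. r k w * lat k s 0) x y"
    using lat_weighted_sum_continues_to[of x] by blast
  have ind: "continues_to lat_series x (real N - real m)" for m
  proof (induction m)
    case 0
    have "continues_to (\<lambda>s w. \<Sum>\<^sub>\<infinity>k\<in>{1..}. of_nat k powr (- w) * lat k s 0) x (real N - real 0)"
    proof (rule N)
      show "\<forall>k\<ge>1. (\<lambda>w. of_nat k powr (- w) :: complex) holomorphic_on {w. Re w > real N - real 0}"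
        by (auto intro!: holomorphic_intros)
      show "\<forall>R. \<exists>C\<ge>0. \<forall>k\<ge>1. \<forall>w. Re w > real N - real 0 \<longrightarrow> norm w \<le> R \<longrightarrow>
          norm (of_nat k powr (- w) :: complex) \<le> C * real k powr (- real N)"
        by (intro allI exI[of _ 1]) (auto simp: norm_of_nat_powr intro!: powr_mono)
    qed
    then show ?case by (simp add: lat_series_def[abs_def])
  next
    case (Suc m)
    define y where "y = real N - real (Suc m)"
    \<comment> \<open>As \<open>Re w > N - (m + 1)\<close>, this many terms make the remainder, of
      order \<open>k powr (- Re w - J)\<close>, at most of order
      \<open>k powr (- N)\<close>.\<close>
    define J where "J = Suc m"
    have IH: "continues_to lat_series x (y + 1)" using Suc by (simp add: y_def)
    have rG: "(\<lambda>w::complex. rGamma (1 - w)) holomorphic_on UNIV" by (intro holomorphic_intros)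
    have c: "continues_to (\<lambda>s w. f w) x y" if "f holomorphic_on UNIV" for f
      using that by (rule continues_to_entire_snd)
    have rem: "continues_to (\<lambda>s w. \<Sum>\<^sub>\<infinity>k\<in>{1..}. (binom_coeff k w - rGamma (1 - w) * asym_sum J k w) * lat k s 0) x y"
    proof (rule N; intro allI impI)
      show "(\<lambda>w. binom_coeff k w - rGamma (1 - w) * asym_sum J k w) holomorphic_on {w. Re w > y}" if "k \<ge> 1" for k
        unfolding asym_sum_def using that
        by (auto intro!: holomorphic_intros binom_coeff_holomorphic asym_coeff_holomorphic)
      fix R :: real
      obtain C where C: "C \<ge> 0" "\<And>w k. norm w \<le> R \<Longrightarrow> k \<ge> 1 \<Longrightarrow>
         norm (binom_coeff k w - rGamma (1 - w) * asym_sum J k w) \<le> C * real k powr (- Re w - real J)"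
        using binom_coeff_asymptotics_pos[of J R] by (auto simp: J_def)
      show "\<exists>C\<ge>0. \<forall>k\<ge>1. \<forall>w. Re w > y \<longrightarrow> norm w \<le> R \<longrightarrow>
          norm (binom_coeff k w - rGamma (1 - w) * asym_sum J k w) \<le> C * real k powr (- real N)"
      proof (intro exI[of _ C] conjI allI impI C(1))
        fix k :: nat and w :: complex assume *: "k \<ge> 1" "Re w > y" "norm w \<le> R"
        have "real k powr (- Re w - real J) \<le> real k powr (- real N)"
          using * by (intro powr_mono) (auto simp: y_def J_def)
        then show "norm (binom_coeff k w - rGamma (1 - w) * asym_sum J k w) \<le> C * real k powr (- real N)"
          using C(1) C(2)[OF *(3,1)] by (meson mult_left_mono order_trans)
      qed
    qed
    have "continues_to (\<lambda>s w. (- 2 * \<i>) powr (w - 1) * lat 0 s (w - 1) + (-1) * lat 0 s 0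
      + (- rGamma (1 - w)) * (\<Sum>j\<in>{1..<J}. asym_coeff j w * lat_series s (w + of_nat j))
      + (-1) * (\<Sum>\<^sub>\<infinity>k\<in>{1..}. (binom_coeff k w - rGamma (1 - w) * asym_sum J k w) * lat k s 0)) x y"
      by (intro continues_to_add continues_to_mult continues_to_sum c rem lat_zero_continues_to lat_shift_continues_to
          continues_to_shift[OF IH] asym_coeff_holomorphic holomorphic_intros) auto
    then have "continues_to (\<lambda>s w. rGamma (1 - w) * lat_series s w) x y"
      by (rule continues_to_cong) (subst lat_series_recursion[where J = J], auto simp: J_def)
    then have "continues_to lat_series x y"
    proof (rule continues_to_cancel[OF _ rG])
      fix w :: complex assume w: "w \<notin> \<int>"
      have "1 - w \<notin> \<int>\<^sub>\<le>\<^sub>0"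
      proof
        assume "1 - w \<in> \<int>\<^sub>\<le>\<^sub>0"
        then have "1 - (1 - w) \<in> \<int>" using nonpos_Ints_Int by (intro Ints_diff) auto
        with w show False by simp
      qed
      then show "rGamma (1 - w) \<noteq> 0" by (simp add: rGamma_eq_zero_iff)
    qed
    then show ?case by (simp add: y_def)
  qed
  obtain m where m: "real m \<ge> real N - y" using real_arch_simple by blast
  obtain g h where "continuation_pair lat_series x (real N - real m) g h"
    using ind unfolding continues_to_def by blast
  note gh = continuation_pairD[OF this]
  have sub: "half_space2 x y \<subseteq> half_space2 x (real N - real m)" using m by auto
  show ?thesis
    by (rule continues_toI[OF holomorphic2_on_subset[OF gh(1) open_half_space2 sub] holomorphic2_on_subset[OF gh(2) open_half_space2 sub]])
      (use gh(3,4) sub in blast)+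
qed

subsection \<open>Ideals of the Gaussian integers\<close>

interpretation gauss: cring gauss_ring by (rule cring_gauss_ring)

lemma gauss_intsE:
  assumes "a \<in> gauss_ints"
  obtains m n where "a = Complex (of_int m) (of_int n)"
  using assms that by (auto simp: gauss_ints_def complex_eq_iff elim!: Ints_cases)

lemma Complex_in_gauss_ints [simp]: "Complex (of_int m) (of_int n) \<in> gauss_ints"
  by (simp add: gauss_ints_def)

lemma gauss_ints_closed [simp]:
  "a \<in> gauss_ints \<Longrightarrow> b \<in> gauss_ints \<Longrightarrow> a + b \<in> gauss_ints"
  "a \<in> gauss_ints \<Longrightarrow> b \<in> gauss_ints \<Longrightarrow> a - b \<in> gauss_ints"
  "a \<in> gauss_ints \<Longrightarrow> b \<in> gauss_ints \<Longrightarrow> a * b \<in> gauss_ints"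
  "a \<in> gauss_ints \<Longrightarrow> - a \<in> gauss_ints" "0 \<in> gauss_ints" "1 \<in> gauss_ints" "\<i> \<in> gauss_ints"
  "a \<in> gauss_ints \<Longrightarrow> cnj a \<in> gauss_ints"
  by (auto simp: gauss_ints_def)

lemma PIdl_gauss: "PIdl\<^bsub>gauss_ring\<^esub> a = {x * a |x. x \<in> gauss_ints}"
  by (simp add: cgenideal_def)

lemma gauss_ideal_closed:
  assumes "ideal I gauss_ring"
  shows "I \<subseteq> gauss_ints" "0 \<in> I" "x \<in> gauss_ints \<Longrightarrow> a \<in> I \<Longrightarrow> x * a \<in> I"
    "a \<in> I \<Longrightarrow> b \<in> I \<Longrightarrow> a + b \<in> I" "a \<in> I \<Longrightarrow> b \<in> I \<Longrightarrow> a - b \<in> I"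
proof -
  interpret I: ideal I gauss_ring by fact
  show "I \<subseteq> gauss_ints" using I.a_subset by simp
  show "0 \<in> I" using I.zero_closed by simp
  show mult: "x * a \<in> I" if "x \<in> gauss_ints" "a \<in> I" for x a using I.I_l_closed[of a x] that by simp
  show add: "a + b \<in> I" if "a \<in> I" "b \<in> I" for a b using I.a_closed[of a b] that by simp
  show "a - b \<in> I" if "a \<in> I" "b \<in> I" for a b
    using add[OF that(1) mult[of "-1" b]] that(2) by simp
qed

lemma gauss_norm_nat:
  assumes "a \<in> gauss_ints"
  obtains k :: nat where "(cmod a)\<^sup>2 = real k"
proof -
  obtain m n where a: "a = Complex (of_int m) (of_int n)" by (rule gauss_intsE[OF assms])
  have "(cmod a)\<^sup>2 = real_of_int (m\<^sup>2 + n\<^sup>2)" by (simp add: a cmod_power2)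
  also have "\<dots> = real (nat (m\<^sup>2 + n\<^sup>2))" by simp
  finally show ?thesis by (rule that)
qed

lemma gauss_division:
  assumes "a \<in> gauss_ints" "b \<in> gauss_ints" "a \<noteq> 0"
  obtains q where "q \<in> gauss_ints" "cmod (b - q * a) < cmod a"
proof -
  define z where "z = b / a"
  define q where "q = Complex (of_int (round (Re z))) (of_int (round (Im z)))"
  have "\<bar>Re (z - q)\<bar> \<le> 1 / 2" "\<bar>Im (z - q)\<bar> \<le> 1 / 2"
    using of_int_round_abs_le[of "Re z"] of_int_round_abs_le[of "Im z"] by (auto simp: q_def abs_minus_commute)
  then have "(Re (z - q))\<^sup>2 \<le> (1 / 2)\<^sup>2" "(Im (z - q))\<^sup>2 \<le> (1 / 2)\<^sup>2"
    by (simp_all only: abs_le_square_iff[symmetric])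
  then have "(cmod (z - q))\<^sup>2 < 1\<^sup>2" unfolding cmod_power2 by (simp add: power2_eq_square)
  then have 1: "cmod (z - q) < 1" by (rule power_less_imp_less_base) simp
  have "b - q * a = (z - q) * a" using assms(3) by (simp add: z_def algebra_simps)
  then have "cmod (b - q * a) < cmod a"
    using 1 assms(3) by (simp add: norm_mult)
  then show ?thesis by (intro that[of q]) (simp add: q_def)
qed

lemma gauss_ideal_principal:
  assumes I: "ideal I gauss_ring" and nz: "I \<noteq> {0}"
  obtains a where "a \<in> gauss_ints" "a \<noteq> 0" "I = PIdl\<^bsub>gauss_ring\<^esub> a"
proof -
  note cl = gauss_ideal_closed[OF I]
  obtain a0 where a0: "a0 \<in> I" "a0 \<noteq> 0" using nz cl(2) by blast
  define P where "P = (\<lambda>k::nat. \<exists>a\<in>I. a \<noteq> 0 \<and> (cmod a)\<^sup>2 = real k)"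
  have "a0 \<in> gauss_ints" using a0 cl(1) by blast
  then obtain k0 :: nat where "(cmod a0)\<^sup>2 = real k0" by (rule gauss_norm_nat)
  then have "\<exists>k. P k" using a0 unfolding P_def by blast
  define k where "k = (LEAST k. P k)"
  have "P k" unfolding k_def using \<open>\<exists>k. P k\<close> by (rule LeastI_ex)
  then obtain a where a: "a \<in> I" "a \<noteq> 0" "(cmod a)\<^sup>2 = real k" unfolding P_def by blast
  have ag: "a \<in> gauss_ints" using a(1) cl(1) by blast
  have "b \<in> PIdl\<^bsub>gauss_ring\<^esub> a" if b: "b \<in> I" for b
  proof -
    have bg: "b \<in> gauss_ints" using b cl(1) by blast
    obtain q where q: "q \<in> gauss_ints" "cmod (b - q * a) < cmod a" by (rule gauss_division[OF ag bg a(2)])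
    have r: "b - q * a \<in> I" by (rule cl(5)[OF b cl(3)[OF q(1) a(1)]])
    then have "b - q * a \<in> gauss_ints" using cl(1) by blast
    then obtain k' :: nat where k': "(cmod (b - q * a))\<^sup>2 = real k'" by (rule gauss_norm_nat)
    have "(cmod (b - q * a))\<^sup>2 < (cmod a)\<^sup>2" using q(2) by (intro power_strict_mono) auto
    then have "k' < k" unfolding k' a(3) by simp
    then have "\<not> P k'" unfolding k_def by (rule not_less_Least)
    then have "b - q * a = 0" using r k' unfolding P_def by blast
    then show ?thesis unfolding PIdl_gauss using q(1) by auto
  qed
  moreover have "PIdl\<^bsub>gauss_ring\<^esub> a \<subseteq> I" unfolding PIdl_gauss using cl(3) a(1) by blast
  ultimately have "I = PIdl\<^bsub>gauss_ring\<^esub> a" by blast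
  with ag a(2) show ?thesis by (intro that)
qed

lemma PIdl_gauss_nonzero:
  assumes "a \<in> gauss_ints" "a \<noteq> 0"
  shows "PIdl\<^bsub>gauss_ring\<^esub> a \<in> nonzero_gauss_ideals"
proof -
  have "ideal (PIdl\<^bsub>gauss_ring\<^esub> a) gauss_ring" using gauss.cgenideal_ideal assms(1) by simp
  moreover have "a \<in> PIdl\<^bsub>gauss_ring\<^esub> a" using gauss.cgenideal_self[of a] assms(1) by simp
  ultimately show ?thesis unfolding nonzero_gauss_ideals_def using assms(2) by blast
qed

lemma a_r_coset_gauss: "a_r_coset gauss_ring I x = (\<lambda>h. h + x) ` I"
  by (auto simp: a_r_coset_def r_coset_def gauss_ring_def)

lemma gauss_coset_eq_iff:
  assumes I: "ideal I gauss_ring"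
  shows "a_r_coset gauss_ring I x = a_r_coset gauss_ring I y \<longleftrightarrow> x - y \<in> I"
proof
  note cl = gauss_ideal_closed[OF I]
  assume "a_r_coset gauss_ring I x = a_r_coset gauss_ring I y"
  then have "0 + x \<in> (\<lambda>h. h + y) ` I" using cl(2) unfolding a_r_coset_gauss by blast
  then show "x - y \<in> I" by auto
next
  note cl = gauss_ideal_closed[OF I]
  assume xy: "x - y \<in> I"
  have "h + x \<in> (\<lambda>h. h + y) ` I" if "h \<in> I" for h
    using cl(4)[OF that xy] by (intro image_eqI[of _ _ "h + (x - y)"]) auto
  moreover have "h + y \<in> (\<lambda>h. h + x) ` I" if "h \<in> I" for h
    using cl(5)[OF that xy] by (intro image_eqI[of _ _ "h - (x - y)"]) auto
  ultimately show "a_r_coset gauss_ring I x = a_r_coset gauss_ring I y"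
    unfolding a_r_coset_gauss by blast
qed

text \<open>With \<open>a = g (c + d \<i>)\<close> and \<open>gcd c d = 1\<close>, the rectangle
  \<open>[0, g (c\<^sup>2 + d\<^sup>2)) \<times> [0, g)\<close> is a set of representatives modulo \<open>(a)\<close>.\<close>
lemma ideal_norm_PIdl:
  assumes a: "a \<in> gauss_ints" "a \<noteq> 0"
  shows "real (ideal_norm (PIdl\<^bsub>gauss_ring\<^esub> a)) = (cmod a)\<^sup>2"
proof -
  obtain p q where pq: "a = Complex (of_int p) (of_int q)" by (rule gauss_intsE[OF a(1)])
  define g where "g = gcd p q"
  have g: "g > 0" using a(2) by (auto simp: g_def pq complex_eq_iff)
  obtain c d where cd: "p = g * c" "q = g * d"
    unfolding g_def by (meson dvd_def gcd_dvd1 gcd_dvd2)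
  obtain u v where "u * p + v * q = g" unfolding g_def using bezout_int by blast
  then have "g * (u * c + v * d) = g * 1" by (simp add: cd algebra_simps)
  then have uv: "u * c + v * d = 1" using g by simp
  define t where "t = g * (c\<^sup>2 + d\<^sup>2)"
  have t: "t > 0"
  proof -
    have "c\<^sup>2 + d\<^sup>2 > 0" using a(2) by (auto simp: pq cd complex_eq_iff sum_power2_gt_zero_iff)
    then show ?thesis using g by (simp add: t_def)
  qed
  define I where "I = PIdl\<^bsub>gauss_ring\<^esub> a"
  have I: "ideal I gauss_ring" unfolding I_def using gauss.cgenideal_ideal a(1) by simp
  note cl = gauss_ideal_closed[OF I]
  have mem: "Complex (of_int x) (of_int y) \<in> I \<longleftrightarrow> (\<exists>k l. x = g * (c * k - d * l) \<and> y = g * (c * l + d * k))" for x y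
  proof -
    have prod: "Complex (of_int k) (of_int l) * a = Complex (of_int (g * (c * k - d * l))) (of_int (g * (c * l + d * k)))" for k l
      by (simp add: pq cd complex_eq_iff algebra_simps)
    have "Complex (of_int x) (of_int y) \<in> I \<longleftrightarrow> (\<exists>k l. Complex (of_int x) (of_int y) = Complex (of_int k) (of_int l) * a)"
    proof
      assume "Complex (of_int x) (of_int y) \<in> I"
      then obtain z where z: "z \<in> gauss_ints" "Complex (of_int x) (of_int y) = z * a"
        unfolding I_def PIdl_gauss by blast
      obtain k l where "z = Complex (of_int k) (of_int l)" by (rule gauss_intsE[OF z(1)])
      with z(2) show "\<exists>k l. Complex (of_int x) (of_int y) = Complex (of_int k) (of_int l) * a" by blast
    next
      assume "\<exists>k l. Complex (of_int x) (of_int y) = Complex (of_int k) (of_int l) * a"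
      then show "Complex (of_int x) (of_int y) \<in> I"
        unfolding I_def PIdl_gauss using Complex_in_gauss_ints by blast
    qed
    then show ?thesis unfolding prod by (simp only: complex.inject of_int_eq_iff)
  qed
  \<comment> \<open>With \<open>u * c + v * d = 1\<close>, the multiple
    \<open>(v + u * \<i>) * a\<close> has imaginary part \<open>g\<close> and real part
    \<open>g * j\<close>, and \<open>(c - d * \<i>) * a\<close> is the real number \<open>t\<close>.
    These two elements form a triangular basis of the ideal, which explains the rectangle.\<close>
  define j where "j = c * v - d * u"
  have e1: "Complex (of_int (g * j)) (of_int g) \<in> I"
    unfolding mem by (intro exI[of _ v] exI[of _ u]) (use uv in \<open>simp add: j_def mult.commute\<close>)
  have e2: "Complex (of_int t) (of_int 0) \<in> I"
    unfolding mem by (intro exI[of _ c] exI[of _ "- d"]) (simp add: t_def power2_eq_square)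
  have dvd_y: "g dvd y" if "Complex (of_int x) (of_int y) \<in> I" for x y
    using that unfolding mem by auto
  have dvd_x: "t dvd x" if "Complex (of_int x) (of_int 0) \<in> I" for x
  proof -
    from iffD1[OF mem that] obtain k l where kl: "x = g * (c * k - d * l)" "0 = g * (c * l + d * k)"
      by (elim exE conjE) (rule that)
    then have 0: "c * l + d * k = 0" using g by simp
    \<comment> \<open>Since \<open>c\<close> and \<open>d\<close> are coprime,
      \<open>c * l + d * k = 0\<close> forces \<open>(k, l)\<close> to be a multiple of
      \<open>(c, - d)\<close>; the Bezout coefficients give the multiplier.\<close>
    define r where "r = u * k - v * l"
    have "(u * c + v * d) * k = c * r + v * (c * l + d * k)" "(u * c + v * d) * l = - d * r + u * (c * l + d * k)"
      by (simp_all add: r_def algebra_simps)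
    then have kr: "k = c * r" "l = - d * r" unfolding 0 uv by simp_all
    have "g * (c * (c * r) - d * (- d * r)) = g * (c\<^sup>2 + d\<^sup>2) * r" by (simp add: power2_eq_square algebra_simps)
    then have "x = t * r" unfolding kl(1) t_def kr[symmetric] .
    then show ?thesis by simp
  qed
  define \<phi> where "\<phi> = (\<lambda>(x, y). a_r_coset gauss_ring I (Complex (of_int x) (of_int y)))"
  have "inj_on \<phi> ({0..<t} \<times> {0..<g})"
  proof (rule inj_onI, clarify)
    fix x y x' y' assume *: "x \<in> {0..<t}" "y \<in> {0..<g}" "x' \<in> {0..<t}" "y' \<in> {0..<g}" "\<phi> (x, y) = \<phi> (x', y')"
    have "Complex (of_int x) (of_int y) - Complex (of_int x') (of_int y') = Complex (of_int (x - x')) (of_int (y - y'))"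
      by (simp add: complex_eq_iff)
    then have d: "Complex (of_int (x - x')) (of_int (y - y')) \<in> I"
      using *(5) gauss_coset_eq_iff[OF I] by (simp add: \<phi>_def)
    have small: "k = 0" if "m dvd k" "\<bar>k\<bar> < m" for k m :: int
      using that zdvd_not_zless[of "\<bar>k\<bar>" m] by force
    have "y - y' = 0"
      using small[OF dvd_y[OF d]] *(2,4) by auto
    then have "Complex (of_int (x - x')) (of_int 0) \<in> I" using d by simp
    then have "t dvd x - x'" by (rule dvd_x)
    from small[OF this] have "x - x' = 0" using *(1,3) by auto
    with \<open>y - y' = 0\<close> show "x = x' \<and> y = y'" by simp
  qed
  moreover have "\<phi> ` ({0..<t} \<times> {0..<g}) = carrier (gauss_ring Quot I)"
  proof -
    have carrier: "carrier (gauss_ring Quot I) = (\<lambda>x. a_r_coset gauss_ring I x) ` gauss_ints"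
      by (auto simp: FactRing_def A_RCOSETS_def')
    have "a_r_coset gauss_ring I z \<in> \<phi> ` ({0..<t} \<times> {0..<g})" if z: "z \<in> gauss_ints" for z
    proof -
      obtain m n where mn: "z = Complex (of_int m) (of_int n)" by (rule gauss_intsE[OF z])
      \<comment> \<open>Reducing \<open>n\<close> modulo \<open>g\<close> by a multiple of the first
        basis element changes the real part to \<open>m1\<close>, which is then reduced modulo
        \<open>t\<close>.\<close>
      define m1 where "m1 = m - (n div g) * (g * j)"
      have "z - Complex (of_int (m1 mod t)) (of_int (n mod g)) =
         of_int (n div g) * Complex (of_int (g * j)) (of_int g) + of_int (m1 div t) * Complex (of_int t) (of_int 0)"
      proof -
        have 1: "n - n mod g = (n div g) * g" by (simp add: minus_mod_eq_div_mult)
        have "m1 - m1 mod t = (m1 div t) * t" by (simp add: minus_mod_eq_div_mult)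
        then have 2: "m - m1 mod t = (n div g) * (g * j) + (m1 div t) * t" by (simp add: m1_def)
        have "z - Complex (of_int (m1 mod t)) (of_int (n mod g)) = Complex (of_int (m - m1 mod t)) (of_int (n - n mod g))"
          by (simp add: mn complex_eq_iff)
        also have "\<dots> = of_int (n div g) * Complex (of_int (g * j)) (of_int g) + of_int (m1 div t) * Complex (of_int t) (of_int 0)"
          unfolding 1 2 by (simp add: complex_eq_iff)
        finally show ?thesis .
      qed
      moreover have "of_int k \<in> gauss_ints" for k :: int by (simp add: gauss_ints_def)
      ultimately have "z - Complex (of_int (m1 mod t)) (of_int (n mod g)) \<in> I"
        using cl(3,4) e1 e2 by metis
      then have "a_r_coset gauss_ring I z = \<phi> (m1 mod t, n mod g)"
        unfolding \<phi>_def using gauss_coset_eq_iff[OF I] by simp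
      then show ?thesis using g t by (intro image_eqI[of _ _ "(m1 mod t, n mod g)"]) auto
    qed
    then show ?thesis unfolding carrier by (auto simp: \<phi>_def)
  qed
  ultimately have "card (carrier (gauss_ring Quot I)) = card ({0..<t} \<times> {0..<g})"
    by (metis card_image)
  also have "\<dots> = nat t * nat g" by (simp add: card_cartesian_product)
  finally have "real (ideal_norm I) = real_of_int (t * g)" using t g by (simp add: ideal_norm_def)
  also have "t * g = p\<^sup>2 + q\<^sup>2" by (simp add: t_def cd power2_eq_square algebra_simps)
  also have "real_of_int (p\<^sup>2 + q\<^sup>2) = (cmod a)\<^sup>2" by (simp add: pq cmod_power2)
  finally show ?thesis by (simp add: I_def)
qed

text \<open>Half-open, with the positive real axis and without the imaginary one, the quadrant
  contains exactly one of the four associates of each nonzero Gaussian integer.\<close>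

definition gauss_quadrant :: "complex set" where
  "gauss_quadrant = {a \<in> gauss_ints. Re a > 0 \<and> Im a \<ge> 0}"

lemma rotate_into_quadrant:
  assumes "a \<noteq> 0"
  obtains "Re a > 0" "Im a \<ge> 0" | "Re (\<i> * a) > 0" "Im (\<i> * a) \<ge> 0"
    | "Re (- a) > 0" "Im (- a) \<ge> 0" | "Re (- \<i> * a) > 0" "Im (- \<i> * a) \<ge> 0"
proof -
  have "Re a \<noteq> 0 \<or> Im a \<noteq> 0" using assms by (auto simp: complex_eq_iff)
  with that show ?thesis
    by (cases "Re a" "0::real" rule: linorder_cases; cases "Im a" "0::real" rule: linorder_cases) auto
qed

lemma PIdl_gauss_unit:
  assumes "u \<in> gauss_ints" "u' \<in> gauss_ints" "u' * u = 1"
  shows "PIdl\<^bsub>gauss_ring\<^esub> (u * a) = PIdl\<^bsub>gauss_ring\<^esub> a"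
proof -
  have "x * (u * a) \<in> {x * a |x. x \<in> gauss_ints}" if "x \<in> gauss_ints" for x
    using that assms by (intro CollectI exI[of _ "x * u"]) auto
  moreover have "x * a \<in> {x * (u * a) |x. x \<in> gauss_ints}" if "x \<in> gauss_ints" for x
    using that assms by (intro CollectI exI[of _ "x * u'"]) (auto simp: mult.assoc[symmetric] mult.assoc[of x u' u])
  ultimately show ?thesis unfolding PIdl_gauss by blast
qed

lemma bij_betw_gauss_ideals: "bij_betw (\<lambda>a. PIdl\<^bsub>gauss_ring\<^esub> a) gauss_quadrant nonzero_gauss_ideals"
proof (rule bij_betwI')
  fix a b assume a: "a \<in> gauss_quadrant" and b: "b \<in> gauss_quadrant"
  have ag: "a \<in> gauss_ints" "a \<noteq> 0" and bg: "b \<in> gauss_ints" "b \<noteq> 0" using a b by (auto simp: gauss_quadrant_def)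
  show "(PIdl\<^bsub>gauss_ring\<^esub> a = PIdl\<^bsub>gauss_ring\<^esub> b) = (a = b)"
  proof
    assume eq: "PIdl\<^bsub>gauss_ring\<^esub> a = PIdl\<^bsub>gauss_ring\<^esub> b"
    have "a \<in> PIdl\<^bsub>gauss_ring\<^esub> b" "b \<in> PIdl\<^bsub>gauss_ring\<^esub> a"
      using eq gauss.cgenideal_self[of a] gauss.cgenideal_self[of b] ag bg by simp_all
    then obtain u v where uv: "u \<in> gauss_ints" "v \<in> gauss_ints" "a = u * b" "b = v * a"
      unfolding PIdl_gauss by blast
    then have "(u * v) * a = 1 * a" by (metis mult.assoc mult_1)
    then have "u * v = 1" using ag(2) by simp
    then have "u ^ 4 = 1" using uv gauss_unit_power4 by blast
    then have "(u - 1) * (u + 1) * (u - \<i>) * (u + \<i>) = 0"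
      by (simp add: algebra_simps eval_nat_numeral)
    then have "u = 1 \<or> u = -1 \<or> u = \<i> \<or> u = - \<i>"
      by (auto simp: eq_neg_iff_add_eq_0)
    then show "a = b"
      using a b uv(3) by (auto simp: gauss_quadrant_def)
  qed simp
next
  fix a assume "a \<in> gauss_quadrant"
  then show "PIdl\<^bsub>gauss_ring\<^esub> a \<in> nonzero_gauss_ideals"
    by (intro PIdl_gauss_nonzero) (auto simp: gauss_quadrant_def)
next
  fix I assume "I \<in> nonzero_gauss_ideals"
  then obtain a where a: "a \<in> gauss_ints" "a \<noteq> 0" "I = PIdl\<^bsub>gauss_ring\<^esub> a"
    by (auto simp: nonzero_gauss_ideals_def elim!: gauss_ideal_principal)
  have *: "\<exists>b\<in>gauss_quadrant. I = PIdl\<^bsub>gauss_ring\<^esub> b"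
    if "u \<in> gauss_ints" "u' \<in> gauss_ints" "u' * u = 1" "Re (u * a) > 0" "Im (u * a) \<ge> 0" for u u'
    using that a PIdl_gauss_unit[OF that(1-3), of a] by (intro bexI[of _ "u * a"]) (auto simp: gauss_quadrant_def)
  from a(2) show "\<exists>b\<in>gauss_quadrant. I = PIdl\<^bsub>gauss_ring\<^esub> b"
    by (cases rule: rotate_into_quadrant)
      (use *[of 1 1] *[of \<i> "- \<i>"] *[of "-1" "-1"] *[of "- \<i>" \<i>] in auto)
qed

subsection \<open>The lattice sum behind the Hecke L-functions\<close>

text \<open>As \<open>(a / cmod a)\<^sup>2 = a / cnj a\<close>, the character of index
  \<open>n\<close> has \<open>k = 2 * n\<close>. Odd \<open>k\<close> define no function of ideals,
  since the value changes sign under multiplication by \<open>\<i>\<close>, but they make sense as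
  lattice summands.\<close>

definition gauss_term :: "int \<Rightarrow> complex \<Rightarrow> complex \<Rightarrow> complex" where
  "gauss_term k s a = (a / cnj a) powi k * of_real ((cmod a)\<^sup>2) powr (- s)"

lemma hecke_L_term_PIdl:
  assumes "a \<in> gauss_ints" "a \<noteq> 0"
  shows "hecke_L_term n s (PIdl\<^bsub>gauss_ring\<^esub> a) = gauss_term (2 * n) s a"
proof -
  have "(a / of_real (cmod a)) powi (4 * n) = ((a / of_real (cmod a)) powi 2) powi (2 * n)"
  proof -
    have "4 * n = 2 * (2 * n)" by simp
    then show ?thesis by (simp only: power_int_mult)
  qed
  also have "(a / of_real (cmod a)) powi 2 = a / cnj a"
  proof -
    have "(a / of_real (cmod a)) powi 2 = a\<^sup>2 / (of_real (cmod a))\<^sup>2" by (simp add: power_divide)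
    also have "(of_real (cmod a))\<^sup>2 = a * cnj a" by (simp only: of_real_power[symmetric] complex_norm_square)
    finally show ?thesis using assms(2) by (simp add: power2_eq_square)
  qed
  finally have "hecke_char n (PIdl\<^bsub>gauss_ring\<^esub> a) = (a / cnj a) powi (2 * n)"
    using hecke_char_principal[OF assms] by simp
  moreover have "(of_nat (ideal_norm (PIdl\<^bsub>gauss_ring\<^esub> a)) :: complex) = of_real ((cmod a)\<^sup>2)"
    using ideal_norm_PIdl[OF assms] by (metis of_real_of_nat_eq)
  ultimately show ?thesis by (simp add: hecke_L_term_def gauss_term_def)
qed

lemma gauss_term_minus: "gauss_term k s (- a) = gauss_term k s a"
  by (simp add: gauss_term_def)

lemma gauss_term_cnj: "gauss_term k s (cnj a) = gauss_term (- k) s a"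
proof -
  have "cnj a / a = inverse (a / cnj a)" by simp
  then show ?thesis by (simp add: gauss_term_def power_int_minus flip: power_int_inverse)
qed

lemma gauss_term_i: "gauss_term k s (\<i> * a) = (-1) powi k * gauss_term k s a"
proof -
  have "\<i> * a / cnj (\<i> * a) = (-1) * (a / cnj a)" by simp
  then have "(\<i> * a / cnj (\<i> * a)) powi k = (-1) powi k * (a / cnj a) powi k"
    by (simp only: power_int_mult_distrib)
  then show ?thesis by (simp add: gauss_term_def norm_mult)
qed

text \<open>For \<open>v = 0\<close> the two powers with exponent \<open>- s\<close> have conjugate
  logarithms, whose sum is the logarithm of the positive number \<open>(m / n)\<^sup>2 + 1\<close>;
  the integer exponents \<open>k\<close> and \<open>- k\<close> combine to a power of
  \<open>a / cnj a\<close>.\<close>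

lemma lat_term_eq_gauss_term:
  assumes "x \<in> lat_index"
  shows "lat_term k s 0 x = gauss_term (int k) s (Complex (of_int (snd x)) (of_nat (fst x)))"
proof -
  obtain n m where x: "x = (n, m)" "n \<ge> 1" using assms by (auto simp: lat_index_def)
  define y where "y = real_of_int m / real n"
  define a where "a = Complex (of_int m) (of_nat n)"
  have a: "a = of_nat n * (of_real y + \<i>)" "cnj a = of_nat n * (of_real y - \<i>)"
    using x(2) by (simp_all add: a_def y_def complex_eq_iff)
  have "kern (of_nat k) (- of_nat k) y = ((of_real y + \<i>) / (of_real y - \<i>)) ^ k"
    by (simp add: kern_def powr_minus powr_nat power_divide divide_inverse power_mult_distrib power_inverse)
  also have "(of_real y + \<i>) / (of_real y - \<i>) = a / cnj a"
    unfolding a using x(2) by simp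
  finally have 1: "kern (of_nat k) (- of_nat k) y = (a / cnj a) ^ k" .
  have "kern (- s) (- s) y = exp (- s * (Ln (of_real y + \<i>) + cnj (Ln (of_real y + \<i>))))"
    unfolding kern_exp Ln_minus_i by (simp add: algebra_simps)
  also have "Ln (of_real y + \<i>) + cnj (Ln (of_real y + \<i>)) = of_real (2 * Re (Ln (of_real y + \<i>)))"
    by (simp add: complex_add_cnj)
  also have "2 * Re (Ln (of_real y + \<i>)) = ln (y\<^sup>2 + 1)"
    by (subst Re_Ln) (simp_all add: cmod_def ln_sqrt add_nonneg_pos)
  also have "exp (- s * of_real (ln (y\<^sup>2 + 1))) = of_real (y\<^sup>2 + 1) powr (- s)"
  proof -
    have pos: "y\<^sup>2 + 1 > 0" by (simp add: add_nonneg_pos)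
    then have "complex_of_real (y\<^sup>2 + 1) \<noteq> 0" by (simp only: of_real_eq_0_iff)
    then show ?thesis using Ln_of_real[OF pos] by (simp only: powr_def if_False)
  qed
  finally have 2: "kern (- s) (- s) y = of_real (y\<^sup>2 + 1) powr (- s)" .
  have "of_nat n powr (- 2 * s) = (of_nat n powr (- s) * of_nat n powr (- s) :: complex)"
    by (simp flip: powr_add)
  also have "\<dots> = of_real ((real n)\<^sup>2) powr (- s)"
    by (subst powr_times_real[symmetric]) (simp_all add: power2_eq_square)
  finally have 3: "of_nat n powr (- 2 * s) = (of_real ((real n)\<^sup>2) powr (- s) :: complex)" .
  have "(cmod a)\<^sup>2 = (real n)\<^sup>2 * (y\<^sup>2 + 1)"
    using x(2) by (simp add: a_def y_def cmod_power2 field_simps)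
  then have 4: "of_real ((cmod a)\<^sup>2) powr (- s) = of_real ((real n)\<^sup>2) powr (- s) * of_real (y\<^sup>2 + 1) powr (- s)"
    by (simp only: of_real_mult) (subst powr_times_real, simp_all add: add_nonneg_nonneg)
  have "lat_term k s 0 x = of_nat n powr (- 2 * s) * kern (of_nat k + - s) (- of_nat k + - s) y"
    by (simp add: lat_term_def x(1) y_def)
  also have "\<dots> = of_real ((real n)\<^sup>2) powr (- s) * ((a / cnj a) ^ k * of_real (y\<^sup>2 + 1) powr (- s))"
    unfolding kern_add 1 2 3 ..
  also have "\<dots> = gauss_term (int k) s a"
    unfolding gauss_term_def 4 by simp
  finally show ?thesis by (simp add: a_def x(1))
qed

text \<open>The nonzero lattice points are those of the upper half plane, those of the positive real
  axis and the negatives of both, and the summand is even. On the real axis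
  \<open>a / cnj a = 1\<close>, which leaves \<open>zeta0 (2 * s)\<close> for every
  \<open>k\<close>.\<close>

lemma has_sum_gauss_term:
  assumes s: "Re s > 3"
  shows "(gauss_term (int k) s has_sum (2 * lat k s 0 + 2 * zeta0 (2 * s))) (gauss_ints - {0})"
proof -
  define U where "U = {a \<in> gauss_ints. Im a > 0}"
  define V where "V = {a \<in> gauss_ints. Im a = 0 \<and> Re a > 0}"
  have "(lat_term k s 0 has_sum lat k s 0) lat_index"
    unfolding lat_def by (rule has_sum_infsum, rule abs_summable_summable[OF lat_term_summable]) (use s in auto)
  then have "((\<lambda>x. gauss_term (int k) s (Complex (of_int (snd x)) (of_nat (fst x)))) has_sum lat k s 0) lat_index"
    by (subst has_sum_cong[OF lat_term_eq_gauss_term[symmetric]])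
  moreover have "bij_betw (\<lambda>x. Complex (of_int (snd x)) (of_nat (fst x))) lat_index U"
  proof (rule bij_betw_byWitness[where f' = "\<lambda>a. (nat \<lfloor>Im a\<rfloor>, \<lfloor>Re a\<rfloor>)"])
    show "\<forall>a\<in>U. Complex (of_int (snd (nat \<lfloor>Im a\<rfloor>, \<lfloor>Re a\<rfloor>))) (of_nat (fst (nat \<lfloor>Im a\<rfloor>, \<lfloor>Re a\<rfloor>))) = a"
      by (auto simp: U_def gauss_ints_def complex_eq_iff elim!: Ints_cases)
    show "(\<lambda>x. Complex (of_int (snd x)) (of_nat (fst x))) ` lat_index \<subseteq> U"
      by (auto simp: U_def gauss_ints_def lat_index_def)
    show "(\<lambda>a. (nat \<lfloor>Im a\<rfloor>, \<lfloor>Re a\<rfloor>)) ` U \<subseteq> lat_index"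
      by (auto simp: U_def gauss_ints_def lat_index_def elim!: Ints_cases)
  qed auto
  ultimately have hU: "(gauss_term (int k) s has_sum lat k s 0) U"
    using has_sum_reindex_bij_betw by blast
  have "((\<lambda>n. of_nat n powr (- (2 * s))) has_sum zeta0 (2 * s)) {1..}"
    by (rule zeta0_has_sum) (use s in auto)
  moreover have "of_nat n powr (- (2 * s)) = gauss_term (int k) s (of_nat n)" if "n \<in> {1..}" for n :: nat
  proof -
    have "of_nat n powr (- (2 * s)) = (of_nat n powr (- s) * of_nat n powr (- s) :: complex)"
      by (simp flip: powr_add)
    also have "\<dots> = of_real ((real n)\<^sup>2) powr (- s)"
      by (subst powr_times_real[symmetric]) (simp_all add: power2_eq_square)
    finally show ?thesis using that by (simp add: gauss_term_def)
  qed
  ultimately have "((\<lambda>n. gauss_term (int k) s (of_nat n)) has_sum zeta0 (2 * s)) {1..}"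
    by (subst has_sum_cong[symmetric]) auto
  moreover have "bij_betw (of_nat :: nat \<Rightarrow> complex) {1..} V"
  proof (rule bij_betw_byWitness[where f' = "\<lambda>a. nat \<lfloor>Re a\<rfloor>"])
    show "\<forall>a\<in>V. of_nat (nat \<lfloor>Re a\<rfloor>) = a"
      by (auto simp: V_def gauss_ints_def complex_eq_iff elim!: Ints_cases)
    show "of_nat ` {1..} \<subseteq> V" by (auto simp: V_def gauss_ints_def)
    show "(\<lambda>a. nat \<lfloor>Re a\<rfloor>) ` V \<subseteq> {1..}"
      by (auto simp: V_def gauss_ints_def elim!: Ints_cases)
  qed auto
  ultimately have hV: "(gauss_term (int k) s has_sum zeta0 (2 * s)) V"
    using has_sum_reindex_bij_betw by blast
  have neg: "(gauss_term (int k) s has_sum S) (uminus ` A)" if "(gauss_term (int k) s has_sum S) A" for S A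
    using that by (subst has_sum_reindex) (auto simp: o_def gauss_term_minus)
  have "(gauss_term (int k) s has_sum (lat k s 0 + lat k s 0 + (zeta0 (2 * s) + zeta0 (2 * s)))) ((U \<union> uminus ` U) \<union> (V \<union> uminus ` V))"
    by (intro has_sum_Un_disjoint hU hV neg) (auto simp: U_def V_def)
  also have "(U \<union> uminus ` U) \<union> (V \<union> uminus ` V) = gauss_ints - {0}"
  proof -
    have im: "uminus ` U = {a \<in> gauss_ints. Im a < 0}" "uminus ` V = {a \<in> gauss_ints. Im a = 0 \<and> Re a < 0}"
    proof -
      have neg_img: "uminus ` A = {b. - b \<in> A}" for A :: "complex set"
      proof (intro equalityI subsetI)
        fix b assume "b \<in> {b. - b \<in> A}"
        then show "b \<in> uminus ` A" by (metis imageI mem_Collect_eq minus_minus)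
      qed auto
      show "uminus ` U = {a \<in> gauss_ints. Im a < 0}" "uminus ` V = {a \<in> gauss_ints. Im a = 0 \<and> Re a < 0}"
        unfolding neg_img U_def V_def by (auto simp: gauss_ints_def)
    qed
    show ?thesis unfolding im by (auto simp: U_def V_def complex_eq_iff)
  qed
  finally show ?thesis by simp
qed

lemma has_sum_gauss_term_abs:
  assumes s: "Re s > 3"
  shows "(gauss_term k s has_sum (2 * lat (nat \<bar>k\<bar>) s 0 + 2 * zeta0 (2 * s))) (gauss_ints - {0})"
proof (cases "k \<ge> 0")
  case True
  then show ?thesis using has_sum_gauss_term[OF s, of "nat k"] by simp
next
  case False
  then have k: "int (nat \<bar>k\<bar>) = - k" by simp
  have "bij_betw cnj (gauss_ints - {0}) (gauss_ints - {0})"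
    by (rule bij_betw_byWitness[where f' = cnj]) auto
  from iffD2[OF has_sum_reindex_bij_betw[OF this] has_sum_gauss_term[OF s, of "nat \<bar>k\<bar>"]]
  show ?thesis unfolding k gauss_term_cnj by simp
qed

text \<open>Rotation by \<open>\<i>\<close> carries the quadrant around the plane and multiplies the
  summand by \<open>(-1) powi k\<close>. The total factor is \<open>4\<close> for even
  \<open>k\<close>; for odd \<open>k\<close> it is \<open>0\<close>, and the equation then evaluates
  \<open>lat\<close>.\<close>

lemma gauss_quadrant_sum:
  assumes s: "Re s > 3"
  shows "gauss_term k s summable_on gauss_quadrant"
    "(2 + 2 * (-1) powi k) * (\<Sum>\<^sub>\<infinity>a\<in>gauss_quadrant. gauss_term k s a) = 2 * lat (nat \<bar>k\<bar>) s 0 + 2 * zeta0 (2 * s)"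
proof -
  let ?G = "gauss_ints - {0}"
  have hs: "(gauss_term k s has_sum (2 * lat (nat \<bar>k\<bar>) s 0 + 2 * zeta0 (2 * s))) ?G"
    by (rule has_sum_gauss_term_abs[OF s])
  have "gauss_quadrant \<subseteq> ?G" by (auto simp: gauss_quadrant_def)
  then show sm: "gauss_term k s summable_on gauss_quadrant"
    using summable_on_subset_banach has_sum_imp_summable[OF hs] by blast
  define S where "S = (\<Sum>\<^sub>\<infinity>a\<in>gauss_quadrant. gauss_term k s a)"
  have h1: "(gauss_term k s has_sum S) gauss_quadrant" unfolding S_def using sm by (rule has_sum_infsum)
  have rot: "(gauss_term k s has_sum ((-1) powi k * T)) ((\<lambda>a. \<i> * a) ` A)" if "(gauss_term k s has_sum T) A" for T A
    using has_sum_cmult_right[OF that, of "(-1) powi k"]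
    by (subst has_sum_reindex) (auto simp: o_def gauss_term_i inj_on_def)
  let ?A = "{a \<in> gauss_ints. Im a > 0 \<and> Re a \<le> 0}"
  let ?B = "{a \<in> gauss_ints. Re a < 0 \<and> Im a \<le> 0}"
  let ?C = "{a \<in> gauss_ints. Im a < 0 \<and> Re a \<ge> 0}"
  have rot_img: "(\<lambda>a. \<i> * a) ` A = {b. - \<i> * b \<in> A}" for A
  proof (intro equalityI subsetI)
    fix b assume "b \<in> {b. - \<i> * b \<in> A}"
    moreover have "b = \<i> * (- \<i> * b)" by simp
    ultimately show "b \<in> (\<lambda>a. \<i> * a) ` A" by (metis imageI mem_Collect_eq)
  qed auto
  have im: "(\<lambda>a. \<i> * a) ` gauss_quadrant = ?A" "(\<lambda>a. \<i> * a) ` ?A = ?B" "(\<lambda>a. \<i> * a) ` ?B = ?C"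
    unfolding gauss_quadrant_def rot_img by (auto simp: gauss_ints_def)
  have sq: "(-1) powi k * (-1) powi k = (1 :: complex)" by (simp flip: power_int_mult_distrib)
  have hA: "(gauss_term k s has_sum ((-1) powi k * S)) ?A" using rot[OF h1] unfolding im .
  have hB: "(gauss_term k s has_sum S) ?B" using rot[OF hA] unfolding im mult.assoc[symmetric] sq by simp
  have hC: "(gauss_term k s has_sum ((-1) powi k * S)) ?C" using rot[OF hB] unfolding im .
  have "(gauss_term k s has_sum (S + (-1) powi k * S + (S + (-1) powi k * S))) ((gauss_quadrant \<union> ?A) \<union> (?B \<union> ?C))"
    by (intro has_sum_Un_disjoint h1 hA hB hC) (auto simp: gauss_quadrant_def)
  also have "(gauss_quadrant \<union> ?A) \<union> (?B \<union> ?C) = ?G"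
    by (auto simp: gauss_quadrant_def complex_eq_iff)
  finally have "S + (-1) powi k * S + (S + (-1) powi k * S) = 2 * lat (nat \<bar>k\<bar>) s 0 + 2 * zeta0 (2 * s)"
    using hs has_sum_unique by blast
  then show "(2 + 2 * (-1) powi k) * S = 2 * lat (nat \<bar>k\<bar>) s 0 + 2 * zeta0 (2 * s)"
    by (simp add: algebra_simps)
qed

lemma hecke_L_eq:
  assumes s: "Re s > 3"
  shows "hecke_L_term n s summable_on nonzero_gauss_ideals"
    "hecke_L n s = (lat (nat (2 * \<bar>n\<bar>)) s 0 + zeta0 (2 * s)) / 2"
proof -
  have eq: "hecke_L_term n s (PIdl\<^bsub>gauss_ring\<^esub> a) = gauss_term (2 * n) s a" if "a \<in> gauss_quadrant" for a
    using that by (intro hecke_L_term_PIdl) (auto simp: gauss_quadrant_def)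
  have "(\<lambda>a. hecke_L_term n s (PIdl\<^bsub>gauss_ring\<^esub> a)) summable_on gauss_quadrant"
    using gauss_quadrant_sum(1)[OF s, of "2 * n"] by (subst summable_on_cong[OF eq])
  then show "hecke_L_term n s summable_on nonzero_gauss_ideals"
    using summable_on_reindex_bij_betw[OF bij_betw_gauss_ideals] by blast
  have "hecke_L n s = (\<Sum>\<^sub>\<infinity>a\<in>gauss_quadrant. hecke_L_term n s (PIdl\<^bsub>gauss_ring\<^esub> a))"
    unfolding hecke_L_def by (rule infsum_reindex_bij_betw[OF bij_betw_gauss_ideals, symmetric])
  also have "\<dots> = (\<Sum>\<^sub>\<infinity>a\<in>gauss_quadrant. gauss_term (2 * n) s a)"
    by (rule infsum_cong[OF eq])
  finally have h: "hecke_L n s = (\<Sum>\<^sub>\<infinity>a\<in>gauss_quadrant. gauss_term (2 * n) s a)" .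
  have "(-1) powi (2 * n) = (1 :: complex)" by (simp add: power_int_mult)
  then have "4 * hecke_L n s = 2 * lat (nat \<bar>2 * n\<bar>) s 0 + 2 * zeta0 (2 * s)"
    using gauss_quadrant_sum(2)[OF s, of "2 * n"] by (simp add: h)
  then have "hecke_L n s = (2 * lat (nat \<bar>2 * n\<bar>) s 0 + 2 * zeta0 (2 * s)) / 4"
    by (metis nonzero_mult_div_cancel_left zero_neq_numeral)
  moreover have "(2 * A + 2 * B) / 4 = (A + B) / 2" for A B :: complex
    by (simp add: add_divide_distrib)
  ultimately show "hecke_L n s = (lat (nat (2 * \<bar>n\<bar>)) s 0 + zeta0 (2 * s)) / 2"
    by (simp only: abs_mult) simp
qed

lemma lat_odd:
  assumes "Re s > 3" "odd k"
  shows "lat k s 0 + zeta0 (2 * s) = 0"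
proof -
  have "(-1) powi (int k) = (-1 :: complex)" using assms(2) by simp
  then show ?thesis using gauss_quadrant_sum(2)[OF assms(1), of "int k"]
    by (simp add: distrib_left[symmetric] del: distrib_left_numeral power_int_of_nat)
qed

text \<open>Because \<open>lat k s 0 + zeta0 (2 * s)\<close> vanishes for odd \<open>k\<close>, the
  sum over all \<open>k\<close> is the sum over \<open>k = 2 * n\<close>. The factor
  \<open>2 powr w\<close> compensates \<open>(2 * n) powr (- w)\<close>; the contributions of
  \<open>n\<close> and \<open>- n\<close> agree and make up for the \<open>1 / 2\<close> in
  \<open>hecke_L_eq\<close>.\<close>

lemma double_term_has_sum:
  assumes s: "Re s > 3" and w: "Re w > 1"
  shows "(double_term s w has_sum (2 powr w * (lat_series s w + zeta0 (2 * s) * zeta0 w))) (UNIV - {0})"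
proof -
  define T where "T = lat_series s w + zeta0 (2 * s) * zeta0 w"
  define f where "f = (\<lambda>k::nat. of_nat k powr (- w) * (lat k s 0 + zeta0 (2 * s)))"
  have "((\<lambda>k. of_nat k powr (- w) * lat k s 0 + of_nat k powr (- w) * zeta0 (2 * s)) has_sum (lat_series s w + zeta0 w * zeta0 (2 * s))) {1..}"
    by (intro has_sum_add has_sum_cmult_left lat_series_has_sum zeta0_has_sum s w)
  then have "(f has_sum T) {1..}" by (simp add: f_def T_def distrib_left mult.commute)
  moreover have "(f has_sum T) {1..} \<longleftrightarrow> (f has_sum T) ((\<lambda>n. 2 * n) ` {1..})"
  proof (rule has_sum_cong_neutral)
    fix k :: nat assume "k \<in> {1..} - (\<lambda>n. 2 * n) ` {1..}"
    then have "odd k" by (auto elim!: evenE)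
    then show "f k = 0" using lat_odd[OF s] by (simp add: f_def)
  qed auto
  ultimately have "((\<lambda>n. f (2 * n)) has_sum T) {1..}"
    by (subst (asm) has_sum_reindex) (auto simp: inj_on_def o_def)
  then have h: "((\<lambda>n. 2 powr w * f (2 * n) / 2) has_sum (2 powr w * T / 2)) {1..}"
    unfolding divide_inverse by (intro has_sum_cmult_left has_sum_cmult_right)
  have val: "2 powr w * f (2 * n) / 2 = double_term s w (int n)" "2 powr w * f (2 * n) / 2 = double_term s w (- int n)"
    if "n \<in> {1..}" for n :: nat
  proof -
    have "of_nat (2 * n) powr (- w) = (2 powr (- w) * of_nat n powr (- w) :: complex)"
      by (simp only: of_nat_mult) (subst powr_times_real, auto)
    then have "2 powr w * of_nat (2 * n) powr (- w) = (of_nat n powr (- w) :: complex)"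
      by (simp add: powr_minus)
    then have "2 powr w * f (2 * n) / 2 = of_nat n powr (- w) * ((lat (2 * n) s 0 + zeta0 (2 * s)) / 2)"
      unfolding f_def by (simp only: mult.assoc[symmetric]) simp
    moreover have "nat (2 * int n) = 2 * n" by simp
    ultimately show "2 powr w * f (2 * n) / 2 = double_term s w (int n)" "2 powr w * f (2 * n) / 2 = double_term s w (- int n)"
      by (simp_all add: double_term_def hecke_L_eq(2)[OF s] mult.commute)
  qed
  have hp: "(double_term s w has_sum (2 powr w * T / 2)) (int ` {1..})"
    using iffD1[OF has_sum_cong[OF val(1)] h] by (subst has_sum_reindex) (auto simp: o_def)
  have hn: "(double_term s w has_sum (2 powr w * T / 2)) ((\<lambda>n. - int n) ` {1..})"
    using iffD1[OF has_sum_cong[OF val(2)] h] by (subst has_sum_reindex) (auto simp: o_def inj_on_def)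
  have "(double_term s w has_sum (2 powr w * T / 2 + 2 powr w * T / 2)) (int ` {1..} \<union> (\<lambda>n. - int n) ` {1..})"
    by (intro has_sum_Un_disjoint hp hn) auto
  also have "int ` {1..} \<union> (\<lambda>n. - int n) ` {1..} = UNIV - {0}"
  proof -
    have "k \<in> int ` {1..} \<union> (\<lambda>n. - int n) ` {1..}" if "k \<noteq> 0" for k
      using that by (cases k rule: int_cases2) auto
    then show ?thesis by auto
  qed
  finally show ?thesis by (simp add: T_def)
qed

lemma double_series_eq:
  assumes "Re s > 3" "Re w > 1"
  shows "double_series s w = (1 / 2) * (lat 0 s 0 + zeta0 (2 * s)) + 2 powr w * (lat_series s w + zeta0 (2 * s) * zeta0 w)"
  using infsumI[OF double_term_has_sum[OF assms]] hecke_L_eq(2)[OF assms(1), of 0]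
  by (simp add: double_series_def)

subsection \<open>Gluing the continuations\<close>

text \<open>Two pairs satisfy \<open>g n * h m = g m * h n\<close> on the quadrant, hence, by the
  identity theorem, on the convex set where both are defined. So the quotients agree wherever both
  denominators are nonzero, and they define one function.\<close>

lemma continues_to_imp_meromorphic2:
  assumes f: "\<And>x y. continues_to f x y"
  shows "\<exists>F. meromorphic2_on F UNIV \<and> (\<forall>s w. Re s > 4 \<longrightarrow> Re w > 4 \<longrightarrow> F (s, w) = f s w)"
proof -
  define U where "U = (\<lambda>n::nat. half_space2 (- real n) (- real n))"
  define base where "base = half_space2 4 4"
  have U: "open (U n)" "convex (U n)" for n
    unfolding U_def by (rule open_half_space2, rule convex_half_space2)
  have base_U: "base \<subseteq> U n" for n unfolding base_def U_def by auto
  have "\<exists>g h. holomorphic2_on g (U n) \<and> holomorphic2_on h (U n) \<and>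
     (\<forall>s w. Re s > 4 \<longrightarrow> Re w > 4 \<longrightarrow> g (s, w) = h (s, w) * f s w \<and> (w \<notin> \<int> \<longrightarrow> h (s, w) \<noteq> 0))" for n
  proof -
    have Un: "half_space2 (- real n) (- real n) = U n" by (simp add: U_def)
    have c: "continues_to f (- real n) (- real n)" by (rule f)
    obtain g h where "continuation_pair f (- real n) (- real n) g h"
      using c unfolding continues_to_def by blast
    note gh = continuation_pairD[OF this, unfolded Un]
    have "(s, w) \<in> U n" if "Re s > 4" "Re w > 4" for s w using that by (auto simp: U_def)
    with gh show ?thesis by blast
  qed
  then obtain g h where gh: "\<And>n. holomorphic2_on (g n) (U n)" "\<And>n. holomorphic2_on (h n) (U n)"
    and eq: "\<And>n s w. Re s > 4 \<Longrightarrow> Re w > 4 \<Longrightarrow> g n (s, w) = h n (s, w) * f s w"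
    and nz: "\<And>n s w. Re s > 4 \<Longrightarrow> Re w > 4 \<Longrightarrow> w \<notin> \<int> \<Longrightarrow> h n (s, w) \<noteq> 0"
    by metis
  have cross: "g n p * h m p = g m p * h n p" if "p \<in> U n" "p \<in> U m" for n m p
  proof -
    have op: "open (U n \<inter> U m)" using U by auto
    show ?thesis
    proof (rule holomorphic2_on_identity[where U = "U n \<inter> U m" and V = base and ?p0.0 = "(5, 5)"])
      show "holomorphic2_on (\<lambda>p. g n p * h m p) (U n \<inter> U m)" "holomorphic2_on (\<lambda>p. g m p * h n p) (U n \<inter> U m)"
        by (intro holomorphic2_on_mult; rule holomorphic2_on_subset[OF gh(1) op] holomorphic2_on_subset[OF gh(2) op]; blast)+
      show "convex (U n \<inter> U m)" by (intro convex_Int U)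
      show "open base" unfolding base_def by (rule open_half_space2)
      show "base \<subseteq> U n \<inter> U m" using base_U by blast
      show "(5, 5) \<in> base" by (simp add: base_def)
      show "g n p * h m p = g m p * h n p" if "p \<in> base" for p
      proof -
        obtain s w where p: "p = (s, w)" by fastforce
        have "Re s > 4" "Re w > 4" using that by (auto simp: p base_def)
        then show ?thesis by (simp add: p eq)
      qed
    qed (use that in auto)
  qed
  define ok where "ok = (\<lambda>p n. p \<in> U n \<and> h n p \<noteq> 0)"
  \<comment> \<open>On the quadrant \<open>F\<close> is \<open>f\<close> itself, since the
    denominators may vanish there and agreement with \<open>f\<close> is claimed at every point.
    Elsewhere any index with a nonzero denominator may be chosen; where none exists the value is
    arbitrary.\<close>
  define F where "F = (\<lambda>p. if p \<in> base then f (fst p) (snd p) else g (SOME n. ok p n) p / h (SOME n. ok p n) p)"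
  have F: "F p = g n p / h n p" if "p \<in> U n" "h n p \<noteq> 0" for n p
  proof (cases "p \<in> base")
    case True
    obtain s w where p: "p = (s, w)" by fastforce
    have "Re s > 4" "Re w > 4" using True by (auto simp: p base_def)
    then have "g n p = h n p * f s w" unfolding p by (rule eq)
    then show ?thesis using True that(2) by (simp add: F_def p)
  next
    case False
    define m where "m = (SOME n. ok p n)"
    have "ok p n" using that by (simp add: ok_def)
    then have "ok p m" unfolding m_def by (rule someI)
    then have m: "p \<in> U m" "h m p \<noteq> 0" by (simp_all add: ok_def)
    have "F p = g m p / h m p" using False by (simp add: F_def m_def)
    also have "\<dots> = g n p / h n p"
      using cross[OF that(1) m(1)] m(2) that(2) by (simp add: frac_eq_eq)
    finally show ?thesis .
  qed
  have "meromorphic2_on F UNIV"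
    unfolding meromorphic2_on_def
  proof (intro conjI ballI)
    fix p :: "complex \<times> complex"
    obtain n :: nat where n: "real n > max (- Re (fst p)) (- Re (snd p))" using reals_Archimedean2 by blast
    have "p \<in> U n" using n by (auto simp: U_def case_prod_unfold)
    moreover have "connected (U n)" by (intro convex_connected U)
    moreover have "\<exists>q\<in>U n. h n q \<noteq> 0"
    proof (intro bexI)
      \<comment> \<open>A non-integral \<open>w\<close> in the quadrant, where \<open>h n\<close>
        cannot vanish.\<close>
      have "(11 / 2 :: complex) \<notin> \<int>"
      proof
        assume "(11 / 2 :: complex) \<in> \<int>"
        then obtain k :: int where "11 / 2 = (of_int k :: complex)" by (auto elim: Ints_cases)
        then have "of_int 11 = (of_int (2 * k) :: complex)" by (simp add: field_simps)
        then have "11 = 2 * k" by (simp only: of_int_eq_iff)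
        then show False by presburger
      qed
      then show "h n (5, 11 / 2) \<noteq> 0" by (intro nz) auto
      show "(5, 11 / 2) \<in> U n" by (simp add: U_def)
    qed
    ultimately show "\<exists>V g h. p \<in> V \<and> V \<subseteq> UNIV \<and> connected V \<and> holomorphic2_on g V \<and> holomorphic2_on h V \<and>
        (\<exists>q\<in>V. h q \<noteq> 0) \<and> (\<forall>q\<in>V. h q \<noteq> 0 \<longrightarrow> F q = g q / h q)"
      using gh[of n] F by (intro exI[of _ "U n"] exI[of _ "g n"] exI[of _ "h n"]) simp
  qed simp
  moreover have "F (s, w) = f s w" if "Re s > 4" "Re w > 4" for s w
    using that by (simp add: F_def base_def)
  ultimately show ?thesis by blast
qed

theorem theorem1p1:
  shows "\<exists>(A::real) (B::real) F. meromorphic2_on F UNIV \<and>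
    (\<forall>s w. Re s > A \<and> Re w > B \<longrightarrow>
       (\<forall>n. hecke_L_term n s summable_on nonzero_gauss_ideals) \<and>
       double_term s w summable_on (UNIV - {0}) \<and>
       F (s, w) = double_series s w)"
proof -
  have "continues_to double_series x y" for x y
  proof (rule continues_to_cong)
    show "continues_to (\<lambda>s w. (1 / 2) * (lat 0 s 0 + zeta0 (2 * s))
        + 2 powr w * (lat_series s w + zeta0 (2 * s) * zeta0 w)) x y"
      by (intro continues_to_add continues_to_mult continues_to_entire_snd lat_zero_continues_to
          lat_series_continues_to zeta0_continues_to holomorphic_intros) auto
  qed (simp add: double_series_eq)
  then obtain F where F: "meromorphic2_on F UNIV" "\<And>s w. Re s > 4 \<Longrightarrow> Re w > 4 \<Longrightarrow> F (s, w) = double_series s w"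
    using continues_to_imp_meromorphic2[of double_series] by blast
  show ?thesis
  proof (intro exI[of _ 4] exI[of _ F] conjI allI impI F(1))
    fix s w :: complex assume *: "Re s > 4 \<and> Re w > 4"
    show "hecke_L_term n s summable_on nonzero_gauss_ideals" for n
      using * by (intro hecke_L_eq(1)) simp
    show "double_term s w summable_on (UNIV - {0})"
      using * by (intro has_sum_imp_summable[OF double_term_has_sum]) auto
    show "F (s, w) = double_series s w" using * F(2) by blast
  qed
qed

end
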